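(* Let $m\le 13$ be a nonnegative integer, let $n$ be a positive integer, and let $A$ and $B$ be positive semidefinite $n\times n$ matrices. Then the polynomial $$p:=\operatorname{tr}\big((A+tB)^m\big)\in\mathbb{R}[t]$$ has only nonnegative coefficients.
   Context: Positive semidefinite matrices are hermitian complex matrices (including real symmetric ones) with nonnegative eigenvalues. The coefficient of $t^k$ in $p$ is $\operatorname{tr}(S_{m,k}(A,B))$, where $S_{m,k}(A,B)$ is the sum of all words of length $m$ in $A$ and $B$ in which $B$ appears exactly $k$ times (and $A$ exactly $m-k$ times); these coefficients are real for hermitian $A,B$. *)

theory Defs
  imports "Jordan_Normal_Form.Schur_Decomposition"
begin

definition mat_trace :: "'a :: comm_monoid_add mat \<Rightarrow> 'a" where
  "mat_trace A = (\<Sum>i<dim_row A. A $$ (i, i))"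

definition hermitian_mat :: "complex mat \<Rightarrow> bool" where
  "hermitian_mat A \<longleftrightarrow> mat_adjoint A = A"

(* The order on complex is that of HOL-Library.Complex_Order:
   0 \<le> e means that e is real and nonnegative. *)
definition pos_semidef_mat :: "complex mat \<Rightarrow> bool" where
  "pos_semidef_mat A \<longleftrightarrow> hermitian_mat A \<and> (\<forall>e. eigenvalue A e \<longrightarrow> 0 \<le> e)"

(* The matrix A + t B over the polynomial ring in the indeterminate t = [:0, 1:];
   the entries of A and B are embedded as constant polynomials. *)
definition linear_pencil :: "'a :: comm_ring_1 mat \<Rightarrow> 'a mat \<Rightarrow> 'a poly mat" where
  "linear_pencil A B = map_mat (\<lambda>a. [:a:]) A + [:0, 1:] \<cdot>\<^sub>m map_mat (\<lambda>b. [:b:]) B"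

end

theory Submission
  imports "HOL-Probability.Probability_Measure" Defs
begin

text \<open>Let \<open>A\<close> and \<open>B\<close> be positive semidefinite, let \<open>M = A + i B\<close> with eigenvalues \<open>w\<^sub>j\<close>, and
let \<open>A\<^sub>t = cos t A + sin t B\<close>. For a point \<open>z\<close> of the complex plane put
\<open>\<langle>z, t\<rangle> = Re z cos t + Im z sin t\<close>. An eigenvalue of \<open>M\<close> has the form \<open>v\<^sup>*Av + i v\<^sup>*Bv\<close> with a unit
vector \<open>v\<close>, so it lies in the closed first quadrant, and the sum of the
\<open>(Re w\<^sub>j + s Im w\<^sub>j)\<^sup>m\<close> is a polynomial in \<open>s\<close> with nonnegative coefficients. It remains to treat the
difference between \<open>tr ((A + s B)\<^sup>m)\<close> and this sum. The idea is to write it as an integral, against a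
nonnegative density on the quadrant, of polynomials in \<open>s\<close> with nonnegative coefficients. The density is
\<open>V(z)\<close>, the mean over the angle \<open>t\<close> of
\<open>ln \<bar>det (\<langle>z, t\<rangle> - A\<^sub>t)\<bar>\<close> minus the sum of the \<open>ln \<bar>\<langle>z, t\<rangle> - \<langle>w\<^sub>j, t\<rangle>\<bar>\<close>.

The sign of \<open>V\<close> (lemmas \<open>jensen_poly\<close>, \<open>mean_ln_det\<close>, \<open>potential_gap\<close>). With \<open>N = z - M\<close> one has
\<open>2 e\<^sup>i\<^sup>t (\<langle>z, t\<rangle> - A\<^sub>t) = N + e\<^sup>2\<^sup>i\<^sup>t N\<^sup>*\<close>. Hence the determinant is, up to a factor of constant
modulus, the value at \<open>e\<^sup>2\<^sup>i\<^sup>t\<close> of a polynomial with constant term \<open>det N\<close>, and Jensen's inequality gives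
\<open>V \<ge> 0\<close>. If \<open>z\<close> is outside the quadrant, then \<open>v\<^sup>*Nv\<close> never vanishes, which forces all roots of the
polynomial onto the unit circle, and equality holds in Jensen's inequality: \<open>V(z) = 0\<close>.

The moments of \<open>V\<close> (lemma \<open>potential_difference\<close>). Let \<open>m \<ge> 2\<close>. In polar coordinates \<open>z = r e\<^sup>i\<^sup>x\<close>, the
integral of \<open>r\<close> to the power \<open>m - 1\<close> times \<open>cos (x - p)\<close> to the power \<open>m - 2\<close> times \<open>V\<close> (with the
angle normalised) is \<open>1 / (m (m - 1))\<close> times the difference between \<open>tr (A\<^sub>p\<^sup>m)\<close> and the sum of the \<open>\<langle>w\<^sub>j, p\<rangle>\<^sup>m\<close>. Indeed, as a
function of \<open>x\<close>, the kernel \<open>ln \<bar>r cos (x - t) - l\<bar>\<close> has Fourier coefficients that are Chebyshev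
polynomials of \<open>l/r\<close> if \<open>\<bar>l\<bar> \<le> r\<close>, with a hyperbolic correction if \<open>\<bar>l\<bar> > r\<close> (\<open>ln_cos_mode\<close>). After
integration over \<open>r\<close>, the coefficient of frequency \<open>j\<close> is a polynomial of degree at most \<open>j\<close> in \<open>l\<close> plus a
multiple of \<open>l\<^sup>m\<close> (\<open>radial_excess\<close>). The polynomials cancel, because \<open>tr (A\<^sub>t\<^sup>i)\<close> and the sum of the
\<open>\<langle>w\<^sub>j, t\<rangle>\<^sup>i\<close> are trigonometric polynomials of degree \<open>i\<close> with the same extreme coefficients, both coming from
\<open>tr (M\<^sup>i)\<close> (\<open>trig_gap_spectra\<close>). The multiples of \<open>l\<^sup>m\<close> combine to a Dirichlet kernel, which evaluates the
difference of power sums at the angle \<open>p\<close> (\<open>trig_gap_reproduce\<close>).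

Finally, expand \<open>cos (x - p) = cos x cos p + sin x sin p\<close> by the binomial theorem and put \<open>s = tan p\<close>: the
difference becomes \<open>1 + s\<^sup>2\<close> times a polynomial in \<open>s\<close> whose coefficients are integrals of \<open>V\<close> against
monomials in \<open>cos x\<close> and \<open>sin x\<close>. These are nonnegative, since \<open>V\<close> lives on the quadrant.\<close>

hide_const (open) Determinants.det

section \<open>Quadratic forms of hermitian matrices\<close>

lemma mat_adjoint_carrier [simp]: "A \<in> carrier_mat n k \<Longrightarrow> mat_adjoint A \<in> carrier_mat k n"
  unfolding mat_adjoint_def by auto

lemma mat_adjoint_dim [simp]:
  "dim_row (mat_adjoint A) = dim_col A" "dim_col (mat_adjoint A) = dim_row A"
  unfolding mat_adjoint_def by auto

lemma mat_adjoint_index: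
  fixes A :: "complex mat"
  shows "i < dim_col A \<Longrightarrow> j < dim_row A \<Longrightarrow> mat_adjoint A $$ (i, j) = cnj (A $$ (j, i))"
  unfolding mat_adjoint_def by (auto simp: mat_of_rows_index conjugate_complex_def)

lemma inner_mult_mat_vec:
  fixes A :: "complex mat"
  assumes A: "A \<in> carrier_mat n n" and v: "v \<in> carrier_vec n" and w: "w \<in> carrier_vec n"
  shows "(A *\<^sub>v v) \<bullet>c w = (\<Sum>i<n. \<Sum>j<n. A $$ (i, j) * v $ j * cnj (w $ i))"
proof -
  have "(A *\<^sub>v v) \<bullet>c w = (\<Sum>i<n. (\<Sum>j<n. A $$ (i, j) * v $ j) * cnj (w $ i))"
    using assms by (auto simp: scalar_prod_def lessThan_atLeast0 intro!: sum.cong)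
  thus ?thesis by (simp add: sum_distrib_right)
qed

lemma inner_mult_adjoint:
  fixes A :: "complex mat"
  assumes A: "A \<in> carrier_mat n n" and v: "v \<in> carrier_vec n" and w: "w \<in> carrier_vec n"
  shows "(mat_adjoint A *\<^sub>v v) \<bullet>c w = cnj ((A *\<^sub>v w) \<bullet>c v)"
proof -
  have *: "mat_adjoint A \<in> carrier_mat n n" using A by simp
  have "(mat_adjoint A *\<^sub>v v) \<bullet>c w = (\<Sum>i<n. \<Sum>j<n. cnj (A $$ (j, i)) * v $ j * cnj (w $ i))"
    unfolding inner_mult_mat_vec[OF * v w] using A by (auto intro!: sum.cong simp: mat_adjoint_index)
  also have "\<dots> = cnj ((A *\<^sub>v w) \<bullet>c v)"
    unfolding inner_mult_mat_vec[OF A w v] by (subst sum.swap) (simp add: mult_ac)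
  finally show ?thesis .
qed

text \<open>Linear in the first vector and conjugate linear in the second one, as \<open>\<bullet>c\<close> is.\<close>
definition form :: "complex mat \<Rightarrow> complex vec \<Rightarrow> complex vec \<Rightarrow> complex" where
  "form A v w = (A *\<^sub>v v) \<bullet>c w"

lemma form_sum:
  assumes "A \<in> carrier_mat n n" "v \<in> carrier_vec n" "w \<in> carrier_vec n"
  shows "form A v w = (\<Sum>i<n. \<Sum>j<n. A $$ (i, j) * v $ j * cnj (w $ i))"
  unfolding form_def using inner_mult_mat_vec assms .

lemma form_add_mat:
  assumes "A \<in> carrier_mat n n" "B \<in> carrier_mat n n" "v \<in> carrier_vec n" "w \<in> carrier_vec n"
  shows "form (A + B) v w = form A v w + form B v w"
  unfolding form_def using assms
  by (simp add: add_mult_distrib_mat_vec[of _ n n] add_scalar_prod_distrib[of _ n])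

lemma form_smult_mat:
  assumes "A \<in> carrier_mat n n" "v \<in> carrier_vec n" "w \<in> carrier_vec n"
  shows "form (c \<cdot>\<^sub>m A) v w = c * form A v w"
proof -
  have "c \<cdot>\<^sub>m A \<in> carrier_mat n n" using assms by simp
  hence "form (c \<cdot>\<^sub>m A) v w = (\<Sum>i<n. \<Sum>j<n. c * (A $$ (i, j) * v $ j * cnj (w $ i)))"
    using assms by (simp only: form_sum) (auto intro!: sum.cong)
  thus ?thesis using assms by (simp add: form_sum[where n = n] sum_distrib_left)
qed

lemma form_one:
  assumes "v \<in> carrier_vec n"
  shows "form (1\<^sub>m n) v w = v \<bullet>c w"
  unfolding form_def using assms by simp

lemma form_add_left:
  assumes "A \<in> carrier_mat n n" "v \<in> carrier_vec n" "v' \<in> carrier_vec n" "w \<in> carrier_vec n"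
  shows "form A (v + v') w = form A v w + form A v' w"
  unfolding form_def using assms
  by (simp add: mult_add_distrib_mat_vec[of _ n n] add_scalar_prod_distrib[of _ n])

lemma form_smult_left:
  assumes "A \<in> carrier_mat n n" "v \<in> carrier_vec n" "w \<in> carrier_vec n"
  shows "form A (c \<cdot>\<^sub>v v) w = c * form A v w"
  unfolding form_def using assms by (simp add: mult_mat_vec)

lemma form_adjoint:
  assumes "A \<in> carrier_mat n n" "v \<in> carrier_vec n" "w \<in> carrier_vec n"
  shows "form (mat_adjoint A) v w = cnj (form A w v)"
  unfolding form_def using inner_mult_adjoint assms .

lemma norm_sq_vec:
  fixes v :: "complex vec"
  assumes "v \<in> carrier_vec n"
  shows "v \<bullet>c v = complex_of_real (\<Sum>i<n. (cmod (v $ i))\<^sup>2)"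
  using assms by (auto simp: scalar_prod_def lessThan_atLeast0 complex_norm_square simp del: of_real_power intro!: sum.cong)

lemma norm_sq_vec_pos:
  fixes v :: "complex vec"
  assumes v: "v \<in> carrier_vec n" and v0: "v \<noteq> 0\<^sub>v n"
  shows "0 < Re (v \<bullet>c v)" "Im (v \<bullet>c v) = 0"
proof -
  define S where "S = (\<Sum>i<n. (cmod (v $ i))\<^sup>2)"
  have S: "v \<bullet>c v = complex_of_real S" unfolding S_def by (rule norm_sq_vec[OF v])
  have "v \<bullet>c v \<noteq> 0" using conjugate_square_eq_0_vec[OF v] v0 by blast
  hence "S \<noteq> 0" unfolding S by simp
  moreover have "0 \<le> S" unfolding S_def by (rule sum_nonneg) simp
  ultimately have "S > 0" by simp
  thus "0 < Re (v \<bullet>c v)" "Im (v \<bullet>c v) = 0" unfolding S by simp_all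
qed

lemma form_eigenvector:
  assumes A: "A \<in> carrier_mat n n" and "eigenvector A v e"
  shows "v \<in> carrier_vec n" "v \<noteq> 0\<^sub>v n" "form A v v = e * (v \<bullet>c v)"
  using assms unfolding eigenvector_def form_def by auto

lemma form_hermitian_commute:
  assumes "A \<in> carrier_mat n n" "hermitian_mat A" "v \<in> carrier_vec n" "w \<in> carrier_vec n"
  shows "form A v w = cnj (form A w v)"
  using form_adjoint[of A n v w] assms unfolding hermitian_mat_def by simp

lemma form_hermitian_real:
  assumes "A \<in> carrier_mat n n" "hermitian_mat A" "v \<in> carrier_vec n"
  shows "Im (form A v v) = 0"
proof -
  have "Im (form A v v) = Im (cnj (form A v v))"
    using form_hermitian_commute[OF assms(1,2,3,3)] by (rule arg_cong)
  thus ?thesis by simp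
qed

lemma hermitian_add:
  assumes "A \<in> carrier_mat n n" "B \<in> carrier_mat n n" "hermitian_mat A" "hermitian_mat B"
  shows "hermitian_mat (A + B)"
proof -
  have "mat_adjoint (A + B) = mat_adjoint A + mat_adjoint B"
    by (rule eq_matI) (use assms(1,2) in \<open>auto simp: mat_adjoint_index\<close>)
  thus ?thesis using assms unfolding hermitian_mat_def by simp
qed

lemma hermitian_smult:
  assumes "A \<in> carrier_mat n n" "hermitian_mat A"
  shows "hermitian_mat (complex_of_real c \<cdot>\<^sub>m A)"
proof -
  have "mat_adjoint (complex_of_real c \<cdot>\<^sub>m A) = complex_of_real c \<cdot>\<^sub>m mat_adjoint A"
    by (rule eq_matI) (use assms(1) in \<open>auto simp: mat_adjoint_index\<close>)
  thus ?thesis using assms unfolding hermitian_mat_def by simp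
qed

lemma hermitian_one: "hermitian_mat (1\<^sub>m n)"
proof -
  have "mat_adjoint (1\<^sub>m n) = (1\<^sub>m n :: complex mat)"
    by (rule eq_matI) (auto simp: mat_adjoint_index)
  thus ?thesis unfolding hermitian_mat_def .
qed

lemma hermitian_eigenvalue_real:
  assumes A: "A \<in> carrier_mat n n" and h: "hermitian_mat A" and e: "eigenvalue A e"
  shows "Im e = 0"
proof -
  from e obtain v where v: "eigenvector A v e" unfolding eigenvalue_def by blast
  note v' = form_eigenvector[OF A v]
  have "0 = Im (e * (v \<bullet>c v))" using form_hermitian_real[OF A h v'(1)] v'(3) by simp
  thus ?thesis using norm_sq_vec_pos[OF v'(1,2)] by simp
qed


lemma inner_commute:
  fixes v w :: "complex vec"
  assumes "v \<in> carrier_vec n" "w \<in> carrier_vec n"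
  shows "v \<bullet>c w = cnj (w \<bullet>c v)"
  using assms by (simp add: scalar_prod_def mult.commute)

lemma form_cmod_le:
  assumes A: "A \<in> carrier_mat n n" and v: "v \<in> carrier_vec n"
  shows "cmod (form A v v) \<le> (\<Sum>i<n. \<Sum>j<n. cmod (A $$ (i, j))) * Re (v \<bullet>c v)"
proof -
  define S where "S = (\<Sum>i<n. (cmod (v $ i))\<^sup>2)"
  have S: "Re (v \<bullet>c v) = S" unfolding S_def norm_sq_vec[OF v] by simp
  have le: "(cmod (v $ i))\<^sup>2 \<le> S" if "i < n" for i
    unfolding S_def by (rule member_le_sum) (use that in auto)
  have le2: "cmod (v $ j) * cmod (v $ i) \<le> S" if "i < n" "j < n" for i j
  proof -
    have "2 * (cmod (v $ j) * cmod (v $ i)) \<le> (cmod (v $ j))\<^sup>2 + (cmod (v $ i))\<^sup>2"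
      using sum_squares_bound[of "cmod (v $ j)" "cmod (v $ i)"] by (simp add: mult_ac)
    with le[OF that(1)] le[OF that(2)] show ?thesis by linarith
  qed
  have "cmod (form A v v) \<le> (\<Sum>i<n. cmod (\<Sum>j<n. A $$ (i, j) * v $ j * cnj (v $ i)))"
    unfolding form_sum[OF A v v] by (rule norm_sum)
  also have "\<dots> \<le> (\<Sum>i<n. \<Sum>j<n. cmod (A $$ (i, j) * v $ j * cnj (v $ i)))"
    by (intro sum_mono norm_sum)
  also have "\<dots> \<le> (\<Sum>i<n. \<Sum>j<n. cmod (A $$ (i, j)) * S)"
    by (intro sum_mono) (use le2 in \<open>auto simp: norm_mult mult.assoc intro!: mult_left_mono\<close>)
  finally show ?thesis unfolding S by (simp add: sum_distrib_right)
qed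

text \<open>Let \<open>t\<close> be the least shift for which the form of \<open>H = A + t\<close> is nonnegative. If \<open>t\<close> were positive,
then \<open>H\<close> would be invertible, as \<open>- t\<close> is no eigenvalue. A nonnegative form of an invertible matrix dominates
a positive multiple of the squared norm, so \<open>t\<close> could be decreased.\<close>
lemma hermitian_form_nonneg:
  assumes A: "A \<in> carrier_mat n n" and h: "hermitian_mat A"
    and ev: "\<And>e. eigenvalue A e \<Longrightarrow> 0 \<le> Re e" and v: "v \<in> carrier_vec n"
  shows "0 \<le> Re (form A v v)"
proof -
  define S where "S = {t. 0 \<le> t \<and> (\<forall>v \<in> carrier_vec n. 0 \<le> Re (form A v v) + t * Re (v \<bullet>c v))}"
  define t0 where "t0 = Inf S"
  have pos: "0 \<le> Re (v \<bullet>c v)" if "v \<in> carrier_vec n" for v :: "complex vec"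
    unfolding norm_sq_vec[OF that] by (auto intro!: sum_nonneg)
  define K where "K = (\<Sum>i<n. \<Sum>j<n. cmod (A $$ (i, j)))"
  have "K \<ge> 0" unfolding K_def by (intro sum_nonneg) auto
  have "K \<in> S" unfolding S_def
  proof (intro CollectI conjI ballI)
    fix v :: "complex vec" assume v: "v \<in> carrier_vec n"
    have "\<bar>Re (form A v v)\<bar> \<le> K * Re (v \<bullet>c v)"
      using form_cmod_le[OF A v] abs_Re_le_cmod[of "form A v v"] unfolding K_def by linarith
    thus "0 \<le> Re (form A v v) + K * Re (v \<bullet>c v)" by linarith
  qed fact
  have bdd: "bdd_below S" unfolding S_def by (rule bdd_belowI[of _ 0]) auto
  have t0: "t0 \<ge> 0" unfolding t0_def by (rule cInf_greatest) (use \<open>K \<in> S\<close> S_def in auto)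
  have t0S: "0 \<le> Re (form A v v) + t0 * Re (v \<bullet>c v)" if v: "v \<in> carrier_vec n" for v
  proof (cases "Re (v \<bullet>c v) = 0")
    case True
    thus ?thesis using \<open>K \<in> S\<close> v unfolding S_def by auto
  next
    case False
    hence p: "Re (v \<bullet>c v) > 0" using pos[OF v] by simp
    have "- Re (form A v v) / Re (v \<bullet>c v) \<le> t0" unfolding t0_def
    proof (rule cInf_greatest)
      show "S \<noteq> {}" using \<open>K \<in> S\<close> by auto
      fix t assume "t \<in> S"
      hence "0 \<le> Re (form A v v) + t * Re (v \<bullet>c v)" using v unfolding S_def by auto
      thus "- Re (form A v v) / Re (v \<bullet>c v) \<le> t" using p by (simp add: field_simps)
    qed
    thus ?thesis using p by (simp add: field_simps)
  qed
  have "t0 = 0"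
  proof (rule ccontr)
    assume "t0 \<noteq> 0"
    hence t0p: "t0 > 0" using t0 by simp
    define H where "H = A + complex_of_real t0 \<cdot>\<^sub>m 1\<^sub>m n"
    have H: "H \<in> carrier_mat n n" unfolding H_def using A by simp
    have hH: "hermitian_mat H" unfolding H_def
      by (intro hermitian_add[of _ n] hermitian_smult[of _ n] A h hermitian_one) simp_all
    have formH: "form H v w = form A v w + t0 * (v \<bullet>c w)"
      if "v \<in> carrier_vec n" "w \<in> carrier_vec n" for v w
      unfolding H_def using A that
      by (simp add: form_add_mat[where n = n] form_smult_mat[where n = n] form_one)
    have "\<not> eigenvalue A (- complex_of_real t0)" using ev[of "- complex_of_real t0"] t0p by auto
    hence d: "det H \<noteq> 0" unfolding eigenvalue_det[OF A] char_matrix_def H_def using A by simp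
    define H' where "H' = (1 / det H) \<cdot>\<^sub>m adj_mat H"
    have H': "H' \<in> carrier_mat n n" unfolding H'_def using adj_mat(1)[OF H] by simp
    have HH': "H * H' = 1\<^sub>m n" unfolding H'_def using adj_mat[OF H] H d
      by (simp add: mult_smult_distrib[of _ n n]) (auto intro!: eq_matI)
    define C where "C = (\<Sum>i<n. \<Sum>j<n. cmod (H' $$ (i, j))) + 1"
    have C: "C > 0" unfolding C_def by (intro add_nonneg_pos sum_nonneg) auto
    define d where "d = min t0 (1 / C)"
    have "t0 - d \<in> S" unfolding S_def
    proof (intro CollectI conjI ballI)
      show "0 \<le> t0 - d" unfolding d_def by simp
      fix v :: "complex vec" assume v: "v \<in> carrier_vec n"
      \<comment> \<open>The form of \<open>H\<close> at \<open>v - w / C\<close> with \<open>Hw = v\<close> is nonnegative; this bounds the form at \<open>v\<close> from below.\<close>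
      define w where "w = H' *\<^sub>v v"
      define s where "s = Re (v \<bullet>c v)"
      have s: "v \<bullet>c v = complex_of_real s" unfolding s_def norm_sq_vec[OF v] by simp
      have s0: "s \<ge> 0" unfolding s_def by (rule pos[OF v])
      have w: "w \<in> carrier_vec n" unfolding w_def using H' v by simp
      have Hw: "H *\<^sub>v w = v" unfolding w_def
        using assoc_mult_mat_vec[OF H H' v] HH' v by simp
      have wv: "form H w v = s" unfolding form_def Hw s ..
      have vw: "form H v w = s" using form_hermitian_commute[OF H hH v w] wv by simp
      have "form H w w = v \<bullet>c (H' *\<^sub>v v)" unfolding form_def Hw unfolding w_def ..
      also have "\<dots> = cnj (form H' v v)" unfolding form_def
        by (rule inner_commute[of _ n]) (use H' v in auto)
      finally have "cmod (form H w w) \<le> (C - 1) * s"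
        using form_cmod_le[OF H' v] unfolding C_def s_def by simp
      hence ww: "Re (form H w w) \<le> C * s"
        using complex_Re_le_cmod[of "form H w w"] s0 by (simp add: algebra_simps)
      define c where "c = complex_of_real (- 1 / C)"
      have c: "Re c = - 1 / C" "Im c = 0" "cnj c = c" unfolding c_def by auto
      have cw: "c \<cdot>\<^sub>v w \<in> carrier_vec n" using w by simp
      have vcw: "v + c \<cdot>\<^sub>v w \<in> carrier_vec n" using v cw by simp
      have right: "form H x (v + c \<cdot>\<^sub>v w) = form H x v + c * form H x w"
        if x: "x \<in> carrier_vec n" for x
      proof -
        have "form H x (v + c \<cdot>\<^sub>v w) = cnj (form H (v + c \<cdot>\<^sub>v w) x)"
          by (rule form_hermitian_commute[OF H hH x vcw])
        also have "\<dots> = cnj (form H v x) + c * cnj (form H w x)"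
          using H v w cw x by (simp add: form_add_left[where n = n] form_smult_left[where n = n] c)
        finally show ?thesis
          using c form_hermitian_commute[OF H hH x v] form_hermitian_commute[OF H hH x w] by simp
      qed
      have "form H (v + c \<cdot>\<^sub>v w) (v + c \<cdot>\<^sub>v w)
          = form H v v + c * s + c * (s + c * form H w w)"
        using H v w cw vcw
        by (simp add: form_add_left[where n = n] form_smult_left[where n = n] right wv vw)
      hence "Re (form H (v + c \<cdot>\<^sub>v w) (v + c \<cdot>\<^sub>v w))
          = Re (form H v v) - 2 * s / C + Re (form H w w) / C\<^sup>2"
        by (simp only: plus_complex.sel times_complex.sel c Re_complex_of_real Im_complex_of_real)
          (use C in \<open>simp add: power2_eq_square field_simps\<close>)
      moreover have "0 \<le> Re (form H (v + c \<cdot>\<^sub>v w) (v + c \<cdot>\<^sub>v w))"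
        using t0S[OF vcw] formH[OF vcw vcw] by simp
      moreover have "Re (form H w w) / C\<^sup>2 \<le> s / C"
        using ww C by (simp add: power2_eq_square field_simps)
      ultimately have "s / C \<le> Re (form H v v)" by simp
      moreover have "Re (form H v v) = Re (form A v v) + t0 * s"
        unfolding formH[OF v v] s by simp
      moreover have "d * s \<le> (1 / C) * s" unfolding d_def by (rule mult_right_mono) (use s0 in auto)
      ultimately show "0 \<le> Re (form A v v) + (t0 - d) * Re (v \<bullet>c v)"
        unfolding s_def[symmetric] by (simp add: algebra_simps)
    qed
    hence "t0 \<le> t0 - d" unfolding t0_def using bdd by (simp add: cInf_lower)
    moreover have "d > 0" unfolding d_def using t0p C by simp
    ultimately show False by simp
  qed
  thus ?thesis using t0S[OF v] by simp
qed

section \<open>Spectra, traces and linear pencils\<close>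

lemma mat_trace_carrier: "A \<in> carrier_mat n k \<Longrightarrow> mat_trace A = (\<Sum>i<n. A $$ (i, i))"
  unfolding mat_trace_def by auto

lemma mat_trace_commute:
  fixes A B :: "'a :: comm_ring_1 mat"
  assumes "A \<in> carrier_mat n k" "B \<in> carrier_mat k n"
  shows "mat_trace (A * B) = mat_trace (B * A)"
proof -
  have "mat_trace (A * B) = (\<Sum>i<n. \<Sum>j<k. A $$ (i, j) * B $$ (j, i))"
    using assms by (auto simp: mat_trace_carrier[of _ n n] mat_trace_carrier[of _ k k] scalar_prod_def lessThan_atLeast0 intro!: sum.cong)
  also have "\<dots> = (\<Sum>j<k. \<Sum>i<n. B $$ (j, i) * A $$ (i, j))"
    by (subst sum.swap) (simp add: mult.commute)
  also have "\<dots> = mat_trace (B * A)"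
    using assms by (auto simp: mat_trace_carrier[of _ n n] mat_trace_carrier[of _ k k] scalar_prod_def lessThan_atLeast0 intro!: sum.cong)
  finally show ?thesis .
qed

lemma upper_triangular_pow:
  fixes A :: "'a :: comm_ring_1 mat"
  assumes A: "A \<in> carrier_mat n n" and ut: "upper_triangular A"
  shows "upper_triangular (A ^\<^sub>m k) \<and> (\<forall>i<n. (A ^\<^sub>m k) $$ (i, i) = (A $$ (i, i)) ^ k)"
proof (induction k)
  case 0
  show ?case using A by (auto simp: upper_triangular_def)
next
  case (Suc k)
  let ?B = "A ^\<^sub>m k"
  have B: "?B \<in> carrier_mat n n" using A by (rule pow_carrier_mat)
  have B0: "?B $$ (i, j) = 0" if "j < i" "i < n" for i j
    using Suc that B unfolding upper_triangular_def by auto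
  have A0: "A $$ (i, j) = 0" if "j < i" "i < n" for i j
    using ut that A unfolding upper_triangular_def by auto
  have idx: "(?B * A) $$ (i, j) = (\<Sum>l<n. ?B $$ (i, l) * A $$ (l, j))" if "i < n" "j < n" for i j
    using A B that by (auto simp: scalar_prod_def lessThan_atLeast0 intro!: sum.cong)
  have "(?B * A) $$ (i, j) = 0" if "j < i" "i < n" for i j
  proof -
    have "?B $$ (i, l) * A $$ (l, j) = 0" if "l < n" for l
      using B0[of l i] A0[of j l] that \<open>j < i\<close> \<open>i < n\<close> by (cases "l < i") auto
    thus ?thesis using that idx by (auto intro!: sum.neutral)
  qed
  moreover have "(?B * A) $$ (i, i) = (A $$ (i, i)) ^ Suc k" if i: "i < n" for i
  proof -
    have "(\<Sum>l<n. ?B $$ (i, l) * A $$ (l, i)) = (\<Sum>l\<in>{i}. ?B $$ (i, l) * A $$ (l, i))"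
    proof (rule sum.mono_neutral_right)
      show "\<forall>l\<in>{..<n} - {i}. ?B $$ (i, l) * A $$ (l, i) = 0"
      proof
        fix l assume "l \<in> {..<n} - {i}"
        thus "?B $$ (i, l) * A $$ (l, i) = 0"
          using B0[of l i] A0[of i l] i by (cases "l < i") auto
      qed
    qed (use i in auto)
    thus ?thesis using idx[OF i i] Suc i by simp
  qed
  ultimately show ?case using A B by (auto simp: upper_triangular_def)
qed

text \<open>A triangular matrix similar to \<open>A\<close> shows that one and the same list, its diagonal, governs the traces
of all powers and the characteristic polynomial.\<close>
lemma complex_mat_spectrum:
  fixes A :: "complex mat"
  assumes A: "A \<in> carrier_mat n n"
  obtains es where "length es = n" "\<And>k. mat_trace (A ^\<^sub>m k) = (\<Sum>e\<leftarrow>es. e ^ k)"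
    "\<And>c. det (c \<cdot>\<^sub>m 1\<^sub>m n - A) = (\<Prod>e\<leftarrow>es. c - e)" "\<And>e. e \<in> set es \<Longrightarrow> eigenvalue A e"
proof -
  obtain es where cp: "char_poly A = (\<Prod>e\<leftarrow>es. [:- e, 1:])" and len: "length es = n"
    using char_poly_factorized[OF A] by auto
  obtain B P Q where sd: "schur_decomposition A es = (B, P, Q)" by (cases "schur_decomposition A es")
  note S = schur_decomposition[OF A cp sd]
  have sim: "similar_mat_wit A B P Q" and ut: "upper_triangular B" and dg: "diag_mat B = es" using S by auto
  note simD = similar_mat_witD2[OF A sim]
  have tr: "mat_trace (A ^\<^sub>m k) = (\<Sum>e\<leftarrow>es. e ^ k)" for k
  proof -
    have simk: "similar_mat_wit (A ^\<^sub>m k) (B ^\<^sub>m k) P Q" by (rule similar_mat_wit_pow[OF sim])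
    note simkD = similar_mat_witD2[OF pow_carrier_mat[OF A] simk]
    have "mat_trace (A ^\<^sub>m k) = mat_trace (P * (B ^\<^sub>m k * Q))"
      using simkD by (simp add: assoc_mult_mat[of _ n n _ n _ n])
    also have "\<dots> = mat_trace (B ^\<^sub>m k * Q * P)"
      by (rule mat_trace_commute[of _ n n]) (use simkD in auto)
    also have "B ^\<^sub>m k * Q * P = B ^\<^sub>m k"
      using simkD by (simp add: assoc_mult_mat[of _ n n _ n _ n] right_mult_one_mat[of _ n n] del: pow_mat_dim)
    also have "mat_trace (B ^\<^sub>m k) = (\<Sum>i<n. (B $$ (i, i)) ^ k)"
      using upper_triangular_pow[OF simD(5) ut, of k] mat_trace_carrier[OF simkD(5)] by simp
    also have "\<dots> = (\<Sum>e\<leftarrow>es. e ^ k)"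
      unfolding dg[symmetric] diag_mat_def using simD(5)
      by (simp add: sum_list_sum_nth lessThan_atLeast0)
    finally show ?thesis .
  qed
  have dt: "det (c \<cdot>\<^sub>m 1\<^sub>m n - A) = (\<Prod>e\<leftarrow>es. c - e)" for c
  proof -
    have "c \<cdot>\<^sub>m 1\<^sub>m n - A = - (char_matrix A c)"
      by (rule eq_matI) (use A in \<open>auto simp: char_matrix_def\<close>)
    hence "det (c \<cdot>\<^sub>m 1\<^sub>m n - A) = poly (char_poly A) c" using char_poly_matrix[OF A, of c] by simp
    also have "\<dots> = (\<Prod>e\<leftarrow>es. c - e)" unfolding cp poly_prod_list by (simp add: o_def)
    finally show ?thesis .
  qed
  have "eigenvalue A e" if "e \<in> set es" for e
    unfolding eigenvalue_root_char_poly[OF A] cp poly_prod_list using that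
    by (auto simp: prod_list_zero_iff)
  with len tr dt show ?thesis by (rule that)
qed


lemma linear_pencil_carrier:
  "A \<in> carrier_mat n n \<Longrightarrow> B \<in> carrier_mat n n \<Longrightarrow> linear_pencil A B \<in> carrier_mat n n"
  unfolding linear_pencil_def by auto

lemma comm_ring_hom_poly: "comm_ring_hom (\<lambda>p. poly p (s :: 'a :: comm_ring_1))"
  by unfold_locales auto

lemma linear_pencil_eval:
  assumes "A \<in> carrier_mat n n" "B \<in> carrier_mat n n"
  shows "map_mat (\<lambda>p. poly p s) (linear_pencil A B) = A + s \<cdot>\<^sub>m B"
  by (rule eq_matI) (use assms in \<open>auto simp: linear_pencil_def\<close>)

lemma poly_mat_trace_linear_pencil:
  assumes A: "A \<in> carrier_mat n n" and B: "B \<in> carrier_mat n n"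
  shows "poly (mat_trace (linear_pencil A B ^\<^sub>m m)) s = mat_trace ((A + s \<cdot>\<^sub>m B) ^\<^sub>m m)"
proof -
  have hom: "semiring_hom (\<lambda>p. poly p s)" by unfold_locales auto
  have L: "linear_pencil A B \<in> carrier_mat n n" using linear_pencil_carrier A B .
  have "poly (mat_trace (linear_pencil A B ^\<^sub>m m)) s
      = mat_trace (map_mat (\<lambda>p. poly p s) (linear_pencil A B ^\<^sub>m m))"
    using pow_carrier_mat[OF L, of m] by (simp add: mat_trace_carrier[of _ n n] poly_sum del: pow_mat_dim)
  thus ?thesis unfolding semiring_hom.mat_hom_pow[OF hom L] linear_pencil_eval[OF A B] .
qed

lemma poly_det_linear_pencil:
  assumes A: "A \<in> carrier_mat n n" and B: "B \<in> carrier_mat n n"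
  shows "poly (det (linear_pencil A B)) s = det (A + s \<cdot>\<^sub>m B)"
  using comm_ring_hom.hom_det[OF comm_ring_hom_poly, of s "linear_pencil A B"]
  unfolding linear_pencil_eval[OF A B] by simp

lemma linear_pencil_pow_coeff:
  fixes A B :: "'a :: comm_ring_1 mat"
  assumes A: "A \<in> carrier_mat n n" and B: "B \<in> carrier_mat n n" and "i < n" "j < n"
  shows "degree ((linear_pencil A B ^\<^sub>m m) $$ (i, j)) \<le> m \<and>
         coeff ((linear_pencil A B ^\<^sub>m m) $$ (i, j)) m = (B ^\<^sub>m m) $$ (i, j)"
  using assms(3,4)
proof (induction m arbitrary: i j)
  case 0
  thus ?case using A B linear_pencil_carrier[OF A B] by auto
next
  case (Suc m)
  let ?L = "linear_pencil A B"
  have L: "?L \<in> carrier_mat n n" using linear_pencil_carrier A B .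
  have Lm: "?L ^\<^sub>m m \<in> carrier_mat n n" and Bm: "B ^\<^sub>m m \<in> carrier_mat n n"
    using pow_carrier_mat L B by blast+
  have entry: "?L $$ (l, j) = [:A $$ (l, j), B $$ (l, j):]" if "l < n" for l
    using that Suc.prems A B unfolding linear_pencil_def by auto
  have deg1: "degree (?L $$ (l, j)) \<le> 1" if "l < n" for l unfolding entry[OF that] by simp
  have prod: "(?L ^\<^sub>m Suc m) $$ (i, j) = (\<Sum>l<n. (?L ^\<^sub>m m) $$ (i, l) * ?L $$ (l, j))"
    using L Lm Suc.prems by (auto simp: scalar_prod_def lessThan_atLeast0 intro!: sum.cong)
  have deg: "degree ((?L ^\<^sub>m m) $$ (i, l) * ?L $$ (l, j)) \<le> Suc m" if "l < n" for l
    using degree_mult_le[of "(?L ^\<^sub>m m) $$ (i, l)" "?L $$ (l, j)"] Suc.IH[OF Suc.prems(1) that] deg1[OF that]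
    by simp
  have co: "coeff ((?L ^\<^sub>m m) $$ (i, l) * ?L $$ (l, j)) (Suc m) = (B ^\<^sub>m m) $$ (i, l) * B $$ (l, j)"
    if "l < n" for l
    using Suc.IH[OF Suc.prems(1) that] by (simp add: entry[OF that] coeff_eq_0)
  have "coeff ((?L ^\<^sub>m Suc m) $$ (i, j)) (Suc m) = (\<Sum>l<n. (B ^\<^sub>m m) $$ (i, l) * B $$ (l, j))"
    unfolding prod coeff_sum by (rule sum.cong) (use co in auto)
  also have "\<dots> = (B ^\<^sub>m Suc m) $$ (i, j)"
    using B Bm Suc.prems by (auto simp: scalar_prod_def lessThan_atLeast0 intro!: sum.cong)
  finally show ?case unfolding prod using deg by (auto intro!: degree_sum_le)
qed

lemma mat_trace_linear_pencil_coeff: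
  fixes A B :: "'a :: comm_ring_1 mat"
  assumes A: "A \<in> carrier_mat n n" and B: "B \<in> carrier_mat n n"
  shows "degree (mat_trace (linear_pencil A B ^\<^sub>m m)) \<le> m"
    "coeff (mat_trace (linear_pencil A B ^\<^sub>m m)) m = mat_trace (B ^\<^sub>m m)"
    "coeff (mat_trace (linear_pencil A B ^\<^sub>m m)) 0 = mat_trace (A ^\<^sub>m m)"
proof -
  have L: "linear_pencil A B ^\<^sub>m m \<in> carrier_mat n n"
    using pow_carrier_mat[OF linear_pencil_carrier[OF A B]] .
  note C = linear_pencil_pow_coeff[OF A B]
  show "degree (mat_trace (linear_pencil A B ^\<^sub>m m)) \<le> m"
    unfolding mat_trace_carrier[OF L] using C by (auto intro!: degree_sum_le)
  show "coeff (mat_trace (linear_pencil A B ^\<^sub>m m)) m = mat_trace (B ^\<^sub>m m)"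
    unfolding mat_trace_carrier[OF L] mat_trace_carrier[OF pow_carrier_mat[OF B]]
    using C by (auto simp: coeff_sum)
  have "0 \<cdot>\<^sub>m B = 0\<^sub>m n n" using B by auto
  hence "A + 0 \<cdot>\<^sub>m B = A" using A by simp
  thus "coeff (mat_trace (linear_pencil A B ^\<^sub>m m)) 0 = mat_trace (A ^\<^sub>m m)"
    using poly_mat_trace_linear_pencil[OF A B, of m 0] by (simp add: poly_0_coeff_0)
qed

section \<open>Fourier coefficients of the logarithm on the unit circle\<close>

text \<open>The uniform distribution of an angle. As a density, and not a restriction, of Lebesgue measure it keeps
all Borel sets measurable.\<close>
definition circle :: "real measure" where
  "circle = density lborel (\<lambda>x. ennreal (indicator {0..2 * pi} x / (2 * pi)))"

lemma sets_circle [measurable_cong, simp]: "sets circle = sets borel"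
  unfolding circle_def by simp

lemma space_circle [simp]: "space circle = UNIV"
  unfolding circle_def by simp

lemma borel_measurable_cis [measurable]: "cis \<in> borel_measurable borel"
  by (intro borel_measurable_continuous_onI continuous_intros)

lemma integral_circle:
  fixes f :: "real \<Rightarrow> 'b :: {banach, second_countable_topology}"
  assumes "f \<in> borel_measurable borel"
  shows "integral\<^sup>L circle f = (1 / (2 * pi)) *\<^sub>R set_lebesgue_integral lborel {0..2 * pi} f"
proof -
  have "integral\<^sup>L circle f = (\<integral>x. (indicator {0..2 * pi} x / (2 * pi)) *\<^sub>R f x \<partial>lborel)"
    unfolding circle_def by (rule integral_density) (use assms in auto)
  also have "(\<lambda>x. (indicator {0..2 * pi} x / (2 * pi)) *\<^sub>R f x)
      = (\<lambda>x. (1 / (2 * pi)) *\<^sub>R (indicator {0..2 * pi} x *\<^sub>R f x))" by simp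
  finally show ?thesis
    unfolding set_lebesgue_integral_def integral_scaleR_right[symmetric] .
qed

lemma prob_space_circle: "prob_space circle"
proof
  have "emeasure circle (space circle) = (\<integral>\<^sup>+x. ennreal (1 / (2 * pi)) * indicator {0..2 * pi} x \<partial>lborel)"
    unfolding circle_def by (subst emeasure_density) (auto intro!: nn_integral_cong split: split_indicator)
  also have "\<dots> = ennreal (1 / (2 * pi)) * ennreal (2 * pi)"
    by (subst nn_integral_cmult_indicator) auto
  also have "\<dots> = 1" by (subst ennreal_mult[symmetric]) auto
  finally show "emeasure circle (space circle) = 1" .
qed

interpretation circle: prob_space circle by (rule prob_space_circle)

lemma AE_circle:
  assumes "AE x in lborel. P x" shows "AE x in circle. P x"
  unfolding circle_def by (subst AE_density) (use assms in auto)

lemma integrable_circle_bounded: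
  fixes f :: "real \<Rightarrow> 'b :: {banach, second_countable_topology}"
  assumes "f \<in> borel_measurable borel" "\<And>x. norm (f x) \<le> B"
  shows "integrable circle f"
  by (rule circle.integrable_const_bound[of _ B]) (use assms in auto)

lemma integrable_bounded_mult:
  fixes f g :: "'a \<Rightarrow> real"
  assumes g: "integrable M g" and f [measurable]: "f \<in> borel_measurable M" and b: "\<And>x. \<bar>f x\<bar> \<le> 1"
  shows "integrable M (\<lambda>x. f x * g x)"
proof (rule Bochner_Integration.integrable_bound[OF g])
  have [measurable]: "g \<in> borel_measurable M" using g by (rule borel_measurable_integrable)
  show "(\<lambda>x. f x * g x) \<in> borel_measurable M" by measurable
  show "AE x in M. norm (f x * g x) \<le> norm (g x)"
    using b by (auto simp: abs_mult intro!: AE_I2 mult_left_le_one_le)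
qed

lemma integral_circle_cis:
  "(\<integral>x. cis (of_int k * x) \<partial>circle) = (if k = 0 then 1 else 0)"
proof (cases "k = 0")
  case True
  thus ?thesis using circle.prob_space by simp
next
  case False
  define F where "F x = cis (of_int k * x) / (\<i> * of_int k)" for x
  have "((\<lambda>x. cis (of_int k * x)) has_integral (F (2 * pi) - F 0)) {0..2 * pi}"
  proof (rule fundamental_theorem_of_calculus)
    fix x :: real
    show "(F has_vector_derivative cis (of_int k * x)) (at x within {0..2 * pi})"
      unfolding F_def has_vector_derivative_def
      using False by (auto intro!: derivative_eq_intros ext simp: scaleR_conv_of_real field_simps)
  qed simp
  moreover have "F (2 * pi) = F 0"
  proof -
    have "cis (of_int k * (2 * pi)) = cis (2 * pi * of_int k)" by (simp add: mult.commute)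
    also have "\<dots> = 1" by (rule cis_multiple_2pi) simp
    finally show ?thesis unfolding F_def by simp
  qed
  ultimately have HI: "((\<lambda>x. cis (of_int k * x)) has_integral 0) {0..2 * pi}" by simp
  have "set_integrable lborel {0..2 * pi} (\<lambda>x. cis (of_int k * x))"
    by (rule borel_integrable_atLeastAtMost') (intro continuous_intros)
  from set_borel_integral_eq_integral(2)[OF this] integral_unique[OF HI]
  show ?thesis using False by (subst integral_circle) auto
qed

lemma integral_circle_cos:
  "(\<integral>x. cos (of_int k * x + b) \<partial>circle) = (if k = 0 then cos b else 0)"
proof -
  have int: "integrable circle (\<lambda>x. cis b * cis (of_int k * x))"
    by (rule integrable_circle_bounded[of _ 1]) (auto simp: norm_mult)
  have "(\<integral>x. cos (of_int k * x + b) \<partial>circle) = (\<integral>x. Re (cis b * cis (of_int k * x)) \<partial>circle)"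
    by (intro Bochner_Integration.integral_cong) (auto simp: cis_mult add.commute)
  also have "\<dots> = Re (\<integral>x. cis b * cis (of_int k * x) \<partial>circle)" using int by (rule integral_Re)
  also have "\<dots> = (if k = 0 then cos b else 0)" by (simp add: integral_circle_cis)
  finally show ?thesis .
qed

lemma AE_circle_cis_neq: "AE x in circle. cis x \<noteq> c"
proof (rule AE_circle)
  have "countable {x. cis x = c}"
  proof (cases "\<exists>y. cis y = c")
    case True
    then obtain y where y: "cis y = c" by blast
    have "{x. cis x = c} \<subseteq> range (\<lambda>n :: int. y + 2 * pi * of_int n)"
    proof
      fix x assume "x \<in> {x. cis x = c}"
      hence "sin x = sin y \<and> cos x = cos y" using y by (auto simp: complex_eq_iff)
      thus "x \<in> range (\<lambda>n :: int. y + 2 * pi * of_int n)" unfolding sin_cos_eq_iff by auto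
    qed
    thus ?thesis by (rule countable_subset) auto
  qed auto
  hence "{x. cis x = c} \<in> null_sets lborel" by (rule countable_imp_null_set_lborel)
  from AE_not_in[OF this] show "AE x in lborel. cis x \<noteq> c" by simp
qed

lemma ln_norm_one_minus:
  assumes "norm (w :: complex) < 1"
  shows "(\<lambda>k. - Re (w ^ Suc k) / Suc k) sums ln (norm (1 - w))"
proof -
  have "(\<lambda>n. (-1) ^ Suc n / of_nat n * (- w) ^ n) sums Ln (1 + (- w))"
    by (rule Ln_series) (use assms in simp)
  also have "(\<lambda>n. (-1) ^ Suc n / of_nat n * (- w) ^ n) = (\<lambda>n. - (w ^ n) / of_nat n)"
  proof
    fix n
    have "(- 1) ^ n * (- w) ^ n = w ^ n" unfolding power_mult_distrib[symmetric] by simp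
    thus "(-1) ^ Suc n / of_nat n * (- w) ^ n = - (w ^ n) / of_nat n" by (simp add: field_simps)
  qed
  finally have "(\<lambda>n. - (w ^ n) / of_nat n) sums Ln (1 - w)" by simp
  from sums_Re[OF this] have "(\<lambda>n. Re (- (w ^ n) / of_nat n)) sums Re (Ln (1 - w))" .
  moreover have "1 - w \<noteq> 0" using assms by auto
  ultimately have "(\<lambda>n. Re (- (w ^ n) / of_nat n)) sums ln (norm (1 - w))" by simp
  hence "(\<lambda>n. Re (- (w ^ Suc n) / of_nat (Suc n))) sums ln (norm (1 - w))"
    by (subst sums_Suc_iff) simp
  thus ?thesis by (simp only: Re_divide_of_nat uminus_complex.sel)
qed

text \<open>Inside the disc the logarithmic series converges uniformly in \<open>x\<close>, and orthogonality selects its term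
of index \<open>j\<close>. For \<open>j = 0\<close> the right-hand side is a division by zero, hence \<open>0\<close>: the series has no constant
term.\<close>
lemma integral_ln_one_minus_aux:
  assumes z: "norm z < 1"
  shows "(\<integral>x. cos (real j * x - a) * ln (norm (1 - z * cis x)) \<partial>circle)
      = - Re (cis a * z ^ j) / (2 * real j)"
proof -
  define f where "f k x = cos (real j * x - a) * (- Re ((z * cis x) ^ Suc k) / Suc k)" for k x
  have [measurable]: "f k \<in> borel_measurable borel" for k
    unfolding f_def by (intro borel_measurable_continuous_onI continuous_intros) auto
  have bnd: "norm (f k x) \<le> norm z ^ Suc k" for k x
  proof -
    have "\<bar>Re ((z * cis x) ^ Suc k)\<bar> \<le> norm z ^ Suc k"
      using abs_Re_le_cmod[of "(z * cis x) ^ Suc k"] by (simp add: norm_power norm_mult del: power_Suc)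
    hence "\<bar>Re ((z * cis x) ^ Suc k)\<bar> / Suc k \<le> norm z ^ Suc k / 1"
      by (intro frac_le) auto
    moreover have "\<bar>cos (real j * x - a)\<bar> \<le> 1" by simp
    ultimately have "\<bar>cos (real j * x - a)\<bar> * (\<bar>Re ((z * cis x) ^ Suc k)\<bar> / Suc k) \<le> 1 * (norm z ^ Suc k / 1)"
      by (intro mult_mono) auto
    thus ?thesis unfolding f_def
      by (simp only: real_norm_def abs_mult abs_divide abs_minus_cancel abs_of_nat div_by_1 mult_1)
  qed
  have int: "integrable circle (f k)" for k
    by (rule integrable_circle_bounded[of _ "norm z ^ Suc k"]) (use bnd in auto)
  have sm: "summable (\<lambda>k. norm z ^ Suc k)" using z by (simp add: summable_geometric)
  have val: "(\<integral>x. f k x \<partial>circle) = (if Suc k = j then - Re (cis a * z ^ j) / (2 * real j) else 0)" for k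
  proof -
    define rho where "rho = norm z" 
    define b where "b = Arg z"
    have zz: "z = rho * cis b" unfolding rho_def b_def by (metis rcis_cmod_Arg rcis_def)
    have e: "f k x = - (rho ^ Suc k / (2 * Suc k)) * (cos (of_int (int j + int (Suc k)) * x + (Suc k * b - a))
            + cos (of_int (int j - int (Suc k)) * x + (- a - Suc k * b)))" for x
    proof -
      have "(z * cis x) ^ Suc k = rho ^ Suc k * cis (Suc k * (b + x))"
        unfolding zz by (simp only: power_mult_distrib mult.assoc cis_mult) (simp only: Complex.DeMoivre of_real_power)
      hence "Re ((z * cis x) ^ Suc k) = rho ^ Suc k * cos (Suc k * (b + x))"
        by (simp del: power_Suc of_nat_Suc)
      moreover have "cos (real j * x - a) * cos (Suc k * (b + x)) =
         (cos (real j * x - a + Suc k * (b + x)) + cos (real j * x - a - Suc k * (b + x))) / 2"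
        by (simp add: cos_add cos_diff)
      ultimately show ?thesis unfolding f_def
        by (simp add: algebra_simps add_divide_distrib)
    qed
    have i: "integrable circle (\<lambda>x. cos (of_int m * x + c))" for m c
      by (rule integrable_circle_bounded[of _ 1]) auto
    have "(\<integral>x. f k x \<partial>circle) = - (rho ^ Suc k / (2 * Suc k)) * ((if int j + int (Suc k) = 0 then cos (Suc k * b - a) else 0)
        + (if int j - int (Suc k) = 0 then cos (- a - Suc k * b) else 0))"
      unfolding e by (subst integral_mult_right_zero, subst Bochner_Integration.integral_add[OF i i])
        (simp only: integral_circle_cos)
    also have "\<dots> = (if Suc k = j then - (rho ^ j / (2 * j)) * cos (a + j * b) else 0)"
      by (auto simp: cos_minus[of "a + j * b", symmetric])
    also have "- (rho ^ j / (2 * j)) * cos (a + j * b) = - Re (cis a * z ^ j) / (2 * real j)"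
    proof -
      have "z ^ j = of_real (rho ^ j) * cis (j * b)"
        unfolding zz power_mult_distrib Complex.DeMoivre by simp
      hence "cis a * z ^ j = of_real (rho ^ j) * cis (a + j * b)" by (simp add: cis_mult mult_ac)
      thus ?thesis by simp
    qed
    finally show ?thesis .
  qed
  have "(\<lambda>k. f k x) sums (cos (real j * x - a) * ln (norm (1 - z * cis x)))" for x
    unfolding f_def by (intro sums_mult ln_norm_one_minus) (use z in \<open>simp add: norm_mult\<close>)
  hence "(\<integral>x. cos (real j * x - a) * ln (norm (1 - z * cis x)) \<partial>circle) = (\<integral>x. (\<Sum>k. f k x) \<partial>circle)"
    by (simp add: sums_iff)
  also have "\<dots> = (\<Sum>k. \<integral>x. f k x \<partial>circle)"
  proof (rule integral_suminf)
    show "integrable circle (f k)" for k by (rule int)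
    show "AE x in circle. summable (\<lambda>i. norm (f i x))"
      by (intro AE_I2 summable_comparison_test'[OF sm, of 0]) (use bnd in auto)
    show "summable (\<lambda>i. \<integral>x. norm (f i x) \<partial>circle)"
    proof (rule summable_comparison_test'[OF sm, of 0])
      fix k
      have "(\<integral>x. norm (f k x) \<partial>circle) \<le> (\<integral>x. norm z ^ Suc k \<partial>circle)"
        by (rule integral_mono) (use int bnd in \<open>auto simp del: power_Suc\<close>)
      thus "norm (\<integral>x. norm (f k x) \<partial>circle) \<le> norm z ^ Suc k"
        using circle.prob_space by (simp del: power_Suc)
    qed
  qed
  also have "\<dots> = (\<Sum>k. if Suc k = j then - Re (cis a * z ^ j) / (2 * real j) else 0)"
    unfolding val ..
  also have "\<dots> = - Re (cis a * z ^ j) / (2 * real j)"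
  proof (cases j)
    case (Suc i)
    have "(\<lambda>k. if k = i then - Re (cis a * z ^ j) / (2 * real j) else 0) sums (- Re (cis a * z ^ j) / (2 * real j))"
      using sums_single[of i "\<lambda>_. - Re (cis a * z ^ j) / (2 * real j)"] by simp
    thus ?thesis using Suc by (simp add: sums_iff)
  qed simp
  finally show ?thesis .
qed

lemma integrable_ln_one_minus_aux:
  assumes z: "norm z < 1"
  shows "integrable circle (\<lambda>x. ln (norm (1 - z * cis x)))"
proof (rule integrable_circle_bounded)
  show "norm (ln (norm (1 - z * cis x))) \<le> max (ln 2) (- ln (1 - norm z))" for x
  proof -
    have 1: "norm (1 - z * cis x) \<le> 2"
      using norm_triangle_ineq4[of 1 "z * cis x"] z by (simp add: norm_mult)
    have 2: "norm (1 - z * cis x) \<ge> 1 - norm z"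
      using norm_triangle_ineq2[of 1 "z * cis x"] by (simp add: norm_mult)
    have "ln (norm (1 - z * cis x)) \<le> ln 2" "ln (norm (1 - z * cis x)) \<ge> ln (1 - norm z)"
      using 1 2 z by (auto intro!: ln_mono)
    thus ?thesis by (auto simp: abs_if)
  qed
qed measurable

text \<open>On the unit circle the logarithm is unbounded. Approach \<open>z\<close> along the radius by \<open>\<rho>z\<close>: the functions
\<open>ln 2 - ln \<bar>1 - \<rho>ze\<^sup>i\<^sup>x\<bar>\<close> are nonnegative with mean \<open>ln 2\<close>, so Fatou's lemma yields integrability of the limit,
and the inequality \<open>\<bar>1 - w\<bar> \<le> 2 \<bar>1 - \<rho>w\<bar>\<close> for \<open>\<bar>w\<bar> = 1\<close> makes the limit a dominating function.\<close>
lemma ln_one_minus_boundary: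
  assumes z: "norm z = 1"
  shows "integrable circle (\<lambda>x. ln (norm (1 - z * cis x)))" (is "integrable circle ?g")
    and "(\<integral>x. cos (real j * x - a) * ln (norm (1 - z * cis x)) \<partial>circle)
      = - Re (cis a * z ^ j) / (2 * real j)"
proof -
  define rho where "rho n = (1 - inverse (real (Suc n)))" for n
  have rho: "0 \<le> rho n" "rho n < 1" for n unfolding rho_def by (auto simp: inverse_le_1_iff)
  have rho_lim: "rho \<longlonglongrightarrow> 1" 
    unfolding rho_def using tendsto_diff[OF tendsto_const[of 1] LIMSEQ_inverse_real_of_nat] by simp
  define g where "g n x = ln (norm (1 - complex_of_real (rho n) * z * cis x))" for n x
  have zn: "norm (complex_of_real (rho n) * z) < 1" for n using rho[of n] z by (simp add: norm_mult)
  have [measurable]: "g n \<in> borel_measurable borel" for n unfolding g_def by measurable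
  have ig: "integrable circle (g n)" for n unfolding g_def by (rule integrable_ln_one_minus_aux[OF zn])
  have g0: "(\<integral>x. g n x \<partial>circle) = 0" for n
    using integral_ln_one_minus_aux[OF zn, of 0 0 n] unfolding g_def by simp
  have g_le: "g n x \<le> ln 2" for n x
  proof -
    have 1: "norm (1 - complex_of_real (rho n) * z * cis x) \<le> 2"
      using norm_triangle_ineq4[of 1 "complex_of_real (rho n) * z * cis x"] zn[of n] by (simp add: norm_mult)
    have "norm (complex_of_real (rho n) * z * cis x) < 1"
      using zn[of n] by (simp only: norm_mult[of _ "cis x"] norm_cis mult_1_right)
    hence 2: "norm (1 - complex_of_real (rho n) * z * cis x) > 0"
      using norm_triangle_ineq2[of 1 "complex_of_real (rho n) * z * cis x"] by (simp only: norm_one)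
    show ?thesis unfolding g_def by (rule ln_mono) (use 1 2 in linarith)+
  qed
  have ne: "AE x in circle. 1 - z * cis x \<noteq> 0"
  proof -
    have "AE x in circle. cis x \<noteq> 1 / z" by (rule AE_circle_cis_neq)
    moreover have "z \<noteq> 0" using z by auto
    ultimately show ?thesis by (auto elim!: eventually_mono simp: field_simps)
  qed
  have glim: "(\<lambda>n. g n x) \<longlonglongrightarrow> ?g x" if "1 - z * cis x \<noteq> 0" for x
  proof -
    have "(\<lambda>n. norm (1 - complex_of_real (rho n) * z * cis x)) \<longlonglongrightarrow> norm (1 - of_real 1 * z * cis x)"
      by (intro tendsto_intros rho_lim)
    thus ?thesis unfolding g_def using that by (intro tendsto_ln) auto
  qed
  have gm: "?g \<in> borel_measurable circle" by measurable
  have ggm: "g n \<in> borel_measurable circle" for n by simp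
  have "integrable circle (\<lambda>x. ln 2 - ?g x)"
  proof (rule integrableI_nonneg)
    show "AE x in circle. 0 \<le> ln 2 - ?g x"
      using ne
    proof eventually_elim
      case (elim x)
      show ?case using LIMSEQ_le_const2[OF glim[OF elim], of "ln 2"] g_le by auto
    qed
    have "(\<integral>\<^sup>+x. ennreal (ln 2 - ?g x) \<partial>circle) = (\<integral>\<^sup>+x. liminf (\<lambda>n. ennreal (ln 2 - g n x)) \<partial>circle)"
    proof (rule nn_integral_cong_AE)
      show "AE x in circle. ennreal (ln 2 - ?g x) = liminf (\<lambda>n. ennreal (ln 2 - g n x))"
        using ne
      proof eventually_elim
        case (elim x)
        have "(\<lambda>n. ennreal (ln 2 - g n x)) \<longlonglongrightarrow> ennreal (ln 2 - ?g x)"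
          by (intro tendsto_ennrealI tendsto_intros glim elim)
        thus ?case by (simp add: lim_imp_Liminf)
      qed
    qed
    also have "\<dots> \<le> liminf (\<lambda>n. \<integral>\<^sup>+x. ennreal (ln 2 - g n x) \<partial>circle)"
      by (rule nn_integral_liminf) (use ggm in auto)
    also have "(\<lambda>n. \<integral>\<^sup>+x. ennreal (ln 2 - g n x) \<partial>circle) = (\<lambda>n. ennreal (ln 2))"
    proof
      fix n
      have "(\<integral>\<^sup>+x. ennreal (ln 2 - g n x) \<partial>circle) = ennreal (\<integral>x. ln 2 - g n x \<partial>circle)"
        by (rule nn_integral_eq_integral) (use ig g_le in auto)
      also have "(\<integral>x. ln 2 - g n x \<partial>circle) = ln 2" using ig g0 circle.prob_space by simp
      finally show "(\<integral>\<^sup>+x. ennreal (ln 2 - g n x) \<partial>circle) = ennreal (ln 2)" .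
    qed
    finally show "(\<integral>\<^sup>+x. ennreal (ln 2 - ?g x) \<partial>circle) < \<infinity>"
      by (simp add: Liminf_const ennreal_less_top le_less_trans)
  qed (use gm in auto)
  from Bochner_Integration.integrable_diff[OF circle.integrable_const[of "ln 2"] this] show I: "integrable circle ?g" by simp
  have lower: "g n x \<ge> ?g x - ln 2" if "1 - z * cis x \<noteq> 0" for n x
  proof -
    define w where "w = z * cis x"
    have w: "norm w = 1" "1 - w \<noteq> 0" using z that unfolding w_def by (auto simp: norm_mult)
    have "norm (1 - w) \<le> norm (1 - rho n * w) + norm (rho n * w - w)"
      using norm_triangle_ineq[of "1 - rho n * w" "rho n * w - w"] by simp
    also have "norm (rho n * w - w) = 1 - rho n"
    proof -
      have "rho n * w - w = complex_of_real (rho n - 1) * w" by (simp add: algebra_simps)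
      thus ?thesis using w rho[of n] by (simp add: norm_mult del: of_real_diff)
    qed
    also have "1 - rho n \<le> norm (1 - rho n * w)"
      using norm_triangle_ineq2[of 1 "rho n * w"] w rho[of n] by (simp add: norm_mult)
    finally have "norm (1 - w) \<le> 2 * norm (1 - rho n * w)" by simp
    moreover have "norm (1 - w) > 0" using w by simp
    ultimately have "ln (norm (1 - w)) \<le> ln (2 * norm (1 - rho n * w))" by (intro ln_mono) auto
    also have "\<dots> = ln 2 + ln (norm (1 - rho n * w))"
      using \<open>norm (1 - w) \<le> 2 * norm (1 - rho n * w)\<close> \<open>norm (1 - w) > 0\<close> by (intro ln_mult_pos) auto
    finally show ?thesis unfolding g_def w_def by (simp add: mult.assoc)
  qed
  have "(\<lambda>n. \<integral>x. cos (real j * x - a) * g n x \<partial>circle) \<longlonglongrightarrow> (\<integral>x. cos (real j * x - a) * ?g x \<partial>circle)"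
  proof (rule integral_dominated_convergence)
    show "integrable circle (\<lambda>x. ln 2 + ln 2 + \<bar>?g x\<bar>)" using I by auto
    show "AE x in circle. (\<lambda>n. cos (real j * x - a) * g n x) \<longlonglongrightarrow> cos (real j * x - a) * ?g x"
      using ne by eventually_elim (intro tendsto_intros glim)
    show "AE x in circle. norm (cos (real j * x - a) * g n x) \<le> ln 2 + ln 2 + \<bar>?g x\<bar>" for n
      using ne
    proof eventually_elim
      case (elim x)
      have "\<bar>g n x\<bar> \<le> ln 2 + ln 2 + \<bar>?g x\<bar>"
        using g_le[of n x] lower[OF elim, of n] ln_gt_zero[of "2 :: real"] by linarith
      moreover have "\<bar>cos (real j * x - a)\<bar> * \<bar>g n x\<bar> \<le> 1 * \<bar>g n x\<bar>" by (intro mult_right_mono) auto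
      ultimately show ?case by (simp add: abs_mult)
    qed
  qed auto
  moreover have "(\<lambda>n. \<integral>x. cos (real j * x - a) * g n x \<partial>circle) \<longlonglongrightarrow> - Re (cis a * (of_real 1 * z) ^ j) / (2 * real j)" (is ?L)
  proof (cases "j = 0")
    case False
    show ?L unfolding g_def integral_ln_one_minus_aux[OF zn]
      by (intro tendsto_intros rho_lim) (use False in simp)
  next
    case True
    show ?L unfolding g_def integral_ln_one_minus_aux[OF zn] by (simp add: True)
  qed
  ultimately show "(\<integral>x. cos (real j * x - a) * ?g x \<partial>circle) = - Re (cis a * z ^ j) / (2 * real j)"
    using LIMSEQ_unique by fastforce
qed

lemma integrable_ln_one_minus:
  "norm z \<le> 1 \<Longrightarrow> integrable circle (\<lambda>x. ln (norm (1 - z * cis x)))"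
  using integrable_ln_one_minus_aux[of z] ln_one_minus_boundary(1)[of z] by linarith

lemma integral_ln_one_minus:
  "norm z \<le> 1 \<Longrightarrow> (\<integral>x. cos (real j * x - a) * ln (norm (1 - z * cis x)) \<partial>circle)
      = - Re (cis a * z ^ j) / (2 * real j)"
  using integral_ln_one_minus_aux[of z j a] ln_one_minus_boundary(2)[of z j a] by linarith

section \<open>Jensen's inequality for polynomials\<close>

text \<open>Factor out \<open>e\<^sup>i\<^sup>x\<close> if \<open>u\<close> is in the closed unit disc, and \<open>u\<close> otherwise; the other factor has mean
logarithm \<open>0\<close>.\<close>
lemma ln_norm_cis_minus:
  "integrable circle (\<lambda>x. ln (norm (cis x - u)))"
  "(\<integral>x. ln (norm (cis x - u)) \<partial>circle) = max 0 (ln (norm u))"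
proof -
  have "integrable circle (\<lambda>x. ln (norm (cis x - u))) \<and>
     (\<integral>x. ln (norm (cis x - u)) \<partial>circle) = max 0 (ln (norm u))"
  proof (cases "norm u \<le> 1")
    case True
    have e: "norm (cis x - u) = norm (1 - cnj u * cis x)" for x
    proof -
      have "cis x - u = cis x * cnj (1 - cnj u * cis x)"
        by (simp add: algebra_simps cis_cnj cis_mult)
      thus ?thesis by (simp only: norm_mult norm_cis complex_mod_cnj mult_1)
    qed
    have "norm (cnj u) \<le> 1" using True by simp
    note I = integrable_ln_one_minus[OF this] integral_ln_one_minus[OF this, of 0 0]
    have "ln (norm u) \<le> 0" using True by (cases "u = 0") auto
    thus ?thesis unfolding e using I by simp
  next
    case False
    hence u: "u \<noteq> 0" "norm (1 / u) \<le> 1" "norm u > 1" by (auto simp: norm_divide divide_le_eq)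
    have e: "ln (norm (cis x - u)) = ln (norm u) + ln (norm (1 - 1 / u * cis x))" for x
    proof -
      have "cis x \<noteq> u" using False norm_cis[of x] by auto
      hence ne: "1 - 1 / u * cis x \<noteq> 0" using u by (simp add: field_simps)
      have "cis x - u = - u * (1 - 1 / u * cis x)" using u by (simp add: field_simps)
      hence "norm (cis x - u) = norm u * norm (1 - 1 / u * cis x)" by (simp only: norm_mult norm_minus_cancel)
      thus ?thesis using u ne by (simp add: ln_mult_pos)
    qed
    note I = integrable_ln_one_minus[OF u(2)] integral_ln_one_minus[OF u(2), of 0 0]
    have I2: "(\<integral>x. ln (norm (1 - 1 / u * cis x)) \<partial>circle) = 0" using I(2) by simp
    have "ln (norm u) \<ge> 0" using u by simp
    thus ?thesis unfolding e using I(1) circle.prob_space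
      by (simp only: Bochner_Integration.integral_add[OF circle.integrable_const I(1)] I2)
        (auto intro!: Bochner_Integration.integrable_add)
  qed
  thus "integrable circle (\<lambda>x. ln (norm (cis x - u)))"
    "(\<integral>x. ln (norm (cis x - u)) \<partial>circle) = max 0 (ln (norm u))" by auto
qed

lemma AE_circle_cis_double_neq: "AE x in circle. cis (2 * x) \<noteq> w"
proof -
  have "cis (2 * x) = w \<longleftrightarrow> cis x = csqrt w \<or> cis x = - csqrt w" for x
  proof -
    have "cis (2 * x) = (cis x)\<^sup>2" by (simp add: Complex.DeMoivre)
    thus ?thesis using power2_eq_iff[of "cis x" "csqrt w"] by simp
  qed
  moreover have "AE x in circle. cis x \<noteq> csqrt w" "AE x in circle. cis x \<noteq> - csqrt w"
    by (rule AE_circle_cis_neq)+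
  ultimately show ?thesis by auto
qed

text \<open>Split \<open>e\<^sup>2\<^sup>i\<^sup>x - w\<close> into the factors \<open>e\<^sup>i\<^sup>x - u\<close> and \<open>e\<^sup>i\<^sup>x + u\<close> with \<open>u\<^sup>2 = w\<close>.\<close>
lemma ln_norm_cis_double_minus:
  "integrable circle (\<lambda>x. ln (norm (cis (2 * x) - w)))"
  "(\<integral>x. ln (norm (cis (2 * x) - w)) \<partial>circle) = max 0 (ln (norm w))"
proof -
  define u where "u = csqrt w"
  have u2: "u\<^sup>2 = w" unfolding u_def by simp
  let ?f = "\<lambda>x. ln (norm (cis x - u)) + ln (norm (cis x - (- u)))"
  have ae: "AE x in circle. ln (norm (cis (2 * x) - w)) = ?f x"
    using AE_circle_cis_double_neq[of w]
  proof eventually_elim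
    case (elim x)
    have e: "cis (2 * x) - w = (cis x - u) * (cis x - (- u))"
      using u2 Complex.DeMoivre[of x 2] by (simp add: power2_eq_square algebra_simps)
    hence "cis x - u \<noteq> 0" "cis x - (- u) \<noteq> 0" using elim by (metis eq_iff_diff_eq_0 mult_zero_left, metis eq_iff_diff_eq_0 mult_zero_right)
    thus ?case unfolding e norm_mult by (intro ln_mult_pos) auto
  qed
  have I: "integrable circle ?f" by (intro Bochner_Integration.integrable_add ln_norm_cis_minus)
  have m1: "(\<lambda>x. ln (norm (cis (2 * x) - w))) \<in> borel_measurable circle" by measurable
  show "integrable circle (\<lambda>x. ln (norm (cis (2 * x) - w)))"
    by (subst integrable_cong_AE[OF m1 _ ae]) (use I in \<open>auto intro: borel_measurable_integrable\<close>)
  have "(\<integral>x. ln (norm (cis (2 * x) - w)) \<partial>circle) = (\<integral>x. ?f x \<partial>circle)"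
    by (rule integral_cong_AE[OF m1 _ ae]) (use I in \<open>auto intro: borel_measurable_integrable\<close>)
  also have "\<dots> = max 0 (ln (norm u)) + max 0 (ln (norm (- u)))"
    by (simp only: Bochner_Integration.integral_add[OF ln_norm_cis_minus(1) ln_norm_cis_minus(1)] ln_norm_cis_minus(2))
  also have "\<dots> = max 0 (ln (norm w))"
  proof (cases "w = 0")
    case False
    have "norm w = norm u ^ 2" using u2 by (simp add: norm_power[symmetric])
    moreover have "u \<noteq> 0" using False u2 by auto
    ultimately have "ln (norm w) = 2 * ln (norm u)" by (simp add: ln_realpow)
    thus ?thesis by auto
  qed (simp add: u_def)
  finally show "(\<integral>x. ln (norm (cis (2 * x) - w)) \<partial>circle) = max 0 (ln (norm w))" .
qed

text \<open>Each linear factor \<open>y - a\<close> contributes \<open>max 0 (ln \<bar>a\<bar>)\<close> to the mean and \<open>ln \<bar>a\<bar>\<close> to the value at \<open>0\<close>.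
The angle is doubled since the determinants to which this is applied are polynomials in \<open>e\<^sup>2\<^sup>i\<^sup>x\<close>.\<close>
lemma jensen_poly:
  fixes Q :: "complex poly"
  assumes Q0: "poly Q 0 \<noteq> 0"
  shows "integrable circle (\<lambda>x. ln (norm (poly Q (cis (2 * x)))))" (is ?A)
    and "ln (norm (poly Q 0)) \<le> (\<integral>x. ln (norm (poly Q (cis (2 * x)))) \<partial>circle)" (is ?B)
    and "(\<And>a. poly Q a = 0 \<Longrightarrow> norm a = 1) \<Longrightarrow>
       (\<integral>x. ln (norm (poly Q (cis (2 * x)))) \<partial>circle) = ln (norm (poly Q 0))"
    and "AE x in circle. poly Q (cis (2 * x)) \<noteq> 0" (is ?D)
proof -
  from fundamental_theorem_algebra_factorized[of Q] obtain as
    where as: "Polynomial.smult (lead_coeff Q) (\<Prod>a\<leftarrow>as. [:- a, 1:]) = Q" by blast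
  define c where "c = lead_coeff Q"
  have Q: "poly Q y = c * (\<Prod>a\<leftarrow>as. y - a)" for y
    unfolding as[symmetric, folded c_def] by (simp add: poly_prod_list o_def)
  have c0: "c \<noteq> 0" using Q0 Q[of 0] by auto
  have a0: "a \<noteq> 0" if "a \<in> set as" for a
    using Q0 Q[of 0] that by (auto simp: prod_list_zero_iff)
  have lnprod: "ln (norm (\<Prod>a\<leftarrow>as'. y - a)) = (\<Sum>a\<leftarrow>as'. ln (norm (y - a)))"
    if "\<And>a. a \<in> set as' \<Longrightarrow> y \<noteq> a" for y :: complex and as'
    using that
  proof (induction as')
    case (Cons a as')
    hence "(\<Prod>a\<leftarrow>as'. y - a) \<noteq> 0" by (auto simp: prod_list_zero_iff)
    thus ?case using Cons by (simp add: norm_mult ln_mult_pos)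
  qed simp
  have lnQ: "ln (norm (poly Q y)) = ln (norm c) + (\<Sum>a\<leftarrow>as. ln (norm (y - a)))"
    if "\<And>a. a \<in> set as \<Longrightarrow> y \<noteq> a" for y
  proof -
    have "(\<Prod>a\<leftarrow>as. y - a) \<noteq> 0" using that by (auto simp: prod_list_zero_iff)
    thus ?thesis unfolding Q using c0 lnprod[OF that] by (simp add: norm_mult ln_mult_pos)
  qed
  have ae1: "AE x in circle. \<forall>a\<in>set as. cis (2 * x) \<noteq> a"
    by (rule AE_finite_allI) (use AE_circle_cis_double_neq in auto)
  show ?D using ae1 by eventually_elim (auto simp: Q c0 prod_list_zero_iff)
  let ?f = "\<lambda>x. ln (norm c) + (\<Sum>a\<leftarrow>as. ln (norm (cis (2 * x) - a)))"
  have ae: "AE x in circle. ln (norm (poly Q (cis (2 * x)))) = ?f x"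
    using ae1 by eventually_elim (rule lnQ, auto)
  have I0: "integrable circle (\<lambda>x. \<Sum>a\<leftarrow>as'. ln (norm (cis (2 * x) - a))) \<and>
     (\<integral>x. (\<Sum>a\<leftarrow>as'. ln (norm (cis (2 * x) - a))) \<partial>circle) = (\<Sum>a\<leftarrow>as'. max 0 (ln (norm a)))" for as'
    by (induction as') (auto simp: ln_norm_cis_double_minus)
  hence I: "integrable circle ?f" by auto
  have m1: "(\<lambda>x. ln (norm (poly Q (cis (2 * x))))) \<in> borel_measurable circle"
  proof -
    have "(\<lambda>x. poly Q (cis (2 * x))) \<in> borel_measurable borel"
      by (intro borel_measurable_continuous_onI continuous_intros)
    hence "(\<lambda>x. poly Q (cis (2 * x))) \<in> borel_measurable circle" by simp
    thus ?thesis by measurable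
  qed
  show ?A
    by (subst integrable_cong_AE[OF m1 _ ae]) (use I in \<open>auto intro: borel_measurable_integrable\<close>)
  have "(\<integral>x. ln (norm (poly Q (cis (2 * x)))) \<partial>circle) = (\<integral>x. ?f x \<partial>circle)"
    by (rule integral_cong_AE[OF m1 _ ae]) (use I in \<open>auto intro: borel_measurable_integrable\<close>)
  also have "\<dots> = ln (norm c) + (\<Sum>a\<leftarrow>as. max 0 (ln (norm a)))"
    using I0[of as] circle.prob_space by simp
  finally have val: "(\<integral>x. ln (norm (poly Q (cis (2 * x)))) \<partial>circle) = ln (norm c) + (\<Sum>a\<leftarrow>as. max 0 (ln (norm a)))" .
  have val0: "ln (norm (poly Q 0)) = ln (norm c) + (\<Sum>a\<leftarrow>as. ln (norm a))"
    using lnQ[of 0] a0 by auto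
  show ?B unfolding val val0 by (intro add_left_mono sum_list_mono) auto
  show "(\<integral>x. ln (norm (poly Q (cis (2 * x)))) \<partial>circle) = ln (norm (poly Q 0))" if r: "\<And>a. poly Q a = 0 \<Longrightarrow> norm a = 1"
  proof -
    have "norm a = 1" if "a \<in> set as" for a
      by (rule r) (use that in \<open>auto simp: Q prod_list_zero_iff\<close>)
    hence "(\<Sum>a\<leftarrow>as. max 0 (ln (norm a))) = (\<Sum>a\<leftarrow>as. ln (norm a))"
      by (intro arg_cong[of _ _ sum_list] map_cong) auto
    thus ?thesis unfolding val val0 by simp
  qed
qed

text \<open>With \<open>c = cis (x - t)\<close> the function \<open>r cos (x - t) - l\<close> is the product of the constant \<open>- r / (2 z)\<close> and
the two factors \<open>1 - z c\<close> and \<open>1 - z / c\<close>, whose logarithms have known Fourier coefficients.\<close>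
lemma ln_cos_minus:
  fixes z :: complex
  assumes r: "r > 0" and z: "z \<noteq> 0" "norm z \<le> 1" and l: "complex_of_real l = of_real r * (z + 1 / z) / 2"
  shows "integrable circle (\<lambda>x. ln \<bar>r * cos (x - t) - l\<bar>)" (is ?A)
    and "(\<integral>x. cos (real j * x - a) * ln \<bar>r * cos (x - t) - l\<bar> \<partial>circle) =
       (if j = 0 then cos a * ln (r / (2 * norm z)) else - cos (real j * t - a) * Re (z ^ j) / real j)" (is ?B)
    and "AE x in circle. r * cos (x - t) - l \<noteq> 0" (is ?C)
proof -
  define z1 z2 where "z1 = z * cis (- t)" and "z2 = cnj z * cis (- t)"
  have n1: "norm z1 \<le> 1" and n2: "norm z2 \<le> 1" using z unfolding z1_def z2_def by (auto simp: norm_mult)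
  have nz: "z1 \<noteq> 0" "z2 \<noteq> 0" using z by (auto simp: z1_def z2_def)
  have fac: "complex_of_real (r * cos (x - t) - l) = - (of_real r / (2 * z)) * ((1 - z1 * cis x) * cnj (1 - z2 * cis x))" for x
  proof -
    have e1: "z1 * cis x = z * cis (x - t)" unfolding z1_def by (simp add: cis_mult mult.assoc)
    have e2: "cnj (z2 * cis x) = z / cis (x - t)" unfolding z2_def
      by (simp add: cis_mult mult.assoc cis_cnj cis_divide divide_inverse)
    have "(1 - z1 * cis x) * cnj (1 - z2 * cis x) = 1 + z\<^sup>2 - z * (cis (x - t) + 1 / cis (x - t))"
      unfolding complex_cnj_diff complex_cnj_one e1 e2 by (simp add: field_simps power2_eq_square)
    also have "cis (x - t) + 1 / cis (x - t) = 2 * cos (x - t)"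
      by (simp add: complex_eq_iff cis_inverse[symmetric] inverse_eq_divide[symmetric] del: cis_inverse)
    finally have "(1 - z1 * cis x) * cnj (1 - z2 * cis x) = 1 + z\<^sup>2 - z * (2 * cos (x - t))" .
    thus ?thesis using z by (simp only: of_real_diff of_real_mult l) (simp add: field_simps power2_eq_square)
  qed
  have nrm: "\<bar>r * cos (x - t) - l\<bar> = r / (2 * norm z) * (norm (1 - z1 * cis x) * norm (1 - z2 * cis x))" for x
    using arg_cong[OF fac[of x], of norm] r 
    by (simp only: norm_of_real norm_mult norm_minus_cancel complex_mod_cnj norm_divide) simp
  have ne1: "AE x in circle. 1 - z1 * cis x \<noteq> 0"
    using AE_circle_cis_neq[of "1 / z1"] by eventually_elim (use nz in \<open>simp add: field_simps\<close>)
  have ne2: "AE x in circle. 1 - z2 * cis x \<noteq> 0"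
    using AE_circle_cis_neq[of "1 / z2"] by eventually_elim (use nz in \<open>simp add: field_simps\<close>)
  show ?C using ne1 ne2
  proof eventually_elim
    case (elim x)
    thus ?case using nrm[of x] r z by auto
  qed
  let ?f = "\<lambda>x. ln (r / (2 * norm z)) + (ln (norm (1 - z1 * cis x)) + ln (norm (1 - z2 * cis x)))"
  have ae: "AE x in circle. ln \<bar>r * cos (x - t) - l\<bar> = ?f x"
    using ne1 ne2
  proof eventually_elim
    case (elim x)
    moreover have "r / (2 * norm z) > 0" using r z by simp
    ultimately show ?case unfolding nrm by (simp only: ln_mult_pos mult_pos_pos zero_less_norm_iff simp_thms)
  qed
  have m1: "(\<lambda>x. ln \<bar>r * cos (x - t) - l\<bar>) \<in> borel_measurable circle" by measurable
  note I1 = integrable_ln_one_minus[OF n1] and I2 = integrable_ln_one_minus[OF n2]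
  have I: "integrable circle ?f" using I1 I2 by auto
  show ?A by (subst integrable_cong_AE[OF m1 _ ae]) (use I in \<open>auto intro: borel_measurable_integrable\<close>)
  have bc: "integrable circle (\<lambda>x. cos (real j * x - a) * g x)" if "integrable circle g" for g
    by (rule integrable_bounded_mult[OF that]) auto
  have "(\<integral>x. cos (real j * x - a) * ln \<bar>r * cos (x - t) - l\<bar> \<partial>circle) = (\<integral>x. cos (real j * x - a) * ?f x \<partial>circle)"
    by (rule integral_cong_AE) (use m1 I ae in \<open>auto intro: borel_measurable_integrable elim!: eventually_mono\<close>)
  also have "\<dots> = (\<integral>x. cos (real j * x - a) * ln (r / (2 * norm z)) + (cos (real j * x - a) * ln (norm (1 - z1 * cis x))
       + cos (real j * x - a) * ln (norm (1 - z2 * cis x))) \<partial>circle)"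
    by (simp only: distrib_left)
  also have "\<dots> = (\<integral>x. cos (real j * x - a) * ln (r / (2 * norm z)) \<partial>circle) + 
       (- Re (cis a * z1 ^ j) / (2 * real j) + - Re (cis a * z2 ^ j) / (2 * real j))"
    by (subst Bochner_Integration.integral_add, rule bc, simp, intro Bochner_Integration.integrable_add bc I1 I2,
        subst Bochner_Integration.integral_add, rule bc[OF I1], rule bc[OF I2],
        simp only: integral_ln_one_minus[OF n1] integral_ln_one_minus[OF n2])
  also have "(\<integral>x. cos (real j * x - a) * ln (r / (2 * norm z)) \<partial>circle) = (if j = 0 then cos a * ln (r / (2 * norm z)) else 0)"
    using integral_circle_cos[of "int j" "- a"] by simp
  also have "- Re (cis a * z1 ^ j) / (2 * real j) + - Re (cis a * z2 ^ j) / (2 * real j) = - cos (real j * t - a) * Re (z ^ j) / real j"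
  proof -
    have "cis a * z1 ^ j + cis a * z2 ^ j = cis (a - real j * t) * (z ^ j + cnj (z ^ j))"
    proof -
      have e: "cis (real j * - t) * cis a = cis (a - real j * t)" by (simp add: cis_mult algebra_simps)
      thus ?thesis unfolding z1_def z2_def power_mult_distrib Complex.DeMoivre complex_cnj_power e[symmetric]
        by (simp add: algebra_simps)
    qed
    also have "\<dots> = cis (a - real j * t) * of_real (2 * Re (z ^ j))" by (simp only: complex_add_cnj)
    finally have "Re (cis a * z1 ^ j) + Re (cis a * z2 ^ j) = cos (a - real j * t) * (2 * Re (z ^ j))"
    proof -
      assume "cis a * z1 ^ j + cis a * z2 ^ j = cis (a - real j * t) * of_real (2 * Re (z ^ j))"
      from arg_cong[OF this, of Re] show ?thesis by (simp only: plus_complex.sel) simp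
    qed
    also have "cos (a - real j * t) = cos (real j * t - a)" by (metis cos_minus minus_diff_eq)
    finally have "Re (cis a * z1 ^ j) + Re (cis a * z2 ^ j) = cos (real j * t - a) * (2 * Re (z ^ j))" .
    moreover have "- X / (2 * k) + - Y / (2 * k) = - c * R / k" if "X + Y = c * (2 * R)" for X Y c R k :: real
    proof -
      have "- X / (2 * k) + - Y / (2 * k) = - (X + Y) / (2 * k)" by (simp add: add_divide_distrib diff_divide_distrib)
      thus ?thesis unfolding that by simp
    qed
    ultimately show ?thesis by blast
  qed
  finally show ?B by simp
qed

section \<open>Fourier coefficients of the logarithm of an affine function of the cosine\<close>

fun chebyshev :: "nat \<Rightarrow> real poly" where
  "chebyshev 0 = 1"
| "chebyshev (Suc 0) = [:0, 1:]"
| "chebyshev (Suc (Suc j)) = [:0, 2:] * chebyshev (Suc j) - chebyshev j"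

lemma degree_chebyshev: "degree (chebyshev j) \<le> j"
proof (induction j rule: chebyshev.induct)
  case (3 j)
  have "degree ([:0, 2:] * chebyshev (Suc j)) \<le> 1 + Suc j"
    by (rule order_trans[OF degree_mult_le]) (use 3 in auto)
  thus ?case using 3 by (auto intro!: degree_diff_le)
qed auto

lemma poly_chebyshev:
  fixes z :: complex
  assumes "z \<noteq> 0" "complex_of_real y = (z + 1 / z) / 2"
  shows "complex_of_real (poly (chebyshev j) y) = (z ^ j + 1 / z ^ j) / 2"
proof (induction j rule: chebyshev.induct)
  case (3 j)
  have "complex_of_real (poly (chebyshev (Suc (Suc j))) y)
     = 2 * ((z + 1 / z) / 2) * ((z ^ Suc j + 1 / z ^ Suc j) / 2) - (z ^ j + 1 / z ^ j) / 2"
  proof -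
    have "poly (chebyshev (Suc (Suc j))) y = 2 * y * poly (chebyshev (Suc j)) y - poly (chebyshev j) y" by simp
    thus ?thesis using 3 assms(2) by (simp only: of_real_diff of_real_mult of_real_numeral)
  qed
  also have "\<dots> = (z ^ Suc (Suc j) + 1 / z ^ Suc (Suc j)) / 2"
    using assms(1) by (simp add: field_simps)
  finally show ?case .
qed (use assms in auto)

text \<open>The value for \<open>j = 0\<close> is the limit; in all cases the derivative in \<open>u\<close> is \<open>cosh (j u)\<close>.\<close>
definition sinh_quot :: "nat \<Rightarrow> real \<Rightarrow> real" where
  "sinh_quot j u = (if j = 0 then u else sinh (real j * u) / real j)"

text \<open>The argument of \<open>sinh_quot\<close> is the \<open>u\<close> with \<open>L = r cosh u\<close>.\<close>
definition log_excess :: "nat \<Rightarrow> real \<Rightarrow> real \<Rightarrow> real" where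
  "log_excess j L r = sinh_quot j (ln ((L + sqrt (L\<^sup>2 - r\<^sup>2)) / r))"

text \<open>The mean of \<open>cos (j x) ln \<bar>r cos x - l\<bar>\<close> over \<open>x\<close>. The first summand is the correct value for
\<open>\<bar>l\<bar> \<le> r\<close>; if \<open>\<bar>l\<bar> = r cosh u\<close> with \<open>u > 0\<close>, then it involves \<open>cosh (j u)\<close> in place of \<open>e\<^sup>-\<^sup>j\<^sup>u\<close>, and the second
summand makes up for this.\<close>
definition log_mode :: "nat \<Rightarrow> real \<Rightarrow> real \<Rightarrow> real" where
  "log_mode j l r = (if j = 0 then ln (r / 2) else - poly (chebyshev j) (l / r) / real j)
     + (if r < \<bar>l\<bar> then sgn l ^ j * log_excess j \<bar>l\<bar> r else 0)"

text \<open>In the lemma \<open>ln_cos_minus\<close>, take \<open>z = e\<^sup>i\<^sup>\<alpha>\<close> with \<open>l = r cos \<alpha>\<close>, respectively \<open>z = sgn l e\<^sup>-\<^sup>u\<close> with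
\<open>\<bar>l\<bar> = r cosh u\<close>.\<close>
lemma ln_cos_mode:
  assumes r: "r > 0"
  shows "integrable circle (\<lambda>x. ln \<bar>r * cos (x - t) - l\<bar>)"
    and "(\<integral>x. cos (real j * x - a) * ln \<bar>r * cos (x - t) - l\<bar> \<partial>circle) = cos (real j * t - a) * log_mode j l r"
    and "AE x in circle. r * cos (x - t) - l \<noteq> 0"
proof -
  have "integrable circle (\<lambda>x. ln \<bar>r * cos (x - t) - l\<bar>) \<and>
    (\<integral>x. cos (real j * x - a) * ln \<bar>r * cos (x - t) - l\<bar> \<partial>circle) = cos (real j * t - a) * log_mode j l r \<and>
    (AE x in circle. r * cos (x - t) - l \<noteq> 0)"
  proof (cases "\<bar>l\<bar> \<le> r")
    case True
    define z where "z = cis (arccos (l / r))"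
    have lr: "-1 \<le> l / r" "l / r \<le> 1" using True r by (auto simp: field_simps)
    have inv: "1 / z = cnj z" unfolding z_def by (simp add: cis_cnj inverse_eq_divide[symmetric])
    have y: "complex_of_real (l / r) = (z + 1 / z) / 2"
    proof -
      have "Re z = l / r" unfolding z_def using lr by simp
      thus ?thesis unfolding inv complex_add_cnj by simp
    qed
    have z: "z \<noteq> 0" "norm z = 1" unfolding z_def by auto
    have "complex_of_real l = of_real r * of_real (l / r)" using r by simp
    hence l: "complex_of_real l = of_real r * (z + 1 / z) / 2" unfolding y by simp
    have "complex_of_real (poly (chebyshev j) (l / r)) = (z ^ j + cnj (z ^ j)) / 2"
      using poly_chebyshev[OF z(1) y, of j] inv by (metis complex_cnj_power power_one_over)
    hence re: "Re (z ^ j) = poly (chebyshev j) (l / r)" unfolding complex_add_cnj by simp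
    have "norm z \<le> 1" using z by simp
    note L = ln_cos_minus[OF r z(1) this l, where t = t]
    show ?thesis using L(1,3) L(2)[of j a] True
      by (auto simp: log_mode_def re z)
  next
    case False
    define S where "S = sqrt (l\<^sup>2 - r\<^sup>2)"
    define E where "E = (\<bar>l\<bar> + S) / r"
    define s where "s = sgn l"
    have lr: "\<bar>l\<bar> > r" using False by simp
    have s: "s * s = 1" "\<bar>s\<bar> = 1" "s * \<bar>l\<bar> = l" "s \<noteq> 0" using lr r unfolding s_def by (auto simp: sgn_if)
    have "r\<^sup>2 < l\<^sup>2" using lr r by (metis abs_of_pos power2_abs power_strict_mono zero_less_numeral less_imp_le)
    hence S: "S > 0" "S\<^sup>2 = l\<^sup>2 - r\<^sup>2" unfolding S_def by auto
    have E1: "E > 1" unfolding E_def using S lr r by (simp add: field_simps)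
    have invE: "1 / E = (\<bar>l\<bar> - S) / r"
    proof -
      have "(\<bar>l\<bar> - S) * (\<bar>l\<bar> + S) = r\<^sup>2" using S by (simp add: algebra_simps power2_eq_square)
      thus ?thesis unfolding E_def using S lr r by (simp add: field_simps power2_eq_square)
    qed
    define z where "z = complex_of_real (s / E)"
    have z: "z \<noteq> 0" "norm z = 1 / E" "norm z \<le> 1" unfolding z_def norm_of_real using s E1 by (auto simp: field_simps)
    have invz: "1 / z = complex_of_real (s * E)" unfolding z_def using s E1 
      by (simp add: field_simps flip: of_real_mult) 
    have "s / E + s * E = s * (1 / E + E)" by (simp add: algebra_simps)
    also have "1 / E + E = 2 * \<bar>l\<bar> / r" unfolding invE unfolding E_def using r by (simp add: field_simps)
    finally have sE: "s / E + s * E = 2 * l / r" using s by simp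
    have y: "complex_of_real (l / r) = (z + 1 / z) / 2"
      unfolding invz unfolding z_def of_real_add[symmetric] sE using r by simp
    have "complex_of_real l = of_real r * of_real (l / r)" using r by simp
    hence l: "complex_of_real l = of_real r * (z + 1 / z) / 2" unfolding y by simp
    have ex: "log_excess j \<bar>l\<bar> r = sinh_quot j (ln E)" unfolding log_excess_def E_def S_def by simp
    have val: "(if j = 0 then cos a * ln (r / (2 * norm z)) else - cos (real j * t - a) * Re (z ^ j) / real j)
       = cos (real j * t - a) * log_mode j l r"
    proof (cases "j = 0")
      case True
      have "ln (r / (2 * norm z)) = ln (r / 2 * E)" using z E1 by simp
      also have "\<dots> = ln (r / 2) + ln E" using r E1 by (subst ln_mult_pos) auto
      finally show ?thesis using True lr by (simp add: log_mode_def ex[unfolded True] sinh_quot_def)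
    next
      case False
      have zj: "z ^ j = complex_of_real (s ^ j / E ^ j)" "1 / z ^ j = complex_of_real (s ^ j * E ^ j)"
      proof -
        show "z ^ j = complex_of_real (s ^ j / E ^ j)" unfolding z_def by (simp add: power_divide)
        have "1 / z ^ j = (1 / z) ^ j" by (simp only: power_one_over)
        thus "1 / z ^ j = complex_of_real (s ^ j * E ^ j)" unfolding invz by (simp add: power_mult_distrib)
      qed
      have "complex_of_real (poly (chebyshev j) (l / r)) = complex_of_real ((s ^ j / E ^ j + s ^ j * E ^ j) / 2)"
        using poly_chebyshev[OF z(1) y, of j] unfolding zj(2) unfolding zj(1) by (simp only: of_real_add of_real_divide of_real_numeral)
      hence ch: "poly (chebyshev j) (l / r) = (s ^ j / E ^ j + s ^ j * E ^ j) / 2" by (simp only: of_real_eq_iff)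
      have "exp (real j * ln E) = E ^ j" using E1 by (simp add: exp_of_nat_mult)
      hence sh: "sinh (real j * ln E) = (E ^ j - 1 / E ^ j) / 2"
        unfolding sinh_field_def exp_minus by (simp add: inverse_eq_divide)
      have "- Re (z ^ j) / real j = log_mode j l r"
        unfolding log_mode_def ex sinh_quot_def ch sh zj s_def[symmetric] using False lr 
        by (simp add: field_simps)
      thus ?thesis using False by (metis (no_types, opaque_lifting) minus_mult_commute times_divide_eq_right)
    qed
    note L = ln_cos_minus[OF r z(1,3) l, where t = t]
    show ?thesis using L(1,3) L(2)[of j a] unfolding val by blast
  qed
  thus "integrable circle (\<lambda>x. ln \<bar>r * cos (x - t) - l\<bar>)"
    "(\<integral>x. cos (real j * x - a) * ln \<bar>r * cos (x - t) - l\<bar> \<partial>circle) = cos (real j * t - a) * log_mode j l r"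
    "AE x in circle. r * cos (x - t) - l \<noteq> 0" by auto
qed

text \<open>Integration by parts trades a factor \<open>L - x\<close> for a factor \<open>L + x\<close>; the increment of \<open>G\<close> is a Beta
integral.\<close>
lemma beta_antiderivative:
  fixes L :: real
  shows "\<exists>G. (\<forall>x. (G has_real_derivative (L + x) ^ p * (L - x) ^ q) (at x)) \<and>
     G L - G (- L) = (2 * L) ^ (p + q + 1) * (fact p * fact q / fact (p + q + 1))"
proof (induction q arbitrary: p)
  case 0
  let ?G = "\<lambda>x. (L + x) ^ Suc p / real (Suc p)"
  have "(?G has_real_derivative (1 + of_nat p) * (1 * (L + x) ^ p) / real (Suc p)) (at x)" for x
    by (intro DERIV_cdivide DERIV_power_Suc) (auto intro!: derivative_eq_intros)
  thus ?case by (intro exI[of _ ?G]) (auto simp: fact_Suc simp del: power_Suc)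
next
  case (Suc q)
  obtain G where G: "\<And>x. (G has_real_derivative (L + x) ^ Suc p * (L - x) ^ q) (at x)"
    "G L - G (- L) = (2 * L) ^ (Suc p + q + 1) * (fact (Suc p) * fact q / fact (Suc p + q + 1))"
    using Suc[of "Suc p"] by blast
  let ?H = "\<lambda>x. (L + x) ^ Suc p * (L - x) ^ Suc q / real (Suc p) + real (Suc q) / real (Suc p) * G x"
  have "(?H has_real_derivative (L + x) ^ p * (L - x) ^ Suc q) (at x)" for x
  proof -
    define a b k where "a = (L + x) ^ p" and "b = (L - x) ^ q" and "k = real (Suc p)"
    have k: "k \<noteq> 0" "1 + real p = k" unfolding k_def by auto
    have 1: "((\<lambda>x. (L + x) ^ Suc p) has_real_derivative (1 + of_nat p) * (1 * (L + x) ^ p)) (at x)"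
      by (intro DERIV_power_Suc) (auto intro!: derivative_eq_intros)
    have 2: "((\<lambda>x. (L - x) ^ Suc q) has_real_derivative (1 + of_nat q) * ((-1) * (L - x) ^ q)) (at x)"
      by (intro DERIV_power_Suc) (auto intro!: derivative_eq_intros)
    have "(?H has_real_derivative ((1 + of_nat p) * (1 * (L + x) ^ p) * (L - x) ^ Suc q
        + (1 + of_nat q) * ((-1) * (L - x) ^ q) * (L + x) ^ Suc p) / real (Suc p)
        + real (Suc q) / real (Suc p) * ((L + x) ^ Suc p * (L - x) ^ q)) (at x)"
      by (intro DERIV_add DERIV_cdivide DERIV_mult DERIV_cmult 1 2 G(1))
    also have "((1 + of_nat p) * (1 * (L + x) ^ p) * (L - x) ^ Suc q
        + (1 + of_nat q) * ((-1) * (L - x) ^ q) * (L + x) ^ Suc p) / real (Suc p)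
        + real (Suc q) / real (Suc p) * ((L + x) ^ Suc p * (L - x) ^ q) = (L + x) ^ p * (L - x) ^ Suc q"
      unfolding power_Suc a_def[symmetric] b_def[symmetric] k_def[symmetric] k(2)
      using k(1) by (simp add: field_simps)
    finally show ?thesis .
  qed
  moreover have "?H L - ?H (- L) = (2 * L) ^ (p + Suc q + 1) * (fact p * fact (Suc q) / fact (p + Suc q + 1))"
  proof -
    have "?H L - ?H (- L) = real (Suc q) / real (Suc p) * (G L - G (- L))"
      by (simp add: right_diff_distrib del: of_nat_Suc)
    thus ?thesis unfolding G(2) by (simp add: fact_Suc field_simps del: of_nat_Suc)
  qed
  ultimately show ?case by (intro exI[of _ ?H]) auto
qed




text \<open>Integrate by parts, differentiating \<open>log_excess\<close>. In terms of \<open>\<sigma> = sqrt (L\<^sup>2 - r\<^sup>2)\<close> one has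
\<open>re\<^sup>u = L + \<sigma>\<close>, \<open>re\<^sup>-\<^sup>u = L - \<sigma>\<close> and \<open>r\<^sup>2 = (L + \<sigma>) (L - \<sigma>)\<close>. As \<open>m - 2\<close> exceeds \<open>j\<close> by the even number \<open>2q\<close>, the remaining
integrand is a polynomial in \<open>\<sigma>\<close>, and a Beta integral results.\<close>
lemma radial_excess:
  fixes j q :: nat and L :: real
  assumes L: "L > 0"
  defines "m \<equiv> j + 2 * q + 2"
  shows "set_integrable lborel {0<..<L} (\<lambda>r. r ^ (m - 1) * log_excess j L r)"
    and "(LBINT r:{0<..<L}. r ^ (m - 1) * log_excess j L r)
       = L ^ m * 2 ^ (m - 2) * (fact (q + j) * fact q) / (real m * fact (m - 1))"
proof -
  let ?S = "\<lambda>r. sqrt (L\<^sup>2 - r\<^sup>2)"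
  obtain G where G: "\<And>x. (G has_real_derivative (L + x) ^ (q + j) * (L - x) ^ q) (at x)"
    "G L - G (- L) = (2 * L) ^ (m - 1) * (fact (q + j) * fact q / fact (m - 1))"
  proof -
    have "q + j + q + 1 = m - 1" unfolding m_def by simp
    thus ?thesis using that beta_antiderivative[of L "q + j" q] by metis
  qed
  define B where "B x = (G x - G (- x)) / 2" for x
  define U where "U r = ln ((L + ?S r) / r)" for r
  \<comment> \<open>The antiderivative that integration by parts suggests; \<open>B\<close> is the odd antiderivative of the polynomial in \<open>\<sigma>\<close>.\<close>
  define F where "F r = r ^ m / m * sinh_quot j (U r) - L / m * B (?S r)" for r
  define f where "f r = r ^ (m - 1) * sinh_quot j (U r)" for r
  have mpos: "m > 0" unfolding m_def by simp
  have Bd: "(B has_real_derivative ((L + x) ^ (q + j) * (L - x) ^ q + (L - x) ^ (q + j) * (L + x) ^ q) / 2) (at x)" for x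
  proof -
    have "((\<lambda>x. G (- x)) has_real_derivative (L + (- x)) ^ (q + j) * (L - (- x)) ^ q * (- 1)) (at x)"
      by (rule DERIV_chain2[OF G(1)]) (auto intro!: derivative_eq_intros)
    thus ?thesis unfolding B_def using G(1)[of x]
      by (auto intro!: derivative_eq_intros)
  qed
  have E: "0 < ?S r" "(?S r)\<^sup>2 = L\<^sup>2 - r\<^sup>2" "?S r \<le> L" if "0 < r" "r < L" for r
  proof -
    have "r\<^sup>2 < L\<^sup>2" using that by (intro power_strict_mono) auto
    thus "0 < ?S r" "(?S r)\<^sup>2 = L\<^sup>2 - r\<^sup>2" by auto
    show "?S r \<le> L" using L by (intro real_le_lsqrt) auto
  qed
  have Sd: "((?S) has_real_derivative (- r / ?S r)) (at r)"
    if r: "0 < r" "r < L" for r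
  proof -
    have p: "L\<^sup>2 - r\<^sup>2 > 0" using E(1)[OF r] by (simp only: real_sqrt_gt_0_iff)
    have 1: "((\<lambda>r. L\<^sup>2 - r\<^sup>2) has_real_derivative - (2 * r)) (at r)"
      by (auto intro!: derivative_eq_intros)
    from DERIV_chain2[OF DERIV_real_sqrt[OF p] 1] show ?thesis by (simp add: field_simps)
  qed
  have Ud: "(U has_real_derivative - L / (r * ?S r)) (at r)" if r: "0 < r" "r < L" for r
  proof -
    define S where "S = ?S r"
    note E = E[OF r, folded S_def]
    have "(U has_real_derivative (1 / ((L + S) / r) * (((- r / S) * r - (L + S)) / (r * r)))) (at r)"
    proof -
      have p: "(L + S) / r > 0" by (rule divide_pos_pos[OF _ r(1)]) (use E L in linarith)
      have "((\<lambda>r. (L + ?S r) / r) has_real_derivative ((0 + - r / S) * r - (L + S) * 1) / (r * r)) (at r)"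
        unfolding S_def by (intro DERIV_divide DERIV_add DERIV_const Sd DERIV_ident) (use r in auto)
      from DERIV_chain2[OF DERIV_ln[OF p[unfolded S_def]] this] show ?thesis
        unfolding U_def S_def by (simp add: inverse_eq_divide)
    qed
    also have "1 / ((L + S) / r) * (((- r / S) * r - (L + S)) / (r * r)) = - L / (r * S)"
    proof -
      have "r\<^sup>2 + S * (L + S) = L * (L + S)" using E by (simp add: algebra_simps power2_eq_square)
      moreover have "- r / S * r - (L + S) = - (r\<^sup>2 + S * (L + S)) / S"
        using E by (simp add: field_simps power2_eq_square)
      ultimately have "- r / S * r - (L + S) = - (L * (L + S)) / S" by simp
      moreover have "L + S \<noteq> 0" using E L by linarith
      ultimately show ?thesis using r by simp
    qed
    finally show ?thesis unfolding S_def .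
  qed
  have sq: "(sinh_quot j has_real_derivative cosh (real j * u)) (at u)" for u
    unfolding sinh_quot_def[abs_def] by (cases "j = 0") (auto intro!: derivative_eq_intros)
  have coshU: "cosh (real j * U r) = (((L + ?S r) / r) ^ j + ((L - ?S r) / r) ^ j) / 2"
    if r: "0 < r" "r < L" for r
  proof -
    define S where "S = ?S r"
    note E = E[OF r, folded S_def]
    have p: "(L + S) / r > 0" using E L r by simp
    have "exp (real j * U r) = ((L + S) / r) ^ j" unfolding U_def S_def[symmetric] using p by (simp add: exp_of_nat_mult)
    moreover have "1 / ((L + S) / r) = (L - S) / r"
    proof -
      have "(L - S) * (L + S) = r\<^sup>2" using E by (simp add: algebra_simps power2_eq_square)
      thus ?thesis using E L r by (simp add: field_simps power2_eq_square)
    qed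
    hence "inverse (((L + S) / r) ^ j) = ((L - S) / r) ^ j"
      by (metis inverse_eq_divide power_inverse)
    ultimately show ?thesis unfolding cosh_field_def exp_minus S_def by simp
  qed
  have Fd: "(F has_real_derivative f r) (at r)" if r: "0 < r" "r < L" for r
  proof -
    define S where "S = ?S r"
    note E = E[OF r, folded S_def]
    have 1: "((\<lambda>r. sinh_quot j (U r)) has_real_derivative cosh (real j * U r) * (- L / (r * S))) (at r)"
      unfolding S_def by (rule DERIV_chain2[OF sq Ud[OF r]])
    have 2: "((\<lambda>r. B (?S r)) has_real_derivative
        ((L + S) ^ (q + j) * (L - S) ^ q + (L - S) ^ (q + j) * (L + S) ^ q) / 2 * (- r / S)) (at r)"
      unfolding S_def by (rule DERIV_chain2[OF Bd Sd[OF r]])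
    have 3: "((\<lambda>r. r ^ m / m) has_real_derivative r ^ (m - 1)) (at r)"
      using mpos by (auto intro!: derivative_eq_intros)
    have "(F has_real_derivative r ^ (m - 1) * sinh_quot j (U r) + cosh (real j * U r) * (- L / (r * S)) * (r ^ m / m)
        - L / m * (((L + S) ^ (q + j) * (L - S) ^ q + (L - S) ^ (q + j) * (L + S) ^ q) / 2 * (- r / S))) (at r)"
      unfolding F_def using DERIV_diff[OF DERIV_mult[OF 3 1] DERIV_cmult[OF 2, of "L / m"]]
      by (simp add: algebra_simps)
    also have "r ^ (m - 1) * sinh_quot j (U r) + cosh (real j * U r) * (- L / (r * S)) * (r ^ m / m)
        - L / m * (((L + S) ^ (q + j) * (L - S) ^ q + (L - S) ^ (q + j) * (L + S) ^ q) / 2 * (- r / S)) = f r"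
    proof -
      have rr: "r * r = (L + S) * (L - S)" using E by (simp add: algebra_simps power2_eq_square)
      have r2q: "r ^ (2 * q) = (L + S) ^ q * (L - S) ^ q"
        unfolding power_mult power2_eq_square rr power_mult_distrib ..
      have "cosh (real j * U r) * r ^ j = ((L + S) ^ j + (L - S) ^ j) / 2"
        unfolding coshU[OF r] S_def[symmetric] using r by (simp add: power_divide field_simps)
      hence "cosh (real j * U r) * r ^ (j + 2 * q) = ((L + S) ^ j + (L - S) ^ j) / 2 * ((L + S) ^ q * (L - S) ^ q)"
        unfolding power_add r2q by (simp only: mult.assoc[symmetric])
      hence c: "cosh (real j * U r) * r ^ (j + 2 * q) = ((L + S) ^ (q + j) * (L - S) ^ q + (L - S) ^ (q + j) * (L + S) ^ q) / 2"
        by (simp add: power_add algebra_simps)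
      have "cosh (real j * U r) * (- L / (r * S)) * (r ^ m / m) = (- L / m / S * r) * (cosh (real j * U r) * r ^ (j + 2 * q))"
        unfolding m_def using r E by (simp add: field_simps power2_eq_square)
      also have "\<dots> = L / m * (((L + S) ^ (q + j) * (L - S) ^ q + (L - S) ^ (q + j) * (L + S) ^ q) / 2 * (- r / S))"
        unfolding c using E by (simp add: field_simps)
      finally show ?thesis unfolding f_def by simp
    qed
    finally show ?thesis .
  qed
  have isC: "isCont f r" if r: "0 < r" "r < L" for r
  proof -
    have "isCont U r" using Ud[OF r] by (rule DERIV_isCont)
    moreover have "isCont (sinh_quot j) (U r)" using sq by (rule DERIV_isCont)
    ultimately have "isCont (\<lambda>r. sinh_quot j (U r)) r" using isCont_o2 by blast
    thus ?thesis unfolding f_def by (intro continuous_intros)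
  qed
  have Upos: "U r \<ge> 0" if r: "0 < r" "r < L" for r
  proof -
    have "r \<le> L + ?S r" using E(1)[OF r] r by linarith
    hence "1 \<le> (L + ?S r) / r" using r by simp
    thus ?thesis unfolding U_def by (rule ln_ge_zero)
  qed
  have sqpos: "sinh_quot j u \<ge> 0" if "u \<ge> 0" for u
    using that unfolding sinh_quot_def by simp
  have Bc: "isCont B x" for x using Bd by (rule DERIV_isCont)
  have limL: "(F \<longlongrightarrow> 0) (at_left L)"
  proof -
    have "((?S) \<longlongrightarrow> sqrt (L\<^sup>2 - L\<^sup>2)) (at_left L)" by (intro tendsto_intros)
    hence S0: "((?S) \<longlongrightarrow> 0) (at_left L)" by simp
    have b: "((\<lambda>r. B (?S r)) \<longlongrightarrow> B 0) (at_left L)"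
      by (rule isCont_tendsto_compose[OF Bc S0])
    have "((\<lambda>r. U r) \<longlongrightarrow> ln ((L + 0) / L)) (at_left L)"
      unfolding U_def using L by (intro tendsto_intros S0) auto
    hence "((\<lambda>r. U r) \<longlongrightarrow> 0) (at_left L)" using L by simp
    from isCont_tendsto_compose[OF DERIV_isCont[OF sq] this]
    have "((\<lambda>r. sinh_quot j (U r)) \<longlongrightarrow> sinh_quot j 0) (at_left L)" .
    moreover have "sinh_quot j 0 = 0" by (simp add: sinh_quot_def)
    ultimately have s: "((\<lambda>r. sinh_quot j (U r)) \<longlongrightarrow> 0) (at_left L)" by simp
    have "(F \<longlongrightarrow> L ^ m / m * 0 - L / m * B 0) (at_left L)"
      unfolding F_def using mpos by (intro tendsto_intros s b) auto
    thus ?thesis by (simp add: B_def)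
  qed
  have lim0: "(F \<longlongrightarrow> - (L / m * B L)) (at_right 0)"
  proof -
    have "((?S) \<longlongrightarrow> sqrt (L\<^sup>2 - 0\<^sup>2)) (at_right 0)" by (intro tendsto_intros)
    hence S0: "((?S) \<longlongrightarrow> L) (at_right 0)" using L by simp
    have b: "((\<lambda>r. B (?S r)) \<longlongrightarrow> B L) (at_right 0)"
      by (rule isCont_tendsto_compose[OF Bc S0])
    have ev: "\<forall>\<^sub>F r in at_right 0. 0 < r \<and> r < L"
      using L by (auto simp: eventually_at_right_field intro!: exI[of _ L])
    \<comment> \<open>\<open>sinh_quot j u\<close> grows at most like \<open>e\<close> to the power \<open>(j + 1) u\<close>, that is, like \<open>r\<close> to the power \<open>- (j + 1)\<close>.\<close>
    have s: "((\<lambda>r. r ^ m / m * sinh_quot j (U r)) \<longlongrightarrow> 0) (at_right 0)"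
    proof (rule tendsto_sandwich)
      show "\<forall>\<^sub>F r in at_right 0. 0 \<le> r ^ m / m * sinh_quot j (U r)"
        using ev by eventually_elim (use sqpos Upos mpos in auto)
      show "\<forall>\<^sub>F r in at_right 0. r ^ m / m * sinh_quot j (U r) \<le> (2 * L) ^ (j + 1) * r ^ (2 * q + 1)"
        using ev
      proof eventually_elim
        case (elim r)
        hence r: "0 < r" "r < L" by auto
        have "0 < L + ?S r" using E(1)[OF r] L by linarith
        hence "0 < (L + ?S r) / r" by (rule divide_pos_pos[OF _ r(1)])
        hence e: "exp (U r) = (L + ?S r) / r" unfolding U_def by (rule exp_ln)
        have "sinh_quot j (U r) \<le> exp (U r) ^ (j + 1)"
        proof (cases "j = 0")
          case True
          thus ?thesis unfolding sinh_quot_def using exp_ge_add_one_self[of "U r"] by (simp, linarith)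
        next
          case False
          have half: "(a - b) / 2 \<le> a" if "0 < a" "0 < b" for a b :: real
            using that by (simp add: field_simps)
          have "sinh x \<le> exp x" for x :: real
            unfolding sinh_field_def by (rule half) auto
          hence "sinh (real j * U r) \<le> exp (real j * U r)" .
          moreover have "sinh (real j * U r) \<ge> 0" using Upos[OF r] by simp
          hence "sinh (real j * U r) / real j \<le> sinh (real j * U r) / 1" using False by (intro divide_left_mono) auto
          moreover have "exp (real j * U r) = exp (U r) ^ j" by (simp add: exp_of_nat_mult)
          moreover have "exp (U r) ^ j \<le> exp (U r) ^ (j + 1)" using Upos[OF r] by (intro power_increasing) auto
          ultimately show ?thesis unfolding sinh_quot_def using False by (simp only: if_False div_by_1)
        qed
        also have "\<dots> \<le> (2 * L / r) ^ (j + 1)"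
          unfolding e using E[OF r] L r by (intro power_mono divide_right_mono) auto
        finally have "r ^ m / m * sinh_quot j (U r) \<le> r ^ m / m * (2 * L / r) ^ (j + 1)"
          using r by (intro mult_left_mono) auto
        also have "\<dots> \<le> r ^ m / 1 * (2 * L / r) ^ (j + 1)"
          using r L mpos by (intro mult_right_mono divide_left_mono) auto
        also have "\<dots> = (2 * L) ^ (j + 1) * r ^ (2 * q + 1)"
        proof -
          have "r ^ m = r ^ (j + 1) * r ^ (2 * q + 1)" unfolding m_def by (simp flip: power_add)
          thus ?thesis using r unfolding power_divide by simp
        qed
        finally show ?case .
      qed
      have "((\<lambda>r. (2 * L) ^ (j + 1) * r ^ (2 * q + 1)) \<longlongrightarrow> (2 * L) ^ (j + 1) * 0 ^ (2 * q + 1)) (at_right 0)"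
        by (intro tendsto_intros)
      thus "((\<lambda>r. (2 * L) ^ (j + 1) * r ^ (2 * q + 1)) \<longlongrightarrow> 0) (at_right 0)" by simp
    qed auto
    from tendsto_diff[OF s tendsto_mult_left[OF b, of "L / m"]] show ?thesis unfolding F_def by simp
  qed
  have conv: "(\<lambda>r. r ^ (m - 1) * log_excess j L r) = f" unfolding f_def log_excess_def U_def ..
  have c1: "ereal 0 < ereal L" using L by simp
  have c2: "(F has_real_derivative f x) (at x)" "isCont f x" if "ereal 0 < ereal x" "ereal x < ereal L" for x
    using that Fd isC by auto
  have c3: "AE x in lborel. ereal 0 < ereal x \<longrightarrow> ereal x < ereal L \<longrightarrow> 0 \<le> f x"
    unfolding f_def using sqpos Upos by (intro AE_I2) auto
  have c4: "((F \<circ> real_of_ereal) \<longlongrightarrow> - (L / m * B L)) (at_right (ereal 0))"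
    "((F \<circ> real_of_ereal) \<longlongrightarrow> 0) (at_left (ereal L))"
    unfolding ereal_tendsto_simps1 using lim0 limL by auto
  note FTC = interval_integral_FTC_nonneg[OF c1 c2 c3 c4]
  hence I: "set_integrable lborel {0<..<L} f" "(LBINT x:{0<..<L}. f x) = L / m * B L"
    using FTC L by (simp_all add: interval_lebesgue_integral_le_eq)
  show "set_integrable lborel {0<..<L} (\<lambda>r. r ^ (m - 1) * log_excess j L r)" unfolding conv by (rule I)
  have "L / m * B L = L / m * ((2 * L) ^ (m - 1) * (fact (q + j) * fact q / fact (m - 1)) / 2)"
    unfolding B_def G(2) ..
  also have "\<dots> = L ^ m * 2 ^ (m - 2) * (fact (q + j) * fact q) / (real m * fact (m - 1))"
  proof -
    define k where "k = j + 2 * q"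
    have "m - 1 = Suc k" "m = Suc (Suc k)" "m - 2 = k" unfolding m_def k_def by auto
    hence "L * (2 * L) ^ (m - 1) / 2 = L ^ m * 2 ^ (m - 2)"
      by (simp add: power_mult_distrib)
    thus ?thesis by (simp add: field_simps)
  qed
  finally show "(LBINT r:{0<..<L}. r ^ (m - 1) * log_excess j L r)
       = L ^ m * 2 ^ (m - 2) * (fact (q + j) * fact q) / (real m * fact (m - 1))"
    unfolding conv using I(2) by simp
qed

section \<open>Radial moments of these coefficients\<close>

lemma set_integral_power:
  assumes "0 \<le> R"
  shows "set_integrable lborel {0<..<R} (\<lambda>r :: real. r ^ k)"
    "(LBINT r:{0<..<R}. r ^ k) = R ^ Suc k / Suc k"
proof -
  have "set_integrable lborel {0..R} (\<lambda>r :: real. r ^ k)"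
    by (intro borel_integrable_atLeastAtMost' continuous_intros)
  thus "set_integrable lborel {0<..<R} (\<lambda>r :: real. r ^ k)"
    by (rule set_integrable_subset) auto
  have "(LBINT r:{0<..<R}. r ^ k) = (LBINT r=ereal 0..ereal R. r ^ k)"
    using assms by (simp add: interval_lebesgue_integral_le_eq)
  also have "\<dots> = (LBINT r:{0..R}. r ^ k)" using assms by (intro interval_integral_Icc)
  also have "\<dots> = R ^ Suc k / Suc k"
    using integral_power[OF assms, of k] unfolding set_lebesgue_integral_def by (simp add: mult.commute)
  finally show "(LBINT r:{0<..<R}. r ^ k) = R ^ Suc k / Suc k" .
qed

lemma set_integral_sum_terms:
  fixes f :: "'i \<Rightarrow> real \<Rightarrow> real"
  assumes "\<And>i. i \<in> I \<Longrightarrow> set_integrable M A (f i)"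
  shows "set_integrable M A (\<lambda>x. \<Sum>i\<in>I. f i x)"
    "(LINT x:A|M. (\<Sum>i\<in>I. f i x)) = (\<Sum>i\<in>I. LINT x:A|M. f i x)"
  using assms unfolding set_integrable_def set_lebesgue_integral_def scaleR_sum_right
  by (auto intro!: Bochner_Integration.integrable_sum Bochner_Integration.integral_sum)

lemma poly_sum_le:
  fixes p :: "real poly"
  assumes "degree p \<le> j"
  shows "poly p x = (\<Sum>i\<le>j. coeff p i * x ^ i)"
  unfolding poly_altdef using assms by (intro sum.mono_neutral_left) (auto simp: coeff_eq_0)

lemma abs_ln_half_le:
  assumes "0 < r" "r < (R :: real)"
  shows "\<bar>ln (r / 2)\<bar> \<le> \<bar>ln (R / 2)\<bar> + 2 / r"
proof -
  have "ln (r / 2) \<le> ln (R / 2)" using assms by (intro ln_mono) auto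
  moreover have "ln (2 / r) \<le> 2 / r" using ln_bound[of "2 / r"] assms by simp
  moreover have "ln (2 / r) = - ln (r / 2)" using assms by (simp add: ln_div)
  moreover have "2 / r \<ge> 0" using assms by simp
  ultimately show ?thesis by linarith
qed

lemma radial_ln:
  fixes R :: real
  assumes "k \<ge> 1" "R \<ge> 0"
  shows "set_integrable lborel {0<..<R} (\<lambda>r. r ^ k * ln (r / 2))"
proof (rule set_integrable_bound)
  show "set_integrable lborel {0<..<R} (\<lambda>r. r ^ k * \<bar>ln (R / 2)\<bar> + 2 * r ^ (k - 1))"
    by (intro set_integral_add set_integrable_mult_left set_integrable_mult_right set_integral_power assms)
  show "AE r in lborel. r \<in> {0<..<R} \<longrightarrow> norm (r ^ k * ln (r / 2)) \<le> norm (r ^ k * \<bar>ln (R / 2)\<bar> + 2 * r ^ (k - 1))"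
  proof (intro AE_I2 impI)
    fix r assume "r \<in> {0<..<R}"
    hence r: "0 < r" "r < R" by auto
    have "norm (r ^ k * ln (r / 2)) = r ^ k * \<bar>ln (r / 2)\<bar>" using r by (simp add: abs_mult)
    also have "\<dots> \<le> r ^ k * (\<bar>ln (R / 2)\<bar> + 2 / r)"
      using r by (intro mult_left_mono abs_ln_half_le) auto
    also have "\<dots> = r ^ k * \<bar>ln (R / 2)\<bar> + 2 * r ^ (k - 1)"
      using r assms(1) by (cases k) (auto simp: field_simps)
    finally show "norm (r ^ k * ln (r / 2)) \<le> norm (r ^ k * \<bar>ln (R / 2)\<bar> + 2 * r ^ (k - 1))" by simp
  qed
  show "set_borel_measurable lborel {0<..<R} (\<lambda>r. r ^ k * ln (r / 2))"
    unfolding set_borel_measurable_def by measurable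
qed

text \<open>With \<open>m = j + 2q + 2\<close>, the product of this number with \<open>(m - 2 choose q)\<close> divided by \<open>2\<^sup>m\<^sup>-\<^sup>2\<close>, the
weight of the frequencies \<open>j\<close> and \<open>- j\<close> in the power \<open>m - 2\<close> of the cosine, is \<open>1 / (m (m - 1))\<close> for every \<open>j\<close>.\<close>
definition radial_const :: "nat \<Rightarrow> nat \<Rightarrow> real" where
  "radial_const j q = 2 ^ (j + 2 * q) * (fact (q + j) * fact q) / (real (j + 2 * q + 2) * fact (j + 2 * q + 1))"

text \<open>\<open>P\<close> is the contribution of the Chebyshev part of \<open>log_mode\<close>. Its degree is bounded by the frequency,
and this is what makes it cancel in the comparison of two potentials.\<close>
definition radial_poly :: "real \<Rightarrow> nat \<Rightarrow> nat \<Rightarrow> real poly \<Rightarrow> bool" where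
  "radial_poly R j q P \<longleftrightarrow> degree P \<le> j \<and> (\<forall>l. \<bar>l\<bar> \<le> R \<longrightarrow>
    set_integrable lborel {0<..<R} (\<lambda>r. r ^ (j + 2 * q + 1) * log_mode j l r) \<and>
    (LBINT r:{0<..<R}. r ^ (j + 2 * q + 1) * log_mode j l r)
      = poly P l + radial_const j q * l ^ (j + 2 * q + 2))"

text \<open>The excess contributes \<open>sgn l\<^sup>j \<bar>l\<bar>\<^sup>m\<close>, which is \<open>l\<^sup>m\<close> because \<open>j\<close> and \<open>m\<close> have the same parity.\<close>
lemma radial_poly_exists:
  fixes j q :: nat and R :: real
  assumes R: "R > 0"
  shows "\<exists>P. radial_poly R j q P"
proof -
  define m where "m = j + 2 * q + 2"
  have m1: "j + 2 * q + 1 = m - 1" unfolding m_def by simp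
  let ?A = "\<lambda>l r. if j = 0 then ln (r / 2) else - poly (chebyshev j) (l / r) / real j"
  have A: "\<exists>P. degree P \<le> j \<and> (\<forall>l. set_integrable lborel {0<..<R} (\<lambda>r. r ^ (m - 1) * ?A l r) \<and>
    (LBINT r:{0<..<R}. r ^ (m - 1) * ?A l r) = poly P l)"
  proof (cases "j = 0")
    case True
    have "set_integrable lborel {0<..<R} (\<lambda>r. r ^ (m - 1) * ln (r / 2))"
      using R by (intro radial_ln) (auto simp: m_def)
    thus ?thesis using True by (intro exI[of _ "[:LBINT r:{0<..<R}. r ^ (m - 1) * ln (r / 2):]"]) auto
  next
    case False
    define c where "c i = - coeff (chebyshev j) i / real j" for i
    define P where "P = (\<Sum>i\<le>j. monom (c i * (R ^ (m - i) / real (m - i))) i)"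
    have m: "m - 1 - i + i = m - 1" "Suc (m - 1 - i) = m - i" if "i \<le> j" for i using that unfolding m_def by auto
    have eq: "r ^ (m - 1) * ?A l r = (\<Sum>i\<le>j. c i * l ^ i * r ^ (m - 1 - i))" if "r \<in> {0<..<R}" for r l
    proof -
      have r: "r > 0" using that by simp
      have "poly (chebyshev j) (l / r) = (\<Sum>i\<le>j. coeff (chebyshev j) i * (l / r) ^ i)"
        by (rule poly_sum_le) (rule degree_chebyshev)
      hence "r ^ (m - 1) * ?A l r = (\<Sum>i\<le>j. c i * (l / r) ^ i * r ^ (m - 1))"
        using False by (simp add: c_def sum_distrib_left sum_divide_distrib sum_negf mult_ac)
      also have "\<dots> = (\<Sum>i\<le>j. c i * l ^ i * r ^ (m - 1 - i))"
      proof (rule sum.cong)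
        fix i assume "i \<in> {..j}"
        hence "r ^ (m - 1) = r ^ (m - 1 - i) * r ^ i" using m(1)[of i] by (simp flip: power_add)
        thus "c i * (l / r) ^ i * r ^ (m - 1) = c i * l ^ i * r ^ (m - 1 - i)"
          using r by (simp add: power_divide)
      qed simp
      finally show ?thesis .
    qed
    have int: "set_integrable lborel {0<..<R} (\<lambda>r. \<Sum>i\<le>j. c i * l ^ i * r ^ (m - 1 - i))" for l
      using R by (intro set_integral_sum_terms set_integrable_mult_right set_integral_power) auto
    have "set_integrable lborel {0<..<R} (\<lambda>r. r ^ (m - 1) * ?A l r)" for l
      using int[of l] by (subst set_integrable_cong[OF refl refl eq]) auto
    moreover have "(LBINT r:{0<..<R}. r ^ (m - 1) * ?A l r) = poly P l" for l
    proof -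
      have "(LBINT r:{0<..<R}. r ^ (m - 1) * ?A l r) = (LBINT r:{0<..<R}. \<Sum>i\<le>j. c i * l ^ i * r ^ (m - 1 - i))"
        by (intro set_lebesgue_integral_cong) (use eq in auto)
      also have "\<dots> = (\<Sum>i\<le>j. LBINT r:{0<..<R}. c i * l ^ i * r ^ (m - 1 - i))"
        using R by (intro set_integral_sum_terms set_integrable_mult_right set_integral_power) auto
      also have "\<dots> = (\<Sum>i\<le>j. c i * l ^ i * (R ^ (m - i) / real (m - i)))"
        using R m(2) by (intro sum.cong refl) (simp add: set_integral_power)
      also have "\<dots> = poly P l" unfolding P_def by (simp add: poly_sum poly_monom mult_ac)
      finally show ?thesis .
    qed
    moreover have "degree P \<le> j" unfolding P_def
      by (rule degree_sum_le) (auto intro: order_trans[OF degree_monom_le])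
    ultimately show ?thesis by blast
  qed
  then obtain P where P: "degree P \<le> j" "\<And>l. set_integrable lborel {0<..<R} (\<lambda>r. r ^ (m - 1) * ?A l r)"
    "\<And>l. (LBINT r:{0<..<R}. r ^ (m - 1) * ?A l r) = poly P l" by blast
  let ?X = "\<lambda>l r. if r < \<bar>l\<bar> then sgn l ^ j * log_excess j \<bar>l\<bar> r else 0"
  have X: "set_integrable lborel {0<..<R} (\<lambda>r. r ^ (m - 1) * ?X l r) \<and>
    (LBINT r:{0<..<R}. r ^ (m - 1) * ?X l r) = radial_const j q * l ^ m" if l: "\<bar>l\<bar> \<le> R" for l
  proof (cases "l = 0")
    case True
    have "r ^ (m - 1) * ?X l r = 0" if "r \<in> {0<..<R}" for r using that True by auto
    hence "set_integrable lborel {0<..<R} (\<lambda>r. r ^ (m - 1) * ?X l r) \<longleftrightarrow> set_integrable lborel {0<..<R} (\<lambda>r. 0 :: real)"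
      "(LBINT r:{0<..<R}. r ^ (m - 1) * ?X l r) = (LBINT r:{0<..<R}. 0)"
      by (intro set_integrable_cong set_lebesgue_integral_cong; simp)+
    moreover have "l ^ m = 0" using True by (simp add: m_def)
    ultimately show ?thesis by (simp add: set_integrable_def set_lebesgue_integral_def)
  next
    case False
    hence L: "\<bar>l\<bar> > 0" by simp
    have ind: "indicator {0<..<R} r *\<^sub>R (r ^ (m - 1) * ?X l r)
       = sgn l ^ j * (indicator {0<..<\<bar>l\<bar>} r *\<^sub>R (r ^ (m - 1) * log_excess j \<bar>l\<bar> r))" for r
      using l by (auto split: split_indicator)
    have "sgn l ^ j * \<bar>l\<bar> ^ m = sgn l ^ j * sgn l ^ m * l ^ m"
      by (metis abs_sgn mult.assoc mult.commute power_mult_distrib)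
    also have "sgn l ^ j * sgn l ^ m = (sgn l ^ 2) ^ (j + q + 1)"
      unfolding m_def by (simp add: algebra_simps flip: power_add power_mult)
    also have "\<dots> = 1" using False by (simp add: sgn_if power2_eq_square)
    finally have "sgn l ^ j * \<bar>l\<bar> ^ m = l ^ m" by simp
    moreover note E = radial_excess[OF L, of j q, folded m_def]
    have "m - 2 = j + 2 * q" "m - 1 = j + 2 * q + 1" unfolding m_def by auto
    hence "(LBINT r:{0<..<\<bar>l\<bar>}. r ^ (m - 1) * log_excess j \<bar>l\<bar> r) = radial_const j q * \<bar>l\<bar> ^ m"
      using E(2) unfolding radial_const_def by (simp add: m_def)
    ultimately show ?thesis
      using E(1) unfolding set_integrable_def set_lebesgue_integral_def ind
      by (auto simp: mult.left_commute)
  qed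
  have "set_integrable lborel {0<..<R} (\<lambda>r. r ^ (m - 1) * log_mode j l r) \<and>
    (LBINT r:{0<..<R}. r ^ (m - 1) * log_mode j l r) = poly P l + radial_const j q * l ^ m" if l: "\<bar>l\<bar> \<le> R" for l
  proof -
    have e: "r ^ (m - 1) * log_mode j l r = r ^ (m - 1) * ?A l r + r ^ (m - 1) * ?X l r" for r
      unfolding log_mode_def by (simp only: distrib_left)
    show ?thesis unfolding e
      using set_integral_add[OF P(2)[of l] conjunct1[OF X[OF l]]] P(3)[of l] X[OF l] by simp
  qed
  thus ?thesis using P(1) unfolding radial_poly_def m1 m_def[symmetric] by blast
qed

lemma sinh_quot_nonneg: "u \<ge> 0 \<Longrightarrow> sinh_quot j u \<ge> 0"
  unfolding sinh_quot_def by simp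

text \<open>The logarithm is bounded above, so its absolute value is at most a constant minus the logarithm, and the
mean of the latter is known.\<close>
lemma integral_abs_ln_cos_le:
  assumes r: "0 < r" "r < R" and l: "\<bar>l\<bar> \<le> R"
  shows "(\<integral>x. \<bar>ln \<bar>r * cos (x - t) - l\<bar>\<bar> \<partial>circle) \<le> 2 * ln (2 * R + 1) + 2 / r"
proof -
  note C = ln_cos_mode[OF r(1), where t = t and l = l]
  have le: "\<bar>ln \<bar>r * cos (x - t) - l\<bar>\<bar> \<le> 2 * ln (2 * R + 1) - ln \<bar>r * cos (x - t) - l\<bar>" for x
  proof -
    define y where "y = \<bar>r * cos (x - t) - l\<bar>"
    have "\<bar>r * cos (x - t)\<bar> \<le> r * 1" unfolding abs_mult using r by (intro mult_mono) auto
    hence y: "0 \<le> y" "y \<le> 2 * R + 1" unfolding y_def using r l by linarith+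
    have "ln (2 * R + 1) \<ge> 0" using r by simp
    show ?thesis
    proof (cases "y = 0")
      case False
      hence "ln y \<le> ln (2 * R + 1)" using y by (intro ln_mono) auto
      thus ?thesis unfolding y_def[symmetric] using \<open>ln (2 * R + 1) \<ge> 0\<close> by linarith
    qed (use \<open>ln (2 * R + 1) \<ge> 0\<close> in \<open>simp add: y_def[symmetric]\<close>)
  qed
  have "(\<integral>x. \<bar>ln \<bar>r * cos (x - t) - l\<bar>\<bar> \<partial>circle) \<le> (\<integral>x. 2 * ln (2 * R + 1) - ln \<bar>r * cos (x - t) - l\<bar> \<partial>circle)"
    using C(1) le by (intro integral_mono) auto
  also have "\<dots> = 2 * ln (2 * R + 1) - log_mode 0 l r"
    using C(1) C(2)[of 0 0] circle.prob_space by simp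
  also have "log_mode 0 l r \<ge> ln (r / 2)"
  proof -
    have "log_excess 0 \<bar>l\<bar> r \<ge> 0" if "r < \<bar>l\<bar>"
    proof -
      have "r \<le> \<bar>l\<bar> + sqrt (\<bar>l\<bar>\<^sup>2 - r\<^sup>2)"
        using that r by (intro add_increasing2) (auto intro!: power_mono simp: abs_le_square_iff[symmetric])
      thus ?thesis unfolding log_excess_def using r by (intro sinh_quot_nonneg ln_ge_zero) simp
    qed
    thus ?thesis unfolding log_mode_def by auto
  qed
  moreover have "- ln (r / 2) \<le> 2 / r"
    using ln_bound[of "2 / r"] r by (simp add: ln_div)
  ultimately show ?thesis by linarith
qed

section \<open>Logarithmic potentials in polar coordinates\<close>

text \<open>A pair \<open>(r, x)\<close> stands for the point \<open>re\<^sup>i\<^sup>x\<close>. Powers of \<open>r\<close>, such as the Jacobian, are part of the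
integrands.\<close>
definition polar :: "(real \<times> real) measure" where
  "polar = lborel \<Otimes>\<^sub>M circle"

lemma sets_polar [measurable_cong]: "sets polar = sets (borel \<Otimes>\<^sub>M borel)"
  unfolding polar_def by (rule sets_pair_measure_cong) auto

lemma space_polar [simp]: "space polar = UNIV"
  unfolding polar_def by (simp add: space_pair_measure)

interpretation lborel_circle: pair_sigma_finite lborel circle ..

interpretation polar: sigma_finite_measure polar
  unfolding polar_def by (intro sigma_finite_pair_measure lborel.sigma_finite_measure_axioms circle.sigma_finite_measure_axioms)

interpretation polar_circle: pair_sigma_finite polar circle ..

lemma ln_abs_prod_list:
  assumes "\<And>a. a \<in> set as \<Longrightarrow> f a \<noteq> (0 :: real)"
  shows "ln \<bar>\<Prod>a\<leftarrow>as. f a\<bar> = (\<Sum>a\<leftarrow>as. ln \<bar>f a\<bar>)"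
  using assms
proof (induction as)
  case (Cons a as)
  hence "(\<Prod>a\<leftarrow>as. f a) \<noteq> 0" by (auto simp: prod_list_zero_iff)
  thus ?case using Cons by (simp add: abs_mult ln_mult_pos)
qed simp

lemma abs_sum_list_le: "\<bar>\<Sum>a\<leftarrow>as. f a\<bar> \<le> (\<Sum>a\<leftarrow>as. \<bar>f a :: real\<bar>)"
  by (induction as) auto

lemma integral_sum_list:
  fixes f :: "'i \<Rightarrow> 'a \<Rightarrow> real"
  assumes "\<And>i. i \<in> set as \<Longrightarrow> integrable M (f i)"
  shows "integrable M (\<lambda>x. \<Sum>i\<leftarrow>as. f i x)" "(\<integral>x. (\<Sum>i\<leftarrow>as. f i x) \<partial>M) = (\<Sum>i\<leftarrow>as. \<integral>x. f i x \<partial>M)"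
  using assms by (induction as) auto

lemma ln_cos_prod:
  assumes r: "0 < r" "r < R" and l: "\<And>l. l \<in> set ls \<Longrightarrow> \<bar>l\<bar> \<le> R"
    and h: "\<And>x. h x = (\<Prod>l\<leftarrow>ls. r * cos (x - t) - l)"
  shows "integrable circle (\<lambda>x. ln \<bar>h x\<bar>)"
    and "(\<integral>x. cos (real j * x - a) * ln \<bar>h x\<bar> \<partial>circle) = cos (real j * t - a) * (\<Sum>l\<leftarrow>ls. log_mode j l r)"
    and "(\<integral>x. \<bar>ln \<bar>h x\<bar>\<bar> \<partial>circle) \<le> real (length ls) * (2 * ln (2 * R + 1) + 2 / r)"
proof -
  note C = ln_cos_mode[OF r(1), where t = t]
  let ?f = "\<lambda>x. \<Sum>l\<leftarrow>ls. ln \<bar>r * cos (x - t) - l\<bar>"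
  have ae: "AE x in circle. ln \<bar>h x\<bar> = ?f x"
  proof -
    have "AE x in circle. \<forall>l\<in>set ls. r * cos (x - t) - l \<noteq> 0"
      by (rule AE_finite_allI) (use C(3) in auto)
    thus ?thesis by eventually_elim (auto simp: h intro!: ln_abs_prod_list)
  qed
  have h': "h = (\<lambda>x. \<Prod>l\<leftarrow>ls. r * cos (x - t) - l)" using h by auto
  have [measurable]: "h \<in> borel_measurable borel" unfolding h'
    by (intro borel_measurable_continuous_onI, induction ls) (auto intro!: continuous_intros)
  have m1: "(\<lambda>x. ln \<bar>h x\<bar>) \<in> borel_measurable circle" by measurable
  have I: "integrable circle ?f" using C(1) by (intro integral_sum_list) auto
  show I1: "integrable circle (\<lambda>x. ln \<bar>h x\<bar>)"
    by (subst integrable_cong_AE[OF m1 _ ae]) (use I in \<open>auto intro: borel_measurable_integrable\<close>)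
  have bc: "integrable circle (\<lambda>x. cos (real j * x - a) * g x)" if "integrable circle g" for g
    by (rule integrable_bounded_mult[OF that]) auto
  have "(\<integral>x. cos (real j * x - a) * ln \<bar>h x\<bar> \<partial>circle) = (\<integral>x. cos (real j * x - a) * ?f x \<partial>circle)"
    by (rule integral_cong_AE) (use m1 I ae in \<open>auto intro: borel_measurable_integrable elim!: eventually_mono\<close>)
  also have "\<dots> = (\<integral>x. (\<Sum>l\<leftarrow>ls. cos (real j * x - a) * ln \<bar>r * cos (x - t) - l\<bar>) \<partial>circle)"
    by (simp add: sum_list_const_mult)
  also have "\<dots> = (\<Sum>l\<leftarrow>ls. \<integral>x. cos (real j * x - a) * ln \<bar>r * cos (x - t) - l\<bar> \<partial>circle)"
    by (rule integral_sum_list(2)) (use bc C(1) in auto)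
  also have "\<dots> = cos (real j * t - a) * (\<Sum>l\<leftarrow>ls. log_mode j l r)"
    unfolding C(2) by (simp add: sum_list_const_mult)
  finally show "(\<integral>x. cos (real j * x - a) * ln \<bar>h x\<bar> \<partial>circle) = cos (real j * t - a) * (\<Sum>l\<leftarrow>ls. log_mode j l r)" .
  have "(\<integral>x. \<bar>ln \<bar>h x\<bar>\<bar> \<partial>circle) \<le> (\<integral>x. (\<Sum>l\<leftarrow>ls. \<bar>ln \<bar>r * cos (x - t) - l\<bar>\<bar>) \<partial>circle)"
  proof (rule integral_mono_AE)
    show "integrable circle (\<lambda>x. \<Sum>l\<leftarrow>ls. \<bar>ln \<bar>r * cos (x - t) - l\<bar>\<bar>)"
      by (rule integral_sum_list(1)) (use C(1) in auto)
    show "AE x in circle. \<bar>ln \<bar>h x\<bar>\<bar> \<le> (\<Sum>l\<leftarrow>ls. \<bar>ln \<bar>r * cos (x - t) - l\<bar>\<bar>)"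
      using ae by eventually_elim (simp add: abs_sum_list_le)
  qed (use I1 in auto)
  also have "\<dots> = (\<Sum>l\<leftarrow>ls. \<integral>x. \<bar>ln \<bar>r * cos (x - t) - l\<bar>\<bar> \<partial>circle)"
    by (rule integral_sum_list(2)) (use C(1) in auto)
  also have "\<dots> \<le> (\<Sum>l\<leftarrow>ls. 2 * ln (2 * R + 1) + 2 / r)"
    by (intro sum_list_mono integral_abs_ln_cos_le r l)
  also have "\<dots> = real (length ls) * (2 * ln (2 * R + 1) + 2 / r)" by (simp add: sum_list_triv)
  finally show "(\<integral>x. \<bar>ln \<bar>h x\<bar>\<bar> \<partial>circle) \<le> real (length ls) * (2 * ln (2 * R + 1) + 2 / r)" .
qed

text \<open>The example to keep in mind is \<open>h r x t = det (r cos (x - t) - A\<^sub>t)\<close> with a hermitian matrix \<open>A\<^sub>t\<close> whose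
eigenvalues are listed in \<open>ls t\<close>. Measurability is demanded of \<open>h\<close> only, since the order of the eigenvalues
may depend on \<open>t\<close> in any way.\<close>
locale cos_family =
  fixes h :: "real \<Rightarrow> real \<Rightarrow> real \<Rightarrow> real" and ls :: "real \<Rightarrow> real list" and R :: real and n :: nat
  assumes h_measurable: "(\<lambda>x. h (fst (fst x)) (snd (fst x)) (snd x)) 
      \<in> borel_measurable ((borel \<Otimes>\<^sub>M borel) \<Otimes>\<^sub>M borel)"
    and h_prod: "h r x t = (\<Prod>l\<leftarrow>ls t. r * cos (x - t) - l)"
    and ls_length: "length (ls t) = n"
    and ls_bound: "l \<in> set (ls t) \<Longrightarrow> \<bar>l\<bar> \<le> R"
    and R_pos: "R > 0"
begin

definition weighted_log :: "nat \<Rightarrow> real \<times> real \<Rightarrow> real \<Rightarrow> real" where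
  "weighted_log k z t = indicator {0<..<R} (fst z) * (fst z ^ k * ln \<bar>h (fst z) (snd z) t\<bar>)"

lemma weighted_log_measurable [measurable]: "(\<lambda>x. weighted_log k (fst x) (snd x)) \<in> borel_measurable (polar \<Otimes>\<^sub>M circle)"
  unfolding weighted_log_def using h_measurable by measurable

lemma weighted_log_slice_measurable [measurable]: "(\<lambda>z. weighted_log k z t) \<in> borel_measurable polar"
  using measurable_compose[OF _ weighted_log_measurable, of "\<lambda>z. (z, t)" polar k] by simp

lemma integrable_weighted_log:
  assumes k: "k \<ge> 1"
  shows "integrable (polar \<Otimes>\<^sub>M circle) (\<lambda>x. weighted_log k (fst x) (snd x))"
    "integrable polar (\<lambda>z. weighted_log k z t)"
proof -
  define C where "C = real n * (2 * ln (2 * R + 1) * R ^ k + 2 * R ^ (k - 1))"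
  have inner: "(\<integral>\<^sup>+x. ennreal (norm (weighted_log k (r, x) t)) \<partial>circle) \<le> ennreal C * indicator {0<..<R} r" for r t
  proof (cases "r \<in> {0<..<R}")
    case True
    hence r: "0 < r" "r < R" by auto
    note L = ln_cos_prod[where t = t and ls = "ls t" and h = "\<lambda>x. h r x t", OF r ls_bound h_prod]
    have ln0: "ln (2 * R + 1) \<ge> 0" using R_pos by simp
    have "(\<integral>\<^sup>+x. ennreal (norm (weighted_log k (r, x) t)) \<partial>circle) = (\<integral>\<^sup>+x. ennreal (r ^ k * \<bar>ln \<bar>h r x t\<bar>\<bar>) \<partial>circle)"
      using r by (intro nn_integral_cong) (simp add: weighted_log_def abs_mult)
    also have "\<dots> = ennreal (\<integral>x. r ^ k * \<bar>ln \<bar>h r x t\<bar>\<bar> \<partial>circle)"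
      using r L(1) by (intro nn_integral_eq_integral) auto
    also have "\<dots> \<le> ennreal C"
    proof (rule ennreal_leI)
      have "(\<integral>x. r ^ k * \<bar>ln \<bar>h r x t\<bar>\<bar> \<partial>circle) \<le> r ^ k * (real n * (2 * ln (2 * R + 1) + 2 / r))"
        using L(3) r ls_length[of t] by (simp add: mult_left_mono)
      also have "\<dots> = real n * (2 * ln (2 * R + 1) * r ^ k + 2 * r ^ (k - 1))"
        using r k by (cases k) (auto simp: field_simps)
      also have "\<dots> \<le> C" unfolding C_def
        using r ln0 by (intro mult_left_mono add_mono power_mono) auto
      finally show "(\<integral>x. r ^ k * \<bar>ln \<bar>h r x t\<bar>\<bar> \<partial>circle) \<le> C" .
    qed
    finally show ?thesis using True by simp
  qed (simp add: weighted_log_def)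
  have mid: "(\<integral>\<^sup>+z. ennreal (norm (weighted_log k z t)) \<partial>polar) \<le> ennreal C * ennreal R" for t
  proof -
    have "(\<integral>\<^sup>+z. ennreal (norm (weighted_log k z t)) \<partial>polar) = (\<integral>\<^sup>+r. \<integral>\<^sup>+x. ennreal (norm (weighted_log k (r, x) t)) \<partial>circle \<partial>lborel)"
      using weighted_log_slice_measurable[of k t] unfolding polar_def by (subst circle.nn_integral_fst) auto
    also have "\<dots> \<le> (\<integral>\<^sup>+r. ennreal C * indicator {0<..<R} r \<partial>lborel)"
      by (intro nn_integral_mono inner)
    also have "\<dots> = ennreal C * ennreal R" using R_pos by (subst nn_integral_cmult_indicator) auto
    finally show ?thesis .
  qed
  show "integrable polar (\<lambda>z. weighted_log k z t)"
  proof (rule integrableI_bounded)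
    show "(\<integral>\<^sup>+z. ennreal (norm (weighted_log k z t)) \<partial>polar) < \<infinity>"
      using mid[of t] by (rule le_less_trans) (simp add: ennreal_mult_less_top)
  qed measurable
  show "integrable (polar \<Otimes>\<^sub>M circle) (\<lambda>x. weighted_log k (fst x) (snd x))"
  proof (rule integrableI_bounded)
    have "(\<integral>\<^sup>+x. ennreal (norm (weighted_log k (fst x) (snd x))) \<partial>(polar \<Otimes>\<^sub>M circle))
        = (\<integral>\<^sup>+t. \<integral>\<^sup>+z. ennreal (norm (weighted_log k z t)) \<partial>polar \<partial>circle)"
      by (subst polar_circle.nn_integral_snd[symmetric]) auto
    also have "\<dots> \<le> (\<integral>\<^sup>+t. ennreal C * ennreal R \<partial>circle)" by (intro nn_integral_mono mid)
    also have "\<dots> = ennreal C * ennreal R" using circle.emeasure_space_1 by simp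
    also have "\<dots> < \<infinity>" by (simp add: ennreal_mult_less_top)
    finally show "(\<integral>\<^sup>+x. ennreal (norm (weighted_log k (fst x) (snd x))) \<partial>(polar \<Otimes>\<^sub>M circle)) < \<infinity>" .
  qed measurable
qed

text \<open>The mean over all directions \<open>t\<close> of the logarithm of \<open>h\<close>, with the weight \<open>r\<^sup>k\<close> and cut off at radius
\<open>R\<close>.\<close>
definition potential :: "nat \<Rightarrow> real \<times> real \<Rightarrow> real" where
  "potential k z = (\<integral>t. weighted_log k z t \<partial>circle)"

lemma integrable_potential: "k \<ge> 1 \<Longrightarrow> integrable polar (potential k)"
  unfolding potential_def using polar_circle.integrable_fst'[OF integrable_weighted_log(1)[of k]] by simp

text \<open>By Fubini's theorem the plane may be integrated first; for a fixed direction \<open>t\<close> the angular and radial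
integrals have been evaluated factor by factor.\<close>
lemma integral_potential:
  fixes j q :: nat
  assumes P: "radial_poly R j q P"
  defines "m \<equiv> j + 2 * q + 2"
  shows "(\<integral>z. cos (real j * snd z - a) * potential (m - 1) z \<partial>polar)
      = (\<integral>t. cos (real j * t - a) * (\<Sum>l\<leftarrow>ls t. poly P l + radial_const j q * l ^ m) \<partial>circle)"
    and "integrable circle (\<lambda>t. cos (real j * t - a) * (\<Sum>l\<leftarrow>ls t. poly P l + radial_const j q * l ^ m))"
proof -
  have k: "m - 1 \<ge> 1" unfolding m_def by simp
  have m1: "j + 2 * q + 1 = m - 1" unfolding m_def by simp
  have P2: "set_integrable lborel {0<..<R} (\<lambda>r. r ^ (m - 1) * log_mode j l r)"
    "(LBINT r:{0<..<R}. r ^ (m - 1) * log_mode j l r) = poly P l + radial_const j q * l ^ m"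
    if "l \<in> set (ls t)" for l t
    using P ls_bound[OF that] unfolding radial_poly_def m1 m_def[symmetric] by auto
  define g where "g z t = cos (real j * snd z - a) * weighted_log (m - 1) z t" for z t
  have gI: "integrable (polar \<Otimes>\<^sub>M circle) (\<lambda>x. g (fst x) (snd x))"
    unfolding g_def by (rule integrable_bounded_mult[OF integrable_weighted_log(1)[OF k]]) auto
  have gI2: "integrable polar (\<lambda>z. g z t)" for t
    unfolding g_def by (rule integrable_bounded_mult[OF integrable_weighted_log(2)[OF k, of t]]) auto
  have "(\<integral>z. cos (real j * snd z - a) * potential (m - 1) z \<partial>polar) = (\<integral>z. (\<integral>t. g z t \<partial>circle) \<partial>polar)"
    unfolding potential_def g_def by simp
  also have "\<dots> = (\<integral>t. (\<integral>z. g z t \<partial>polar) \<partial>circle)"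
    by (rule polar_circle.Fubini_integral[symmetric]) (use gI in \<open>simp only: case_prod_beta'\<close>)
  finally have E1: "(\<integral>z. cos (real j * snd z - a) * potential (m - 1) z \<partial>polar) = (\<integral>t. (\<integral>z. g z t \<partial>polar) \<partial>circle)" .
  have E2: "(\<integral>z. g z t \<partial>polar) = cos (real j * t - a) * (\<Sum>l\<leftarrow>ls t. poly P l + radial_const j q * l ^ m)" for t
  proof -
    have "(\<integral>z. g z t \<partial>polar) = (\<integral>r. (\<integral>x. g (r, x) t \<partial>circle) \<partial>lborel)"
      using gI2[of t] unfolding polar_def by (subst lborel_circle.integral_fst') auto
    also have "\<dots> = (\<integral>r. cos (real j * t - a) * (\<Sum>l\<leftarrow>ls t. indicator {0<..<R} r *\<^sub>R (r ^ (m - 1) * log_mode j l r)) \<partial>lborel)"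
    proof (rule Bochner_Integration.integral_cong[OF refl])
      fix r
      show "(\<integral>x. g (r, x) t \<partial>circle) = cos (real j * t - a) * (\<Sum>l\<leftarrow>ls t. indicator {0<..<R} r *\<^sub>R (r ^ (m - 1) * log_mode j l r))"
      proof (cases "r \<in> {0<..<R}")
        case True
        hence r: "0 < r" "r < R" by auto
        have "(\<integral>x. g (r, x) t \<partial>circle) = (\<integral>x. r ^ (m - 1) * (cos (real j * x - a) * ln \<bar>h r x t\<bar>) \<partial>circle)"
          using r by (simp add: g_def weighted_log_def mult_ac)
        also have "\<dots> = r ^ (m - 1) * (cos (real j * t - a) * (\<Sum>l\<leftarrow>ls t. log_mode j l r))"
          using ln_cos_prod(2)[where t = t and ls = "ls t" and h = "\<lambda>x. h r x t" and j = j and a = a, OF r ls_bound h_prod] by simp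
        finally show ?thesis using True by (simp add: sum_list_const_mult)
      qed (simp add: g_def weighted_log_def)
    qed
    also have "\<dots> = cos (real j * t - a) * (\<Sum>l\<leftarrow>ls t. LBINT r:{0<..<R}. r ^ (m - 1) * log_mode j l r)"
      using P2 unfolding set_integrable_def set_lebesgue_integral_def
      by (simp add: integral_sum_list)
    also have "(\<Sum>l\<leftarrow>ls t. LBINT r:{0<..<R}. r ^ (m - 1) * log_mode j l r) = (\<Sum>l\<leftarrow>ls t. poly P l + radial_const j q * l ^ m)"
      using P2 by (intro arg_cong[of _ _ sum_list] map_cong) auto
    finally show ?thesis .
  qed
  show "(\<integral>z. cos (real j * snd z - a) * potential (m - 1) z \<partial>polar)
      = (\<integral>t. cos (real j * t - a) * (\<Sum>l\<leftarrow>ls t. poly P l + radial_const j q * l ^ m) \<partial>circle)"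
    unfolding E1 E2 ..
  have "integrable circle (\<lambda>t. \<integral>z. g z t \<partial>polar)"
    by (rule polar_circle.integrable_snd) (use gI in \<open>simp only: case_prod_beta'\<close>)
  thus "integrable circle (\<lambda>t. cos (real j * t - a) * (\<Sum>l\<leftarrow>ls t. poly P l + radial_const j q * l ^ m))"
    unfolding E2 .
qed

end

section \<open>Moments of the difference of two potentials\<close>

text \<open>The frequencies \<open>N, N - 2, \<dots>, - N\<close> of a homogeneous polynomial of degree \<open>N\<close> in sine and cosine.\<close>
abbreviation freq :: "nat \<Rightarrow> nat \<Rightarrow> real" where
  "freq N l \<equiv> real_of_int (int N - 2 * int l)"

lemma cos_power_expand:
  "cos x ^ N = (\<Sum>l\<le>N. real (N choose l) / 2 ^ N * cos (freq N l * x))"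
proof -
  have "complex_of_real (cos x) = (cis (- x) + cis x) / 2" by (simp add: complex_eq_iff)
  hence "complex_of_real (cos x ^ N) = (cis (- x) + cis x) ^ N / 2 ^ N"
    by (metis of_real_power power_divide)
  also have "(cis (- x) + cis x) ^ N = (\<Sum>l\<le>N. of_nat (N choose l) * cis (- x) ^ l * cis x ^ (N - l))"
    by (rule binomial_ring)
  also have "\<dots> = (\<Sum>l\<le>N. of_nat (N choose l) * cis (freq N l * x))"
  proof (rule sum.cong)
    fix l assume "l \<in> {..N}"
    hence l: "l \<le> N" by simp
    have "cis (- x) ^ l * cis x ^ (N - l) = cis (real l * - x + real (N - l) * x)"
      unfolding Complex.DeMoivre cis_mult ..
    also have "real l * - x + real (N - l) * x = freq N l * x"
      using l by (simp add: of_nat_diff algebra_simps)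
    finally show "of_nat (N choose l) * cis (- x) ^ l * cis x ^ (N - l) = of_nat (N choose l) * cis (freq N l * x)"
      by (simp add: mult.assoc)
  qed simp
  finally have "complex_of_real (cos x ^ N) = (\<Sum>l\<le>N. of_nat (N choose l) * cis (freq N l * x)) / 2 ^ N" .
  hence "Re (complex_of_real (cos x ^ N)) = Re ((\<Sum>l\<le>N. of_nat (N choose l) * cis (freq N l * x)) / 2 ^ N)"
    by (rule arg_cong)
  also have "\<dots> = (\<Sum>l\<le>N. real (N choose l) / 2 ^ N * cos (freq N l * x))"
    unfolding sum_divide_distrib Re_sum
  proof (rule sum.cong)
    fix l
    have "of_nat (N choose l) * cis (freq N l * x) / 2 ^ N
      = complex_of_real (real (N choose l) / 2 ^ N) * cis (freq N l * x)" by simp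
    thus "Re (of_nat (N choose l) * cis (freq N l * x) / 2 ^ N)
      = real (N choose l) / 2 ^ N * cos (freq N l * x)" by (simp only: Re_complex_of_real times_complex.sel Im_complex_of_real cis.sel mult_zero_left diff_zero)
  qed simp
  finally show ?thesis by simp
qed

lemma integral_cos_cis:
  "(\<integral>t. complex_of_real (cos (real_of_int j * t - a)) * cis (real_of_int k * t) \<partial>circle)
    = ((if j + k = 0 then cis (- a) else 0) + (if k - j = 0 then cis a else 0)) / 2"
proof -
  have e: "complex_of_real (cos (real_of_int j * t - a)) * cis (real_of_int k * t)
     = (cis (- a) / 2) * cis (real_of_int (j + k) * t) + (cis a / 2) * cis (real_of_int (k - j) * t)" for t
  proof -
    have "complex_of_real (cos y) = (cis y + cis (- y)) / 2" for y by (simp add: complex_eq_iff)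
    hence "complex_of_real (cos (real_of_int j * t - a)) * cis (real_of_int k * t)
      = (cis (real_of_int j * t - a) * cis (real_of_int k * t) + cis (- (real_of_int j * t - a)) * cis (real_of_int k * t)) / 2"
      by (simp only: times_divide_eq_left distrib_right)
    also have "cis (real_of_int j * t - a) * cis (real_of_int k * t) = cis (- a) * cis (real_of_int (j + k) * t)"
      unfolding cis_mult by (simp add: algebra_simps)
    also have "cis (- (real_of_int j * t - a)) * cis (real_of_int k * t) = cis a * cis (real_of_int (k - j) * t)"
      unfolding cis_mult by (simp add: algebra_simps)
    finally show ?thesis by (simp add: add_divide_distrib)
  qed
  have I: "integrable circle (\<lambda>t. c * cis (real_of_int i * t))" for c i
    by (rule integrable_circle_bounded[of _ "norm c"]) (auto simp: norm_mult)
  show ?thesis unfolding e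
    by (subst Bochner_Integration.integral_add[OF I I], simp only: integral_mult_right_zero integral_circle_cis)
      (auto simp: add_divide_distrib)
qed

text \<open>Of the frequencies \<open>i, i - 2, \<dots>, - i\<close>, the extreme ones are missing.\<close>
definition trig_gap :: "nat \<Rightarrow> (real \<Rightarrow> real) \<Rightarrow> bool" where
  "trig_gap i f \<longleftrightarrow> (\<exists>c :: nat \<Rightarrow> complex. \<forall>t. complex_of_real (f t) = (\<Sum>k\<in>{0<..<i}. c k * cis (freq i k * t)))"

lemma trig_gap_bounded:
  assumes "trig_gap i f"
  shows "f \<in> borel_measurable borel" "\<exists>B. \<forall>t. norm (f t) \<le> B"
proof -
  obtain c where c: "\<And>t. complex_of_real (f t) = (\<Sum>k\<in>{0<..<i}. c k * cis (freq i k * t))"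
    using assms unfolding trig_gap_def by blast
  have "f = (\<lambda>t. Re (\<Sum>k\<in>{0<..<i}. c k * cis (freq i k * t)))"
    unfolding c[symmetric] by simp
  also have "\<dots> \<in> borel_measurable borel"
    by (intro borel_measurable_continuous_onI continuous_intros)
  finally show "f \<in> borel_measurable borel" .
  have "norm (f t) \<le> (\<Sum>k\<in>{0<..<i}. norm (c k))" for t
  proof -
    have "norm (complex_of_real (f t)) \<le> (\<Sum>k\<in>{0<..<i}. norm (c k * cis (freq i k * t)))"
      unfolding c by (rule norm_sum)
    thus ?thesis by (simp add: norm_mult)
  qed
  thus "\<exists>B. \<forall>t. norm (f t) \<le> B" by blast
qed

lemma integrable_cos_trig_gap:
  assumes "trig_gap i f"
  shows "integrable circle (\<lambda>t. cos (b * t - a) * f t)"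
proof -
  obtain B where B: "\<And>t. norm (f t) \<le> B" using trig_gap_bounded(2)[OF assms] by blast
  have [measurable]: "f \<in> borel_measurable borel" by (rule trig_gap_bounded(1)[OF assms])
  show ?thesis
  proof (rule integrable_circle_bounded[of _ B])
    show "norm (cos (b * x - a) * f x) \<le> B" for x
      using mult_mono[of "\<bar>cos (b * x - a)\<bar>" 1 "\<bar>f x\<bar>" B] B[of x] by (simp add: abs_mult)
  qed measurable
qed

lemma integral_cos_trig_gap:
  assumes c: "\<And>t. complex_of_real (f t) = (\<Sum>k\<in>{0<..<i}. c k * cis (freq i k * t))"
  shows "complex_of_real (\<integral>t. cos (real_of_int j * t - a) * f t \<partial>circle) = (\<Sum>k\<in>{0<..<i}. c k *
    (((if j + (int i - 2 * int k) = 0 then cis (- a) else 0) + (if (int i - 2 * int k) - j = 0 then cis a else 0)) / 2))"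
proof -
  have I: "integrable circle (\<lambda>t. c k * (complex_of_real (cos (real_of_int j * t - a)) * cis (freq i k * t)))" for k
    by (rule integrable_circle_bounded[of _ "norm (c k)"]) (auto simp: norm_mult intro!: mult_left_le)
  have "complex_of_real (\<integral>t. cos (real_of_int j * t - a) * f t \<partial>circle)
     = (\<integral>t. complex_of_real (cos (real_of_int j * t - a) * f t) \<partial>circle)"
    by (rule integral_complex_of_real[symmetric])
  also have "\<dots> = (\<integral>t. (\<Sum>k\<in>{0<..<i}. c k * (complex_of_real (cos (real_of_int j * t - a)) * cis (freq i k * t))) \<partial>circle)"
    unfolding of_real_mult c sum_distrib_left by (simp only: mult.left_commute)
  also have "\<dots> = (\<Sum>k\<in>{0<..<i}. \<integral>t. c k * (complex_of_real (cos (real_of_int j * t - a)) * cis (freq i k * t)) \<partial>circle)"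
    by (rule Bochner_Integration.integral_sum) (rule I)
  also have "\<dots> = (\<Sum>k\<in>{0<..<i}. c k *
    (((if j + (int i - 2 * int k) = 0 then cis (- a) else 0) + (if (int i - 2 * int k) - j = 0 then cis a else 0)) / 2))"
    by (simp only: integral_mult_right_zero integral_cos_cis)
  finally show ?thesis .
qed

lemma if_cis_cong:
  "(P \<longleftrightarrow> Q) \<Longrightarrow> (P \<Longrightarrow> x = y) \<Longrightarrow> (if P then cis x else 0) = (if Q then cis y else 0)"
  by auto

lemma trig_gap_orthogonal:
  assumes f: "trig_gap i f" and ij: "i \<le> j"
  shows "(\<integral>t. cos (real j * t - a) * f t \<partial>circle) = 0"
proof -
  obtain c where c: "\<And>t. complex_of_real (f t) = (\<Sum>k\<in>{0<..<i}. c k * cis (freq i k * t))"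
    using f unfolding trig_gap_def by blast
  have "complex_of_real (\<integral>t. cos (real_of_int (int j) * t - a) * f t \<partial>circle) = 0"
    unfolding integral_cos_trig_gap[OF c] using ij by (intro sum.neutral) auto
  thus ?thesis by simp
qed

text \<open>The cosines on the left add up to the Dirichlet kernel of the frequencies \<open>m - 2, m - 4, \<dots>, - (m - 2)\<close>,
which contain all frequencies of \<open>f\<close>.\<close>
lemma trig_gap_reproduce:
  assumes f: "trig_gap m f" and m: "m \<ge> 2"
  shows "(\<Sum>l\<le>m - 2. \<integral>t. cos (freq (m - 2) l * t - freq (m - 2) l * p) * f t \<partial>circle) = f p"
proof -
  obtain c where c: "\<And>t. complex_of_real (f t) = (\<Sum>k\<in>{0<..<m}. c k * cis (freq m k * t))"
    using f unfolding trig_gap_def by blast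
  define N where "N = m - 2"
  define j where "j l = int N - 2 * int l" for l
  have mN: "int m = int N + 2" using m unfolding N_def by simp
  have "complex_of_real (\<Sum>l\<le>N. \<integral>t. cos (real_of_int (j l) * t - real_of_int (j l) * p) * f t \<partial>circle)
    = (\<Sum>l\<le>N. \<Sum>k\<in>{0<..<m}. c k *
    (((if j l + (int m - 2 * int k) = 0 then cis (- (real_of_int (j l) * p)) else 0)
     + (if (int m - 2 * int k) - j l = 0 then cis (real_of_int (j l) * p) else 0)) / 2))"
    unfolding of_real_sum integral_cos_trig_gap[OF c] ..
  also have "\<dots> = (\<Sum>k\<in>{0<..<m}. c k * cis (freq m k * p))"
  proof (subst sum.swap, rule sum.cong)
    fix k assume k: "k \<in> {0<..<m}"
    let ?e = "cis (freq m k * p)"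
    have "(\<Sum>l\<le>N. if j l + (int m - 2 * int k) = 0 then cis (- (real_of_int (j l) * p)) else 0)
       = (\<Sum>l\<le>N. if l = m - 1 - k then ?e else 0)"
    proof (rule sum.cong)
      fix l
      have "j l + (int m - 2 * int k) = 0 \<longleftrightarrow> l = m - 1 - k" unfolding j_def using k mN by auto
      moreover have "- (real_of_int (j l) * p) = freq m k * p" if "j l + (int m - 2 * int k) = 0"
      proof -
        have "int m - 2 * int k = - j l" using that by simp
        thus ?thesis by simp
      qed
      ultimately show "(if j l + (int m - 2 * int k) = 0 then cis (- (real_of_int (j l) * p)) else 0) = (if l = m - 1 - k then ?e else 0)"
        by (rule if_cis_cong)
    qed simp
    also have "\<dots> = ?e" using k mN by (subst sum.delta) auto
    finally have 1: "(\<Sum>l\<le>N. if j l + (int m - 2 * int k) = 0 then cis (- (real_of_int (j l) * p)) else 0) = ?e" .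
    have "(\<Sum>l\<le>N. if (int m - 2 * int k) - j l = 0 then cis (real_of_int (j l) * p) else 0)
       = (\<Sum>l\<le>N. if l = k - 1 then ?e else 0)"
    proof (rule sum.cong)
      fix l
      have "(int m - 2 * int k) - j l = 0 \<longleftrightarrow> l = k - 1" unfolding j_def using k mN by auto
      moreover have "real_of_int (j l) * p = freq m k * p" if "(int m - 2 * int k) - j l = 0"
        using that by simp
      ultimately show "(if (int m - 2 * int k) - j l = 0 then cis (real_of_int (j l) * p) else 0) = (if l = k - 1 then ?e else 0)"
        by (rule if_cis_cong)
    qed simp
    also have "\<dots> = ?e" using k mN by (subst sum.delta) auto
    finally have 2: "(\<Sum>l\<le>N. if (int m - 2 * int k) - j l = 0 then cis (real_of_int (j l) * p) else 0) = ?e" .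
    have "(\<Sum>l\<le>N. c k * (((if j l + (int m - 2 * int k) = 0 then cis (- (real_of_int (j l) * p)) else 0)
     + (if (int m - 2 * int k) - j l = 0 then cis (real_of_int (j l) * p) else 0)) / 2)) = c k * ((?e + ?e) / 2)"
      unfolding sum_distrib_left[symmetric] sum_divide_distrib[symmetric] sum.distrib 1 2 ..
    thus "(\<Sum>l\<le>N. c k * (((if j l + (int m - 2 * int k) = 0 then cis (- (real_of_int (j l) * p)) else 0)
     + (if (int m - 2 * int k) - j l = 0 then cis (real_of_int (j l) * p) else 0)) / 2)) = c k * ?e" by simp
  qed simp
  also have "\<dots> = complex_of_real (f p)" unfolding c ..
  finally show ?thesis unfolding j_def N_def by (simp only: of_real_eq_iff)
qed

lemma sum_list_poly:
  "(\<Sum>l\<leftarrow>ls. poly P l + K * l ^ m) = (\<Sum>i\<le>degree P. coeff P i * (\<Sum>l\<leftarrow>ls. l ^ i)) + K * (\<Sum>l\<leftarrow>ls. (l :: real) ^ m)"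
  by (induction ls) (simp_all add: poly_altdef sum.distrib algebra_simps)

text \<open>Expand the power of the cosine into its frequencies. At frequency \<open>j\<close>, the polynomial of degree at most
\<open>j\<close> contributes differences of power sums of index at most \<open>j\<close>; these do not contain the frequency \<open>j\<close>. What is
left is the difference of the power sums of index \<open>m\<close>, with a factor in which \<open>radial_const\<close> and the binomial
weight cancel, so that the frequencies add up to the Dirichlet kernel.\<close>
lemma potential_difference:
  assumes F: "cos_family h ls R n" and F': "cos_family h' ls' R n" and m: "m \<ge> 2"
    and gap: "\<And>i. trig_gap i (\<lambda>t. (\<Sum>l\<leftarrow>ls t. l ^ i) - (\<Sum>l\<leftarrow>ls' t. l ^ i))"
  defines "V \<equiv> \<lambda>z. cos_family.potential h R (m - 1) z - cos_family.potential h' R (m - 1) z"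
  shows "integrable polar V"
    and "(\<integral>z. cos (snd z - p) ^ (m - 2) * V z \<partial>polar)
      = ((\<Sum>l\<leftarrow>ls p. l ^ m) - (\<Sum>l\<leftarrow>ls' p. l ^ m)) / (real m * real (m - 1))"
proof -
  interpret F: cos_family h ls R n by (rule F)
  interpret F': cos_family h' ls' R n by (rule F')
  define N where "N = m - 2"
  define D where "D i t = (\<Sum>l\<leftarrow>ls t. l ^ i) - (\<Sum>l\<leftarrow>ls' t. l ^ i)" for i t
  have D: "trig_gap i (D i)" for i using gap[of i] unfolding D_def .
  have V: "V z = F.potential (m - 1) z - F'.potential (m - 1) z" for z unfolding V_def ..
  have m1: "m - 1 \<ge> 1" using m by simp
  show IV: "integrable polar V" unfolding V
    by (intro Bochner_Integration.integrable_diff F.integrable_potential F'.integrable_potential m1)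
  have wI: "integrable polar (\<lambda>z. cos (b * snd z - a) * W z)" if "integrable polar W" for W b a
    by (rule integrable_bounded_mult[OF that]) auto
  have mode: "real (N choose l) / 2 ^ N * (\<integral>z. cos (freq N l * snd z - freq N l * p) * V z \<partial>polar)
     = (\<integral>t. cos (freq N l * t - freq N l * p) * D m t \<partial>circle) / (real m * real (m - 1))"
    if l: "l \<le> N" for l
  proof -
    define j where "j = nat \<bar>int N - 2 * int l\<bar>"
    define q where "q = min l (N - l)"
    define a where "a = real j * p"
    have m': "m = j + 2 * q + 2" unfolding j_def q_def using l m by (auto simp: N_def min_def split: if_splits)
    have cs: "cos (freq N l * x - freq N l * p) = cos (real j * x - a)" for x
    proof (cases "int N - 2 * int l \<ge> 0")
      case True
      hence "real j = freq N l" unfolding j_def by simp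
      thus ?thesis unfolding a_def by simp
    next
      case False
      hence e: "freq N l = - real j" unfolding j_def by simp
      hence "freq N l * x - freq N l * p = - (real j * x - a)"
        unfolding a_def e by (simp add: algebra_simps)
      thus ?thesis by (simp only: cos_minus)
    qed
    obtain P where P: "radial_poly R j q P" using radial_poly_exists[OF F.R_pos] by blast
    hence dP: "degree P \<le> j" unfolding radial_poly_def by simp
    let ?S = "\<lambda>ls t. (\<Sum>l\<leftarrow>ls t. poly P l + radial_const j q * l ^ m)"
    note A = F.integral_potential[OF P, of a, folded m'] and A' = F'.integral_potential[OF P, of a, folded m']
    have "(\<integral>z. cos (real j * snd z - a) * V z \<partial>polar)
       = (\<integral>z. cos (real j * snd z - a) * F.potential (m - 1) z - cos (real j * snd z - a) * F'.potential (m - 1) z \<partial>polar)"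
      unfolding V by (simp only: right_diff_distrib)
    also have "\<dots> = (\<integral>t. cos (real j * t - a) * ?S ls t \<partial>circle) - (\<integral>t. cos (real j * t - a) * ?S ls' t \<partial>circle)"
      unfolding A(1)[symmetric] A'(1)[symmetric]
      by (intro Bochner_Integration.integral_diff wI F.integrable_potential F'.integrable_potential m1)
    also have "\<dots> = (\<integral>t. cos (real j * t - a) * ?S ls t - cos (real j * t - a) * ?S ls' t \<partial>circle)"
      by (rule Bochner_Integration.integral_diff[symmetric, OF A(2) A'(2)])
    also have "\<dots> = (\<integral>t. (\<Sum>i\<le>degree P. coeff P i * (cos (real j * t - a) * D i t)) + radial_const j q * (cos (real j * t - a) * D m t) \<partial>circle)"
      unfolding sum_list_poly D_def by (simp add: algebra_simps sum_distrib_left sum_subtractf)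
    also have "\<dots> = (\<Sum>i\<le>degree P. coeff P i * (\<integral>t. cos (real j * t - a) * D i t \<partial>circle)) + radial_const j q * (\<integral>t. cos (real j * t - a) * D m t \<partial>circle)"
      using integrable_cos_trig_gap[OF D] by (simp add: Bochner_Integration.integral_sum)
    also have "(\<Sum>i\<le>degree P. coeff P i * (\<integral>t. cos (real j * t - a) * D i t \<partial>circle)) = 0"
      using trig_gap_orthogonal[OF D] dP by (intro sum.neutral) auto
    finally have "(\<integral>z. cos (real j * snd z - a) * V z \<partial>polar) = radial_const j q * (\<integral>t. cos (real j * t - a) * D m t \<partial>circle)" by simp
    moreover have "real (N choose l) / 2 ^ N * radial_const j q = 1 / (real m * real (m - 1))"
    proof -
      have N': "j + 2 * q = N" "j + 2 * q + 1 = m - 1" "m - 1 = Suc N" using m' unfolding N_def by auto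
      have fq: "fact (q + j) * fact q = (fact l * fact (N - l) :: real)"
      proof (cases "l \<le> N - l")
        case True
        hence "q = l" "q + j = N - l" using N' unfolding q_def by (auto simp: min_def)
        thus ?thesis by simp
      next
        case False
        hence "q = N - l" "q + j = l" using N' l unfolding q_def by (auto simp: min_def)
        thus ?thesis by simp
      qed
      have "real (N choose l) * (fact l * fact (N - l)) = fact N"
        using binomial_fact_lemma[OF l] by (metis mult.commute of_nat_fact of_nat_mult)
      hence "real (N choose l) / 2 ^ N * radial_const j q = fact N / (real m * fact (m - 1))"
      proof -
        assume e: "real (N choose l) * (fact l * fact (N - l)) = fact N"
        have "radial_const j q = 2 ^ N * (fact l * fact (N - l)) / (real m * fact (m - 1))"
        proof -
          have "radial_const j q = 2 ^ (j + 2 * q) * (fact l * fact (N - l)) / (real m * fact (j + 2 * q + 1))"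
            unfolding radial_const_def fq unfolding m'[symmetric] ..
          thus ?thesis by (simp only: N'(2)) (simp only: N'(1))
        qed
        hence "real (N choose l) / 2 ^ N * radial_const j q = (real (N choose l) * (fact l * fact (N - l))) / (real m * fact (m - 1))"
          by simp
        thus ?thesis unfolding e .
      qed
      also have "\<dots> = 1 / (real m * real (m - 1))" unfolding N'(3) fact_Suc by simp
      finally show ?thesis .
    qed
    ultimately have "real (N choose l) / 2 ^ N * (\<integral>z. cos (real j * snd z - a) * V z \<partial>polar)
      = 1 / (real m * real (m - 1)) * (\<integral>t. cos (real j * t - a) * D m t \<partial>circle)"
      by (simp only: mult.assoc[symmetric])
    thus ?thesis unfolding cs by simp
  qed
  have "(\<integral>z. cos (snd z - p) ^ N * V z \<partial>polar)
     = (\<integral>z. (\<Sum>l\<le>N. real (N choose l) / 2 ^ N * (cos (freq N l * snd z - freq N l * p) * V z)) \<partial>polar)"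
    unfolding cos_power_expand[of _ N] sum_distrib_right by (simp only: right_diff_distrib mult.assoc)
  also have "\<dots> = (\<Sum>l\<le>N. real (N choose l) / 2 ^ N * (\<integral>z. cos (freq N l * snd z - freq N l * p) * V z \<partial>polar))"
    using wI[OF IV] by (subst Bochner_Integration.integral_sum) (simp_all del: of_int_diff)
  also have "\<dots> = (\<Sum>l\<le>N. (\<integral>t. cos (freq N l * t - freq N l * p) * D m t \<partial>circle) / (real m * real (m - 1)))"
    by (rule sum.cong) (use mode in auto)
  also have "\<dots> = D m p / (real m * real (m - 1))"
    unfolding sum_divide_distrib[symmetric] N_def trig_gap_reproduce[OF D m] ..
  finally show "(\<integral>z. cos (snd z - p) ^ (m - 2) * V z \<partial>polar)
      = ((\<Sum>l\<leftarrow>ls p. l ^ m) - (\<Sum>l\<leftarrow>ls' p. l ^ m)) / (real m * real (m - 1))"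
    unfolding N_def D_def .
qed

section \<open>The hermitian pencil as a trigonometric polynomial\<close>

lemma mat_adjoint_mult:
  fixes A B :: "complex mat"
  assumes A: "A \<in> carrier_mat n n" and B: "B \<in> carrier_mat n n"
  shows "mat_adjoint (A * B) = mat_adjoint B * mat_adjoint A"
proof (rule eq_matI)
  fix i j assume "i < dim_row (mat_adjoint B * mat_adjoint A)" "j < dim_col (mat_adjoint B * mat_adjoint A)"
  hence ij: "i < n" "j < n" using A B by auto
  have "mat_adjoint (A * B) $$ (i, j) = cnj ((A * B) $$ (j, i))"
    using ij A B by (intro mat_adjoint_index) auto
  also have "\<dots> = (\<Sum>k<n. cnj (A $$ (j, k)) * cnj (B $$ (k, i)))"
    using ij A B by (auto simp: scalar_prod_def lessThan_atLeast0)
  also have "\<dots> = (\<Sum>k<n. mat_adjoint B $$ (i, k) * mat_adjoint A $$ (k, j))"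
    using ij A B by (intro sum.cong) (auto simp: mat_adjoint_index)
  also have "\<dots> = (mat_adjoint B * mat_adjoint A) $$ (i, j)"
    using ij A B by (auto simp: scalar_prod_def lessThan_atLeast0)
  finally show "mat_adjoint (A * B) $$ (i, j) = (mat_adjoint B * mat_adjoint A) $$ (i, j)" .
qed (use A B in auto)

lemma mat_adjoint_one: "mat_adjoint (1\<^sub>m n :: complex mat) = 1\<^sub>m n"
  using hermitian_one unfolding hermitian_mat_def .

lemma pow_mat_Suc_left:
  fixes A :: "'a :: semiring_1 mat"
  assumes A: "A \<in> carrier_mat n n"
  shows "A * A ^\<^sub>m k = A ^\<^sub>m k * A"
proof (induction k)
  case (Suc k)
  have K: "A ^\<^sub>m k \<in> carrier_mat n n" using A by (rule pow_carrier_mat)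
  have "A * A ^\<^sub>m Suc k = A * A ^\<^sub>m k * A" using A K by (simp add: assoc_mult_mat[of _ n n _ n _ n])
  thus ?case using Suc by simp
qed (use A in auto)

lemma mat_adjoint_pow:
  fixes A :: "complex mat"
  assumes A: "A \<in> carrier_mat n n"
  shows "mat_adjoint (A ^\<^sub>m k) = mat_adjoint A ^\<^sub>m k"
proof (induction k)
  case 0
  show ?case using A by (simp add: mat_adjoint_one)
next
  case (Suc k)
  have K: "A ^\<^sub>m k \<in> carrier_mat n n" using A by (rule pow_carrier_mat)
  show ?case using mat_adjoint_mult[OF K A] Suc pow_mat_Suc_left[of "mat_adjoint A" n k] A by simp
qed

lemma mat_trace_adjoint:
  fixes A :: "complex mat"
  assumes A: "A \<in> carrier_mat n n"
  shows "mat_trace (mat_adjoint A) = cnj (mat_trace A)"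
  using A mat_trace_carrier[OF A] mat_trace_carrier[of "mat_adjoint A" n n]
  by (simp add: mat_adjoint_index)

lemma smult_pow_mat:
  fixes A :: "'a :: comm_ring_1 mat"
  assumes A: "A \<in> carrier_mat n n"
  shows "(c \<cdot>\<^sub>m A) ^\<^sub>m k = c ^ k \<cdot>\<^sub>m A ^\<^sub>m k"
proof (induction k)
  case 0
  show ?case using A by (auto intro!: eq_matI)
next
  case (Suc k)
  have K: "A ^\<^sub>m k \<in> carrier_mat n n" using A by (rule pow_carrier_mat)
  show ?case using A K Suc
    by (simp add: mult_smult_distrib[of _ n n] mult_smult_assoc_mat[of _ n n] smult_smult_assoc)
      (auto intro!: eq_matI simp: mult_ac)
qed

lemma mat_trace_smult:
  fixes A :: "'a :: comm_ring_1 mat"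
  assumes A: "A \<in> carrier_mat n n"
  shows "mat_trace (c \<cdot>\<^sub>m A) = c * mat_trace A"
  using A mat_trace_carrier[OF A] mat_trace_carrier[of "c \<cdot>\<^sub>m A" n n] by (simp add: sum_distrib_left)

lemma borel_measurable_det:
  fixes f :: "'a \<Rightarrow> complex mat"
  assumes c: "\<And>x. f x \<in> carrier_mat n n"
    and m: "\<And>i j. i < n \<Longrightarrow> j < n \<Longrightarrow> (\<lambda>x. f x $$ (i, j)) \<in> borel_measurable M"
  shows "(\<lambda>x. det (f x)) \<in> borel_measurable M"
proof -
  have "(\<lambda>x. det (f x)) = (\<lambda>x. \<Sum>p | p permutes {0..<n}. signof p * (\<Prod>i = 0..<n. f x $$ (i, p i)))"
    using det_def'[OF c] by auto
  also have "\<dots> \<in> borel_measurable M"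
  proof (intro borel_measurable_sum borel_measurable_times borel_measurable_prod)
    fix p i assume "p \<in> {p. p permutes {0..<n}}" "i \<in> {0..<n}"
    hence "i < n" "p i < n" using permutes_in_image[of p "{0..<n}" i] by auto
    thus "(\<lambda>x. f x $$ (i, p i)) \<in> borel_measurable M" by (rule m)
  qed auto
  finally show ?thesis .
qed

definition dir_mat :: "complex mat \<Rightarrow> complex mat \<Rightarrow> real \<Rightarrow> complex mat" where
  "dir_mat A B t = complex_of_real (cos t) \<cdot>\<^sub>m A + complex_of_real (sin t) \<cdot>\<^sub>m B"

text \<open>Every complex matrix arises in this way from two hermitian ones; its eigenvalues are points of the plane
in which \<open>dir_mat A B t\<close> plays the role of the coordinate in direction \<open>t\<close>.\<close>
definition cart_mat :: "complex mat \<Rightarrow> complex mat \<Rightarrow> complex mat" where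
  "cart_mat A B = A + \<i> \<cdot>\<^sub>m B"

lemma cart_mat_carrier: "A \<in> carrier_mat n n \<Longrightarrow> B \<in> carrier_mat n n \<Longrightarrow> cart_mat A B \<in> carrier_mat n n"
  unfolding cart_mat_def by simp

lemma dir_mat_carrier: "A \<in> carrier_mat n n \<Longrightarrow> B \<in> carrier_mat n n \<Longrightarrow> dir_mat A B t \<in> carrier_mat n n"
  unfolding dir_mat_def by simp

lemma hermitian_index:
  assumes "A \<in> carrier_mat n n" "hermitian_mat A" "i < n" "j < n"
  shows "cnj (A $$ (j, i)) = A $$ (i, j)"
  using mat_adjoint_index[of i A j] assms unfolding hermitian_mat_def by auto

lemma mat_adjoint_cart:
  assumes A: "A \<in> carrier_mat n n" "hermitian_mat A" and B: "B \<in> carrier_mat n n" "hermitian_mat B"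
  shows "mat_adjoint (cart_mat A B) = A + (- \<i>) \<cdot>\<^sub>m B"
  by (rule eq_matI)
    (use A B in \<open>auto simp: cart_mat_def mat_adjoint_index hermitian_index[OF A] hermitian_index[OF B]\<close>)

lemma dir_mat_cart:
  assumes A: "A \<in> carrier_mat n n" "hermitian_mat A" and B: "B \<in> carrier_mat n n" "hermitian_mat B"
  shows "dir_mat A B t = (cis t / 2) \<cdot>\<^sub>m (mat_adjoint (cart_mat A B) + cis (- 2 * t) \<cdot>\<^sub>m cart_mat A B)"
    and "dir_mat A B t = (cis (- t) / 2) \<cdot>\<^sub>m (cart_mat A B + cis (2 * t) \<cdot>\<^sub>m mat_adjoint (cart_mat A B))"
proof -
  have 1: "complex_of_real (cos t) * a + complex_of_real (sin t) * b
     = cis t / 2 * ((a + - \<i> * b) + cis (- 2 * t) * (a + \<i> * b))" for a b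
  proof -
    have "cis t * cis (- 2 * t) = cis (- t)" by (simp add: cis_mult)
    hence "cis t / 2 * ((a + - \<i> * b) + cis (- 2 * t) * (a + \<i> * b)) = (cis t * (a + - \<i> * b) + cis (- t) * (a + \<i> * b)) / 2"
      by (simp add: distrib_left mult.assoc[symmetric])
    also have "\<dots> = complex_of_real (cos t) * a + complex_of_real (sin t) * b"
      by (simp add: complex_eq_iff field_simps)
    finally show ?thesis ..
  qed
  have 2: "cis t * (cis (- (2 * t)) * x) = cis (- t) * x" "cis (- t) * (cis (2 * t) * x) = cis t * x" for x
    by (simp_all add: cis_mult mult.assoc[symmetric])
  show *: "dir_mat A B t = (cis t / 2) \<cdot>\<^sub>m (mat_adjoint (cart_mat A B) + cis (- 2 * t) \<cdot>\<^sub>m cart_mat A B)"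
    unfolding mat_adjoint_cart[OF A B] unfolding dir_mat_def cart_mat_def
    by (rule eq_matI) (use A B 1 in \<open>auto simp del: cis.simps\<close>)
  show "dir_mat A B t = (cis (- t) / 2) \<cdot>\<^sub>m (cart_mat A B + cis (2 * t) \<cdot>\<^sub>m mat_adjoint (cart_mat A B))"
    unfolding * mat_adjoint_cart[OF A B] unfolding cart_mat_def
    by (rule eq_matI) (use A B in \<open>auto simp: distrib_left right_diff_distrib 2 simp del: cis.simps\<close>)
qed

lemma hermitian_dir_mat:
  assumes A: "A \<in> carrier_mat n n" "hermitian_mat A" and B: "B \<in> carrier_mat n n" "hermitian_mat B"
  shows "hermitian_mat (dir_mat A B t)"
  unfolding dir_mat_def
  by (intro hermitian_add[of _ n] hermitian_smult[of _ n]) (use A B in auto)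

lemma mat_trace_dir_mat_pow:
  assumes A: "A \<in> carrier_mat n n" "hermitian_mat A" and B: "B \<in> carrier_mat n n" "hermitian_mat B"
  defines "M \<equiv> cart_mat A B"
  shows "mat_trace (dir_mat A B t ^\<^sub>m i) =
    (\<Sum>k\<le>i. coeff (mat_trace (linear_pencil (mat_adjoint M) M ^\<^sub>m i)) k / 2 ^ i * cis (freq i k * t))"
proof -
  have M: "M \<in> carrier_mat n n" "mat_adjoint M \<in> carrier_mat n n"
    unfolding M_def using cart_mat_carrier[OF A(1) B(1)] by auto
  let ?P = "mat_trace (linear_pencil (mat_adjoint M) M ^\<^sub>m i)"
  let ?X = "mat_adjoint M + cis (- 2 * t) \<cdot>\<^sub>m M"
  have X: "?X \<in> carrier_mat n n" using M by simp
  have "mat_trace (dir_mat A B t ^\<^sub>m i) = (cis t / 2) ^ i * mat_trace (?X ^\<^sub>m i)"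
    unfolding dir_mat_cart(1)[OF A B] M_def[symmetric] smult_pow_mat[OF X] mat_trace_smult[OF pow_carrier_mat[OF X]] ..
  also have "mat_trace (?X ^\<^sub>m i) = poly ?P (cis (- 2 * t))"
    using poly_mat_trace_linear_pencil[OF M(2,1)] by simp
  also have "\<dots> = (\<Sum>k\<le>i. coeff ?P k * cis (- 2 * t) ^ k)"
    unfolding poly_altdef using mat_trace_linear_pencil_coeff(1)[OF M(2,1), of i]
    by (intro sum.mono_neutral_left) (auto simp: coeff_eq_0)
  also have "(cis t / 2) ^ i * (\<Sum>k\<le>i. coeff ?P k * cis (- 2 * t) ^ k) = (\<Sum>k\<le>i. coeff ?P k / 2 ^ i * cis (freq i k * t))"
    unfolding sum_distrib_left
  proof (rule sum.cong)
    fix k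
    have "cis t ^ i * cis (- 2 * t) ^ k = cis (freq i k * t)"
      unfolding Complex.DeMoivre cis_mult by (simp add: algebra_simps)
    thus "(cis t / 2) ^ i * (coeff ?P k * cis (- 2 * t) ^ k) = coeff ?P k / 2 ^ i * cis (freq i k * t)"
      by (simp add: power_divide algebra_simps)
  qed simp
  finally show ?thesis .
qed

lemma scalar_dir_pow:
  "complex_of_real ((Re w * cos t + Im w * sin t) ^ i) =
    (\<Sum>k\<le>i. of_nat (i choose k) * w ^ k * cnj w ^ (i - k) / 2 ^ i * cis (freq i k * t))"
proof -
  have "complex_of_real (Re w * cos t + Im w * sin t) = cis t / 2 * (cis (- 2 * t) * w + cnj w)"
  proof -
    have "cis t * cis (- 2 * t) = cis (- t)" by (simp add: cis_mult)
    hence "cis t / 2 * (cis (- 2 * t) * w + cnj w) = (cis (- t) * w + cis t * cnj w) / 2"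
      by (simp add: distrib_left mult.assoc[symmetric])
    also have "\<dots> = complex_of_real (Re w * cos t + Im w * sin t)"
      by (simp add: complex_eq_iff field_simps)
    finally show ?thesis ..
  qed
  hence "complex_of_real ((Re w * cos t + Im w * sin t) ^ i) = (cis t / 2) ^ i * (cis (- 2 * t) * w + cnj w) ^ i"
    unfolding of_real_power by (simp only: power_mult_distrib)
  also have "(cis (- 2 * t) * w + cnj w) ^ i = (\<Sum>k\<le>i. of_nat (i choose k) * (cis (- 2 * t) * w) ^ k * cnj w ^ (i - k))"
    by (rule binomial_ring)
  also have "(cis t / 2) ^ i * \<dots> = (\<Sum>k\<le>i. of_nat (i choose k) * w ^ k * cnj w ^ (i - k) / 2 ^ i * cis (freq i k * t))"
    unfolding sum_distrib_left
  proof (rule sum.cong)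
    fix k
    have "cis t ^ i * cis (- 2 * t) ^ k = cis (freq i k * t)"
      unfolding Complex.DeMoivre cis_mult by (simp add: algebra_simps)
    thus "(cis t / 2) ^ i * (of_nat (i choose k) * (cis (- 2 * t) * w) ^ k * cnj w ^ (i - k))
       = of_nat (i choose k) * w ^ k * cnj w ^ (i - k) / 2 ^ i * cis (freq i k * t)"
      by (simp add: power_divide power_mult_distrib algebra_simps)
  qed simp
  finally show ?thesis .
qed

text \<open>Both sums are trigonometric polynomials of degree \<open>i\<close>, and both have the extreme coefficients
\<open>tr (M\<^sup>i)\<close> and \<open>tr ((M\<^sup>*)\<^sup>i)\<close>, divided by \<open>2\<^sup>i\<close>.\<close>
lemma trig_gap_spectra:
  assumes A: "A \<in> carrier_mat n n" "hermitian_mat A" and B: "B \<in> carrier_mat n n" "hermitian_mat B"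
    and ls: "\<And>t i. mat_trace (dir_mat A B t ^\<^sub>m i) = complex_of_real (\<Sum>l\<leftarrow>ls t. l ^ i)"
    and ws: "\<And>i. mat_trace (cart_mat A B ^\<^sub>m i) = (\<Sum>w\<leftarrow>ws. w ^ i)"
  shows "trig_gap i (\<lambda>t. (\<Sum>l\<leftarrow>ls t. l ^ i) - (\<Sum>w\<leftarrow>ws. (Re w * cos t + Im w * sin t) ^ i))"
proof -
  define M where "M = cart_mat A B"
  have M: "M \<in> carrier_mat n n" "mat_adjoint M \<in> carrier_mat n n"
    unfolding M_def using cart_mat_carrier[OF A(1) B(1)] by auto
  let ?P = "mat_trace (linear_pencil (mat_adjoint M) M ^\<^sub>m i)"
  define c where "c k = (coeff ?P k - (\<Sum>w\<leftarrow>ws. of_nat (i choose k) * w ^ k * cnj w ^ (i - k))) / 2 ^ i" for k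
  let ?e = "\<lambda>k t. cis (freq i k * t)"
  have s: "complex_of_real (\<Sum>w\<leftarrow>ws'. (Re w * cos t + Im w * sin t) ^ i)
     = (\<Sum>k\<le>i. (\<Sum>w\<leftarrow>ws'. of_nat (i choose k) * w ^ k * cnj w ^ (i - k)) / 2 ^ i * ?e k t)" for t ws'
  proof (induction ws')
    case (Cons w ws')
    thus ?case unfolding list.map sum_list.Cons of_real_add scalar_dir_pow[of w t i]
      by (simp only: sum.distrib[symmetric] distrib_right[symmetric] add_divide_distrib[symmetric])
  qed simp
  have "complex_of_real ((\<Sum>l\<leftarrow>ls t. l ^ i) - (\<Sum>w\<leftarrow>ws. (Re w * cos t + Im w * sin t) ^ i)) = (\<Sum>k\<le>i. c k * ?e k t)" for t
    unfolding of_real_diff s ls[symmetric] mat_trace_dir_mat_pow[OF A B] M_def[symmetric] c_def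
    by (simp only: sum_subtractf[symmetric] left_diff_distrib[symmetric] diff_divide_distrib[symmetric])
  moreover have "(\<Sum>k\<le>i. c k * ?e k t) = (\<Sum>k\<in>{0<..<i}. c k * ?e k t)" for t
  proof (rule sum.mono_neutral_right)
    have c0: "c 0 = 0"
    proof -
      have "coeff ?P 0 = mat_trace (mat_adjoint M ^\<^sub>m i)" by (rule mat_trace_linear_pencil_coeff(3)[OF M(2,1)])
      also have "\<dots> = cnj (\<Sum>w\<leftarrow>ws. w ^ i)"
        unfolding mat_adjoint_pow[OF M(1), symmetric] mat_trace_adjoint[OF pow_carrier_mat[OF M(1)]]
        unfolding M_def ws ..
      also have "\<dots> = (\<Sum>w\<leftarrow>ws. cnj w ^ i)" by (induction ws) auto
      finally show ?thesis unfolding c_def by simp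
    qed
    have ci: "c i = 0"
      unfolding c_def mat_trace_linear_pencil_coeff(2)[OF M(2,1)] by (simp add: M_def ws)
    show "\<forall>k\<in>{..i} - {0<..<i}. c k * ?e k t = 0"
    proof
      fix k assume "k \<in> {..i} - {0<..<i}"
      hence "k = 0 \<or> k = i" by auto
      thus "c k * ?e k t = 0" using c0 ci by auto
    qed
  qed auto
  ultimately show ?thesis unfolding trig_gap_def by auto
qed

section \<open>Positivity of the difference\<close>

text \<open>Up to a factor of modulus \<open>2\<^sup>-\<^sup>n\<close>, the determinant is the value at \<open>e\<^sup>2\<^sup>i\<^sup>t\<close> of the polynomial
\<open>det (N + y N\<^sup>*)\<close>, to which Jensen's inequality applies. A root \<open>y\<close> of this polynomial comes with a vector \<open>v\<close>
such that \<open>v\<^sup>*Nv = - y\<close> times the conjugate of \<open>v\<^sup>*Nv\<close>, so that \<open>\<bar>y\<bar> = 1\<close> unless \<open>v\<^sup>*Nv\<close> vanishes.\<close>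
lemma mean_ln_det:
  assumes C: "C \<in> carrier_mat n n" "hermitian_mat C" and D: "D \<in> carrier_mat n n" "hermitian_mat D"
  defines "N \<equiv> cart_mat C D"
  assumes d: "det N \<noteq> 0"
  shows "ln (norm (det N)) - real n * ln 2 \<le> (\<integral>t. ln (norm (det (dir_mat C D t))) \<partial>circle)"
    and "(\<And>v. v \<in> carrier_vec n \<Longrightarrow> v \<noteq> 0\<^sub>v n \<Longrightarrow> form N v v \<noteq> 0) \<Longrightarrow>
      (\<integral>t. ln (norm (det (dir_mat C D t))) \<partial>circle) = ln (norm (det N)) - real n * ln 2"
proof -
  have N: "N \<in> carrier_mat n n" "mat_adjoint N \<in> carrier_mat n n"
    unfolding N_def using cart_mat_carrier[OF C(1) D(1)] by auto
  define Q where "Q = det (linear_pencil N (mat_adjoint N))"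
  have Q: "poly Q y = det (N + y \<cdot>\<^sub>m mat_adjoint N)" for y
    unfolding Q_def by (rule poly_det_linear_pencil[OF N])
  have "0 \<cdot>\<^sub>m mat_adjoint N = 0\<^sub>m n n" using N by auto
  hence Q0: "poly Q 0 = det N" unfolding Q using N by simp
  have nrm: "norm (det (dir_mat C D t)) = norm (poly Q (cis (2 * t))) / 2 ^ n" for t
  proof -
    have "N + cis (2 * t) \<cdot>\<^sub>m mat_adjoint N \<in> carrier_mat n n" "dim_row N = n" using N by simp_all
    hence "det (dir_mat C D t) = (cis (- t) / 2) ^ n * poly Q (cis (2 * t))"
      unfolding dir_mat_cart(2)[OF C D] N_def[symmetric] Q by (simp add: det_smult carrier_matD)
    thus ?thesis by (simp add: norm_mult norm_power norm_divide power_divide)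
  qed
  have Qne: "poly Q 0 \<noteq> 0" using d Q0 by simp
  note J = jensen_poly[OF Qne]
  have "(\<integral>t. ln (norm (det (dir_mat C D t))) \<partial>circle) = (\<integral>t. ln (norm (poly Q (cis (2 * t)))) - real n * ln 2 \<partial>circle)"
  proof (rule integral_cong_AE)
    have m: "(\<lambda>t. poly Q (cis (2 * t))) \<in> borel_measurable circle"
    proof -
      have "(\<lambda>t. poly Q (cis (2 * t))) \<in> borel_measurable borel"
        by (intro borel_measurable_continuous_onI continuous_intros)
      thus ?thesis by simp
    qed
    show "(\<lambda>t. ln (norm (det (dir_mat C D t)))) \<in> borel_measurable circle"
      unfolding nrm using m by measurable
    show "(\<lambda>t. ln (norm (poly Q (cis (2 * t)))) - real n * ln 2) \<in> borel_measurable circle"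
      using m by measurable
    show "AE t in circle. ln (norm (det (dir_mat C D t))) = ln (norm (poly Q (cis (2 * t)))) - real n * ln 2"
      using J(4) by eventually_elim (simp add: nrm ln_div ln_realpow)
  qed
  also have "\<dots> = (\<integral>t. ln (norm (poly Q (cis (2 * t)))) \<partial>circle) - real n * ln 2"
    using J(1) circle.prob_space by simp
  finally have I: "(\<integral>t. ln (norm (det (dir_mat C D t))) \<partial>circle) = (\<integral>t. ln (norm (poly Q (cis (2 * t)))) \<partial>circle) - real n * ln 2" .
  show "ln (norm (det N)) - real n * ln 2 \<le> (\<integral>t. ln (norm (det (dir_mat C D t))) \<partial>circle)"
    unfolding I using J(2) Q0 by simp
  show "(\<integral>t. ln (norm (det (dir_mat C D t))) \<partial>circle) = ln (norm (det N)) - real n * ln 2"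
    if ne: "\<And>v. v \<in> carrier_vec n \<Longrightarrow> v \<noteq> 0\<^sub>v n \<Longrightarrow> form N v v \<noteq> 0"
  proof -
    have "norm y = 1" if "poly Q y = 0" for y
    proof -
      let ?X = "N + y \<cdot>\<^sub>m mat_adjoint N"
      have X: "?X \<in> carrier_mat n n" using N by simp
      have "det ?X = 0" using that Q by simp
      then obtain v where v: "v \<in> carrier_vec n" "v \<noteq> 0\<^sub>v n" "?X *\<^sub>v v = 0\<^sub>v n"
        using det_0_iff_vec_prod_zero[OF X] by auto
      have "form ?X v v = 0" unfolding form_def v(3) using v(1) by simp
      moreover have "form ?X v v = form N v v + y * cnj (form N v v)"
        using N v by (simp add: form_add_mat[where n = n] form_smult_mat[where n = n] form_adjoint[where n = n])
      ultimately have "form N v v = - (y * cnj (form N v v))" by (simp add: eq_neg_iff_add_eq_0)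
      from arg_cong[OF this, of norm] have "norm (form N v v) = norm y * norm (form N v v)"
        by (simp only: norm_minus_cancel norm_mult complex_mod_cnj)
      thus ?thesis using ne[OF v(1,2)] by simp
    qed
    thus ?thesis unfolding I using J(3) Q0 by simp
  qed
qed

lemma mean_ln_scalar:
  assumes "z \<noteq> 0"
  shows "integrable circle (\<lambda>t. ln \<bar>Re z * cos t + Im z * sin t\<bar>)"
    "(\<integral>t. ln \<bar>Re z * cos t + Im z * sin t\<bar> \<partial>circle) = ln (norm z) - ln 2"
    "AE t in circle. Re z * cos t + Im z * sin t \<noteq> 0"
proof -
  have r: "norm z > 0" using assms by simp
  have e: "Re z * cos t + Im z * sin t = norm z * cos (t - Arg z) - 0" for t
  proof -
    have "Re z = norm z * cos (Arg z)" "Im z = norm z * sin (Arg z)"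
      using assms by (simp_all add: cos_Arg sin_Arg)
    thus ?thesis by (simp only: cos_diff) (simp add: algebra_simps)
  qed
  note L = ln_cos_mode[OF r, where t = "Arg z" and l = 0]
  show "integrable circle (\<lambda>t. ln \<bar>Re z * cos t + Im z * sin t\<bar>)" unfolding e by (rule L(1))
  show "AE t in circle. Re z * cos t + Im z * sin t \<noteq> 0" unfolding e by (rule L(3))
  show "(\<integral>t. ln \<bar>Re z * cos t + Im z * sin t\<bar> \<partial>circle) = ln (norm z) - ln 2" unfolding e
    using L(2)[of 0 0] r by (simp add: log_mode_def ln_div)
qed

lemma mean_ln_scalar_prod:
  assumes "\<And>z. z \<in> set zs \<Longrightarrow> z \<noteq> 0"
  shows "(\<integral>t. ln \<bar>\<Prod>z\<leftarrow>zs. Re z * cos t + Im z * sin t\<bar> \<partial>circle)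
    = ln (norm (\<Prod>z\<leftarrow>zs. z)) - real (length zs) * ln 2"
proof -
  have "(\<integral>t. ln \<bar>\<Prod>z\<leftarrow>zs. Re z * cos t + Im z * sin t\<bar> \<partial>circle) = (\<integral>t. (\<Sum>z\<leftarrow>zs. ln \<bar>Re z * cos t + Im z * sin t\<bar>) \<partial>circle)"
  proof (rule integral_cong_AE)
    have "(\<lambda>t. \<Prod>z\<leftarrow>zs. Re z * cos t + Im z * sin t) \<in> borel_measurable borel"
      by (intro borel_measurable_continuous_onI, induction zs) (auto intro!: continuous_intros)
    thus "(\<lambda>t. ln \<bar>\<Prod>z\<leftarrow>zs. Re z * cos t + Im z * sin t\<bar>) \<in> borel_measurable circle" by simp
    show "(\<lambda>t. \<Sum>z\<leftarrow>zs. ln \<bar>Re z * cos t + Im z * sin t\<bar>) \<in> borel_measurable circle"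
      using integral_sum_list(1)[of zs circle "\<lambda>z t. ln \<bar>Re z * cos t + Im z * sin t\<bar>"] mean_ln_scalar(1) assms
      by (auto intro: borel_measurable_integrable)
    have "AE t in circle. \<forall>z\<in>set zs. Re z * cos t + Im z * sin t \<noteq> 0"
      by (rule AE_finite_allI) (use mean_ln_scalar(3) assms in auto)
    thus "AE t in circle. ln \<bar>\<Prod>z\<leftarrow>zs. Re z * cos t + Im z * sin t\<bar> = (\<Sum>z\<leftarrow>zs. ln \<bar>Re z * cos t + Im z * sin t\<bar>)"
      by eventually_elim (rule ln_abs_prod_list, auto)
  qed
  also have "\<dots> = (\<Sum>z\<leftarrow>zs. \<integral>t. ln \<bar>Re z * cos t + Im z * sin t\<bar> \<partial>circle)"
    by (rule integral_sum_list(2)) (use mean_ln_scalar(1) assms in auto)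
  also have "\<dots> = (\<Sum>z\<leftarrow>zs. ln (norm z) - ln 2)"
    using mean_ln_scalar(2) assms by (intro arg_cong[of _ _ sum_list] map_cong) auto
  also have "\<dots> = ln (norm (\<Prod>z\<leftarrow>zs. z)) - real (length zs) * ln 2"
    using assms
  proof (induction zs)
    case (Cons z zs)
    hence "(\<Prod>z\<leftarrow>zs. z) \<noteq> 0" by (auto simp: prod_list_zero_iff)
    thus ?case using Cons by (simp add: norm_mult ln_mult_pos algebra_simps)
  qed simp
  finally show ?thesis .
qed

text \<open>The matrix \<open>a - A\<close>, as a sum of real multiples of hermitian matrices.\<close>
definition shift_mat :: "nat \<Rightarrow> real \<Rightarrow> complex mat \<Rightarrow> complex mat" where
  "shift_mat n a A = complex_of_real a \<cdot>\<^sub>m 1\<^sub>m n + complex_of_real (- 1) \<cdot>\<^sub>m A"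

lemma shift_mat:
  assumes A: "A \<in> carrier_mat n n"
  shows "shift_mat n a A \<in> carrier_mat n n" "hermitian_mat A \<Longrightarrow> hermitian_mat (shift_mat n a A)"
    "v \<in> carrier_vec n \<Longrightarrow> form (shift_mat n a A) v v = of_real a * (v \<bullet>c v) - form A v v"
proof -
  show "shift_mat n a A \<in> carrier_mat n n" unfolding shift_mat_def using A by simp
  show "hermitian_mat (shift_mat n a A)" if "hermitian_mat A"
    unfolding shift_mat_def
    by (intro hermitian_add[of _ n] hermitian_smult[of _ n] hermitian_one) (use A that in auto)
  show "form (shift_mat n a A) v v = of_real a * (v \<bullet>c v) - form A v v" if "v \<in> carrier_vec n"
    unfolding shift_mat_def using A that
    by (simp add: form_add_mat[where n = n] form_smult_mat[where n = n] form_one)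
qed

lemma cart_shift_mat:
  assumes "A \<in> carrier_mat n n" "B \<in> carrier_mat n n"
  shows "cart_mat (shift_mat n a A) (shift_mat n b B) = Complex a b \<cdot>\<^sub>m 1\<^sub>m n - cart_mat A B"
  by (rule eq_matI) (use assms in \<open>auto simp: cart_mat_def shift_mat_def complex_eq_iff\<close>)

lemma dir_shift_mat:
  assumes "A \<in> carrier_mat n n" "B \<in> carrier_mat n n"
  shows "dir_mat (shift_mat n a A) (shift_mat n b B) t
    = complex_of_real (a * cos t + b * sin t) \<cdot>\<^sub>m 1\<^sub>m n - dir_mat A B t"
  by (rule eq_matI) (use assms in \<open>auto simp: dir_mat_def shift_mat_def algebra_simps\<close>)

lemma form_cart_mat:
  assumes A: "A \<in> carrier_mat n n" "hermitian_mat A" and B: "B \<in> carrier_mat n n" "hermitian_mat B"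
    and v: "v \<in> carrier_vec n"
  shows "Re (form (cart_mat A B) v v) = Re (form A v v)" "Im (form (cart_mat A B) v v) = Re (form B v v)"
  unfolding cart_mat_def using A B v form_hermitian_real[OF A v] form_hermitian_real[OF B v]
  by (simp_all add: form_add_mat[where n = n] form_smult_mat[where n = n])

lemma psd_form_nonneg:
  assumes "A \<in> carrier_mat n n" "pos_semidef_mat A" "v \<in> carrier_vec n"
  shows "0 \<le> Re (form A v v)"
  using assms hermitian_form_nonneg[of A n v] unfolding pos_semidef_mat_def
  by (auto simp: less_eq_complex_def)

text \<open>At a unit eigenvector, the form of \<open>A + i B\<close> takes the eigenvalue as its value, and the forms of \<open>A\<close> and
\<open>B\<close> are its real and imaginary parts.\<close>
lemma cart_eigenvalue_quadrant:
  assumes A: "A \<in> carrier_mat n n" "pos_semidef_mat A" and B: "B \<in> carrier_mat n n" "pos_semidef_mat B"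
    and w: "eigenvalue (cart_mat A B) w"
  shows "0 \<le> Re w" "0 \<le> Im w"
proof -
  obtain v where v: "eigenvector (cart_mat A B) v w" using w unfolding eigenvalue_def by blast
  note F = form_eigenvector[OF cart_mat_carrier[OF A(1) B(1)] v]
  have h: "hermitian_mat A" "hermitian_mat B" using A B unfolding pos_semidef_mat_def by auto
  note N = norm_sq_vec_pos[OF F(1,2)]
  have "Re (form A v v) = Re w * Re (v \<bullet>c v)" "Re (form B v v) = Im w * Re (v \<bullet>c v)"
    using form_cart_mat[OF A(1) h(1) B(1) h(2) F(1)] F(3) N(2) by simp_all
  with psd_form_nonneg[OF A F(1)] psd_form_nonneg[OF B F(1)] N(1)
  show "0 \<le> Re w" "0 \<le> Im w" by (auto simp: zero_le_mult_iff)
qed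

lemma hermitian_dir_spectrum:
  assumes A: "A \<in> carrier_mat n n" "hermitian_mat A" and B: "B \<in> carrier_mat n n" "hermitian_mat B"
  obtains ls :: "real \<Rightarrow> real list" and R :: real where
    "\<And>t. length (ls t) = n" "\<And>t i. mat_trace (dir_mat A B t ^\<^sub>m i) = complex_of_real (\<Sum>l\<leftarrow>ls t. l ^ i)"
    "\<And>t c. det (complex_of_real c \<cdot>\<^sub>m 1\<^sub>m n - dir_mat A B t) = complex_of_real (\<Prod>l\<leftarrow>ls t. c - l)"
    "\<And>t l. l \<in> set (ls t) \<Longrightarrow> \<bar>l\<bar> \<le> R"
proof -
  define K where "K X = (\<Sum>i<n. \<Sum>j<n. cmod (X $$ (i, j)))" for X :: "complex mat"
  define S where "S t es \<longleftrightarrow> length es = n \<and> (\<forall>i. mat_trace (dir_mat A B t ^\<^sub>m i) = complex_of_real (\<Sum>l\<leftarrow>es. l ^ i)) \<and>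
     (\<forall>c. det (complex_of_real c \<cdot>\<^sub>m 1\<^sub>m n - dir_mat A B t) = complex_of_real (\<Prod>l\<leftarrow>es. c - l)) \<and>
     (\<forall>l\<in>set es. \<bar>l\<bar> \<le> K A + K B)" for t es
  have ex: "\<exists>es. S t es" for t
  proof -
    have H: "dir_mat A B t \<in> carrier_mat n n" "hermitian_mat (dir_mat A B t)"
      using dir_mat_carrier[OF A(1) B(1)] hermitian_dir_mat[OF A B] by auto
    obtain es where es: "length es = n" "\<And>k. mat_trace (dir_mat A B t ^\<^sub>m k) = (\<Sum>e\<leftarrow>es. e ^ k)"
      "\<And>c. det (c \<cdot>\<^sub>m 1\<^sub>m n - dir_mat A B t) = (\<Prod>e\<leftarrow>es. c - e)" "\<And>e. e \<in> set es \<Longrightarrow> eigenvalue (dir_mat A B t) e"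
      using complex_mat_spectrum[OF H(1)] by blast
    have re: "e = complex_of_real (Re e)" if "e \<in> set es" for e
      using hermitian_eigenvalue_real[OF H es(4)[OF that]] by (simp add: complex_eq_iff)
    have bd: "\<bar>Re e\<bar> \<le> K A + K B" if "e \<in> set es" for e
    proof -
      obtain v where v: "eigenvector (dir_mat A B t) v e" using es(4)[OF \<open>e \<in> set es\<close>] unfolding eigenvalue_def by blast
      note F = form_eigenvector[OF H(1) v] and N = norm_sq_vec_pos[OF form_eigenvector(1,2)[OF H(1) v]]
      have "form (dir_mat A B t) v v = of_real (cos t) * form A v v + of_real (sin t) * form B v v"
        unfolding dir_mat_def using A B F(1) by (simp add: form_add_mat[where n = n] form_smult_mat[where n = n])
      hence "norm (e * (v \<bullet>c v)) = norm (of_real (cos t) * form A v v + of_real (sin t) * form B v v)"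
        by (simp only: F(3))
      also have "\<dots> \<le> norm (of_real (cos t) * form A v v) + norm (of_real (sin t) * form B v v)"
        by (rule norm_triangle_ineq)
      also have "\<dots> \<le> 1 * norm (form A v v) + 1 * norm (form B v v)"
        unfolding norm_mult norm_of_real by (intro add_mono mult_right_mono) auto
      also have "\<dots> \<le> (K A + K B) * Re (v \<bullet>c v)"
        using form_cmod_le[OF A(1) F(1)] form_cmod_le[OF B(1) F(1)] unfolding K_def by (simp add: distrib_right)
      finally have "norm e * Re (v \<bullet>c v) \<le> (K A + K B) * Re (v \<bullet>c v)"
      proof -
        have "norm (v \<bullet>c v) = Re (v \<bullet>c v)" using N by (simp add: cmod_def)
        moreover assume "norm (e * (v \<bullet>c v)) \<le> (K A + K B) * Re (v \<bullet>c v)"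
        ultimately show ?thesis by (simp only: norm_mult)
      qed
      hence "norm e \<le> K A + K B" using N(1) by simp
      thus ?thesis using abs_Re_le_cmod[of e] by linarith
    qed
    define rs where "rs = map Re es"
    have es_rs: "es = map complex_of_real rs"
      unfolding rs_def map_map o_def by (rule map_idI[symmetric]) (rule re[symmetric])
    have tr: "(\<Sum>e\<leftarrow>es. e ^ k) = complex_of_real (\<Sum>l\<leftarrow>rs. l ^ k)" for k
      unfolding es_rs by (induction rs) auto
    have pr: "(\<Prod>e\<leftarrow>es. complex_of_real c - e) = complex_of_real (\<Prod>l\<leftarrow>rs. c - l)" for c
      unfolding es_rs by (induction rs) auto
    have "length rs = n" "\<forall>l\<in>set rs. \<bar>l\<bar> \<le> K A + K B" using es(1) bd unfolding rs_def by auto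
    hence "S t rs" unfolding S_def using es(2) es(3) by (simp add: tr pr)
    thus ?thesis by (rule exI)
  qed
  have "\<forall>t. \<exists>es. S t es" using ex by blast
  from choice[OF this] obtain ls where ls: "\<And>t. S t (ls t)" by blast
  show ?thesis
    by (rule that[of ls "K A + K B"]) (use ls in \<open>auto simp: S_def\<close>)
qed

section \<open>Nonnegative coefficients\<close>

text \<open>This is Jensen's inequality for \<open>N = z - (A + i B)\<close> with \<open>z = re\<^sup>i\<^sup>x\<close>: for the scalars \<open>z - w\<close> equality
holds, and the product of these scalars is \<open>det N\<close>. If \<open>z\<close> is outside the closed quadrant, then the real or the
imaginary part of \<open>v\<^sup>*Nv\<close> is negative for all \<open>v \<noteq> 0\<close>, so that equality holds for \<open>N\<close> as well.\<close>
lemma potential_gap: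
  fixes r x :: real
  assumes A: "A \<in> carrier_mat n n" "pos_semidef_mat A" and B: "B \<in> carrier_mat n n" "pos_semidef_mat B"
    and ws: "length ws = n" "\<And>c. det (c \<cdot>\<^sub>m 1\<^sub>m n - cart_mat A B) = (\<Prod>w\<leftarrow>ws. c - w)"
    and z: "Complex (r * cos x) (r * sin x) \<notin> set ws"
  defines "E \<equiv> \<integral>t. ln (norm (det (complex_of_real (r * cos (x - t)) \<cdot>\<^sub>m 1\<^sub>m n - dir_mat A B t))) \<partial>circle"
    and "E' \<equiv> \<integral>t. ln \<bar>\<Prod>w\<leftarrow>ws. r * cos (x - t) - (Re w * cos t + Im w * sin t)\<bar> \<partial>circle"
  shows "E' \<le> E" and "r > 0 \<Longrightarrow> cos x < 0 \<or> sin x < 0 \<Longrightarrow> E = E'"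
proof -
  define a b where "a = r * cos x" and "b = r * sin x"
  have h: "hermitian_mat A" "hermitian_mat B" using A B unfolding pos_semidef_mat_def by auto
  have ab: "r * cos (x - t) = a * cos t + b * sin t" for t
    unfolding a_def b_def by (simp add: cos_diff algebra_simps)
  let ?C = "shift_mat n a A" and ?D = "shift_mat n b B"
  note C = shift_mat(1)[OF A(1), of a] shift_mat(2)[OF A(1) h(1), of a]
    and D = shift_mat(1)[OF B(1), of b] shift_mat(2)[OF B(1) h(2), of b]
  have E: "E = (\<integral>t. ln (norm (det (dir_mat ?C ?D t))) \<partial>circle)"
    unfolding E_def ab dir_shift_mat[OF A(1) B(1)] ..
  define zs where "zs = map (\<lambda>w. Complex a b - w) ws"
  have zs: "\<zeta> \<noteq> 0" if "\<zeta> \<in> set zs" for \<zeta> using that z unfolding zs_def a_def b_def by auto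
  have len: "length zs = n" using ws(1) unfolding zs_def by simp
  have pr: "(\<Prod>w\<leftarrow>ws. r * cos (x - t) - (Re w * cos t + Im w * sin t)) = (\<Prod>\<zeta>\<leftarrow>zs. Re \<zeta> * cos t + Im \<zeta> * sin t)" for t
    unfolding zs_def ab by (simp add: o_def algebra_simps)
  have E': "E' = ln (norm (\<Prod>\<zeta>\<leftarrow>zs. \<zeta>)) - real n * ln 2"
  proof -
    have "(\<integral>t. ln \<bar>\<Prod>\<zeta>\<leftarrow>zs. Re \<zeta> * cos t + Im \<zeta> * sin t\<bar> \<partial>circle) = ln (norm (\<Prod>\<zeta>\<leftarrow>zs. \<zeta>)) - real (length zs) * ln 2"
      by (rule mean_ln_scalar_prod) (rule zs)
    thus ?thesis unfolding E'_def pr len .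
  qed
  have dN: "det (cart_mat ?C ?D) = (\<Prod>\<zeta>\<leftarrow>zs. \<zeta>)"
    unfolding cart_shift_mat[OF A(1) B(1)] ws(2) zs_def by simp
  have d0: "det (cart_mat ?C ?D) \<noteq> 0" unfolding dN using zs by (auto simp: prod_list_zero_iff)
  show "E' \<le> E" unfolding E E' using mean_ln_det(1)[OF C D d0] unfolding dN .
  show "E = E'" if r: "r > 0" and s: "cos x < 0 \<or> sin x < 0"
  proof -
    have "form (cart_mat ?C ?D) v v \<noteq> 0" if v: "v \<in> carrier_vec n" "v \<noteq> 0\<^sub>v n" for v
    proof -
      note N = norm_sq_vec_pos[OF v]
      have F: "Re (form (cart_mat ?C ?D) v v) = a * Re (v \<bullet>c v) - Re (form A v v)"
        "Im (form (cart_mat ?C ?D) v v) = b * Re (v \<bullet>c v) - Re (form B v v)"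
        using form_cart_mat[OF C D v(1)] shift_mat(3)[OF A(1) v(1), of a] shift_mat(3)[OF B(1) v(1), of b] by simp_all
      have P: "0 \<le> Re (form A v v)" "0 \<le> Re (form B v v)"
        using psd_form_nonneg[OF A v(1)] psd_form_nonneg[OF B v(1)] by auto
      have "a < 0 \<or> b < 0" unfolding a_def b_def using r s by (auto simp: mult_less_0_iff)
      hence "a * Re (v \<bullet>c v) < 0 \<or> b * Re (v \<bullet>c v) < 0" using N(1) by (auto simp: mult_less_0_iff)
      hence "Re (form (cart_mat ?C ?D) v v) < 0 \<or> Im (form (cart_mat ?C ?D) v v) < 0"
        unfolding F using P by linarith
      thus ?thesis by auto
    qed
    thus ?thesis unfolding E E' using mean_ln_det(2)[OF C D d0] unfolding dN by blast
  qed
qed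

lemma cos_family_dir_mat:
  assumes A: "A \<in> carrier_mat n n" and B: "B \<in> carrier_mat n n"
    and ls: "\<And>t. length (ls t) = n" "\<And>t l. l \<in> set (ls t) \<Longrightarrow> \<bar>l\<bar> \<le> R" "R > 0"
    and d: "\<And>t c. det (complex_of_real c \<cdot>\<^sub>m 1\<^sub>m n - dir_mat A B t) = complex_of_real (\<Prod>l\<leftarrow>ls t. c - l)"
  shows "cos_family (\<lambda>r x t. Re (det (complex_of_real (r * cos (x - t)) \<cdot>\<^sub>m 1\<^sub>m n - dir_mat A B t))) ls R n"
proof
  show "(\<lambda>x. Re (det (complex_of_real (fst (fst x) * cos (snd (fst x) - snd x)) \<cdot>\<^sub>m 1\<^sub>m n - dir_mat A B (snd x))))
    \<in> borel_measurable ((borel \<Otimes>\<^sub>M borel) \<Otimes>\<^sub>M borel)" (is "(\<lambda>x. Re (det (?X x))) \<in> _")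
  proof -
    have "(\<lambda>x. det (?X x)) \<in> borel_measurable ((borel \<Otimes>\<^sub>M borel) \<Otimes>\<^sub>M borel)"
    proof (rule borel_measurable_det)
      show "?X x \<in> carrier_mat n n" for x
        by (intro minus_carrier_mat dir_mat_carrier[OF A B])
      fix i j assume ij: "i < n" "j < n"
      have "?X x $$ (i, j) = complex_of_real (fst (fst x) * cos (snd (fst x) - snd x)) * (if i = j then 1 else 0)
         - (complex_of_real (cos (snd x)) * A $$ (i, j) + complex_of_real (sin (snd x)) * B $$ (i, j))" for x
        using A B ij by (simp add: dir_mat_def)
      thus "(\<lambda>x. ?X x $$ (i, j)) \<in> borel_measurable ((borel \<Otimes>\<^sub>M borel) \<Otimes>\<^sub>M borel)"
        by (simp only:) measurable
    qed
    thus ?thesis by measurable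
  qed
  show "Re (det (complex_of_real (r * cos (x - t)) \<cdot>\<^sub>m 1\<^sub>m n - dir_mat A B t)) = (\<Prod>l\<leftarrow>ls t. r * cos (x - t) - l)" for r x t
    by (simp only: d Re_complex_of_real)
qed (use ls in auto)

lemma cos_family_scalars:
  assumes "length ws = n" "\<And>w. w \<in> set ws \<Longrightarrow> 2 * norm w \<le> R" "R > 0"
  shows "cos_family (\<lambda>r x t. \<Prod>w\<leftarrow>ws. r * cos (x - t) - (Re w * cos t + Im w * sin t))
    (\<lambda>t. map (\<lambda>w. Re w * cos t + Im w * sin t) ws) R n"
proof
  show "(\<lambda>x. \<Prod>w\<leftarrow>ws. fst (fst x) * cos (snd (fst x) - snd x) - (Re w * cos (snd x) + Im w * sin (snd x)))
    \<in> borel_measurable ((borel \<Otimes>\<^sub>M borel) \<Otimes>\<^sub>M borel)"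
    by (induction ws) simp_all
  fix t l assume "l \<in> set (map (\<lambda>w. Re w * cos t + Im w * sin t) ws)"
  then obtain w where w: "w \<in> set ws" "l = Re w * cos t + Im w * sin t" by auto
  have "\<bar>l\<bar> \<le> \<bar>Re w\<bar> * \<bar>cos t\<bar> + \<bar>Im w\<bar> * \<bar>sin t\<bar>"
    unfolding w(2) using abs_triangle_ineq[of "Re w * cos t" "Im w * sin t"] by (simp add: abs_mult)
  also have "\<dots> \<le> norm w * 1 + norm w * 1"
    by (intro add_mono mult_mono abs_Re_le_cmod abs_Im_le_cmod) auto
  finally show "\<bar>l\<bar> \<le> R" using assms(2)[OF w(1)] by simp
qed (use assms in \<open>auto simp: o_def\<close>)

text \<open>The numbers \<open>I k\<close> are, up to positive factors, the integrals of the difference of the two potentials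
against products of powers of the cosine and the sine of the angle. The difference is nonnegative and vanishes where the sine or the
cosine is negative.\<close>
lemma trace_representation:
  assumes A: "A \<in> carrier_mat n n" "pos_semidef_mat A" and B: "B \<in> carrier_mat n n" "pos_semidef_mat B"
  obtains ws :: "complex list" and I :: "nat \<Rightarrow> real" where
    "\<And>w. w \<in> set ws \<Longrightarrow> 0 \<le> Re w \<and> 0 \<le> Im w" "\<And>k. 0 \<le> I k"
    "\<And>p. mat_trace (dir_mat A B p ^\<^sub>m m) = complex_of_real
      ((\<Sum>w\<leftarrow>ws. (Re w * cos p + Im w * sin p) ^ m) +
       (if m < 2 then 0 else \<Sum>k\<le>m - 2. I k * cos p ^ (m - 2 - k) * sin p ^ k))"
proof -
  have h: "hermitian_mat A" "hermitian_mat B" using A B unfolding pos_semidef_mat_def by auto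
  obtain ws where ws: "length ws = n" "\<And>k. mat_trace (cart_mat A B ^\<^sub>m k) = (\<Sum>w\<leftarrow>ws. w ^ k)"
    "\<And>c. det (c \<cdot>\<^sub>m 1\<^sub>m n - cart_mat A B) = (\<Prod>w\<leftarrow>ws. c - w)"
    "\<And>w. w \<in> set ws \<Longrightarrow> eigenvalue (cart_mat A B) w"
    using complex_mat_spectrum[OF cart_mat_carrier[OF A(1) B(1)]] by blast
  obtain ls R0 where ls: "\<And>t. length (ls t) = n"
    "\<And>t i. mat_trace (dir_mat A B t ^\<^sub>m i) = complex_of_real (\<Sum>l\<leftarrow>ls t. l ^ i)"
    "\<And>t c. det (complex_of_real c \<cdot>\<^sub>m 1\<^sub>m n - dir_mat A B t) = complex_of_real (\<Prod>l\<leftarrow>ls t. c - l)"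
    "\<And>t l. l \<in> set (ls t) \<Longrightarrow> \<bar>l\<bar> \<le> R0"
    using hermitian_dir_spectrum[OF A(1) h(1) B(1) h(2)] by blast
  define ls' where "ls' t = map (\<lambda>w. Re w * cos t + Im w * sin t) ws" for t
  have gap: "trig_gap i (\<lambda>t. (\<Sum>l\<leftarrow>ls t. l ^ i) - (\<Sum>l\<leftarrow>ls' t. l ^ i))" for i
    using trig_gap_spectra[OF A(1) h(1) B(1) h(2) ls(2) ws(2)] unfolding ls'_def by (simp add: o_def)
  have quad: "0 \<le> Re w \<and> 0 \<le> Im w" if "w \<in> set ws" for w
    using cart_eigenvalue_quadrant[OF A B ws(4)[OF that]] by simp
  have rep: "mat_trace (dir_mat A B p ^\<^sub>m m) = complex_of_real
      ((\<Sum>w\<leftarrow>ws. (Re w * cos p + Im w * sin p) ^ m) + ((\<Sum>l\<leftarrow>ls p. l ^ m) - (\<Sum>l\<leftarrow>ls' p. l ^ m)))" for p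
    unfolding ls(2) ls'_def by (simp add: o_def)
  show ?thesis
  proof (cases "m < 2")
    case True
    hence e: "{0<..<m} = {}" by auto
    have "(\<Sum>l\<leftarrow>ls p. l ^ m) - (\<Sum>l\<leftarrow>ls' p. l ^ m) = 0" for p
    proof -
      obtain c where "\<And>t. complex_of_real ((\<Sum>l\<leftarrow>ls t. l ^ m) - (\<Sum>l\<leftarrow>ls' t. l ^ m))
        = (\<Sum>k\<in>{0<..<m}. c k * cis (freq m k * t))"
        using gap[of m] unfolding trig_gap_def by blast
      hence "complex_of_real ((\<Sum>l\<leftarrow>ls p. l ^ m) - (\<Sum>l\<leftarrow>ls' p. l ^ m)) = 0"
        by (simp only: e sum.empty)
      thus ?thesis by (simp only: of_real_eq_0_iff)
    qed
    hence fin: "mat_trace (dir_mat A B p ^\<^sub>m m) = complex_of_real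
      ((\<Sum>w\<leftarrow>ws. (Re w * cos p + Im w * sin p) ^ m) +
       (if m < 2 then 0 else \<Sum>k\<le>m - 2. (\<lambda>_. 0) k * cos p ^ (m - 2 - k) * sin p ^ k))" for p
      unfolding rep using True by (simp only: if_True)
    show ?thesis by (rule that[OF quad _ fin]) auto
  next
    case False
    hence m: "m \<ge> 2" by simp
    define R where "R = \<bar>R0\<bar> + (\<Sum>w\<leftarrow>ws. 2 * norm w) + 1"
    have nn: "0 \<le> (\<Sum>w\<leftarrow>ws. 2 * norm w)" by (rule sum_list_nonneg) auto
    have R: "R > 0" unfolding R_def using nn by linarith
    have lsR: "\<bar>l\<bar> \<le> R" if "l \<in> set (ls t)" for l t
      using ls(4)[OF that] nn unfolding R_def by linarith
    have wsR: "2 * norm w \<le> R" if "w \<in> set ws" for w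
    proof -
      have "2 * norm w \<le> (\<Sum>w\<leftarrow>ws. 2 * norm w)"
        by (rule member_le_sum_list) (use that in auto)
      thus ?thesis unfolding R_def by linarith
    qed
    let ?h = "\<lambda>r x t. Re (det (complex_of_real (r * cos (x - t)) \<cdot>\<^sub>m 1\<^sub>m n - dir_mat A B t))"
    let ?h' = "\<lambda>r x t. \<Prod>w\<leftarrow>ws. r * cos (x - t) - (Re w * cos t + Im w * sin t)"
    interpret F: cos_family ?h ls R n by (rule cos_family_dir_mat[OF A(1) B(1) ls(1) lsR R ls(3)])
    interpret F': cos_family ?h' ls' R n unfolding ls'_def by (rule cos_family_scalars[OF ws(1) wsR R])
    define V where "V z = F.potential (m - 1) z - F'.potential (m - 1) z" for z
    note PD0 = potential_difference[OF F.cos_family_axioms F'.cos_family_axioms m gap]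
    have PD1: "integrable polar V" using PD0(1) unfolding V_def[abs_def] .
    have PD2: "(\<integral>z. cos (snd z - p) ^ (m - 2) * V z \<partial>polar)
      = ((\<Sum>l\<leftarrow>ls p. l ^ m) - (\<Sum>l\<leftarrow>ls' p. l ^ m)) / (real m * real (m - 1))" for p
      using PD0(2)[of p] unfolding V_def .
    have absh: "\<bar>?h r x t\<bar> = norm (det (complex_of_real (r * cos (x - t)) \<cdot>\<^sub>m 1\<^sub>m n - dir_mat A B t))" for r x t
      unfolding ls(3) by simp
    have V: "0 \<le> V (r, x) \<and> (cos x < 0 \<or> sin x < 0 \<longrightarrow> V (r, x) = 0)" if "r \<notin> norm ` set ws" for r x
    proof (cases "r \<in> {0<..<R}")
      case True
      hence r: "r > 0" "r < R" by auto
      have "Complex (r * cos x) (r * sin x) \<notin> set ws"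
      proof
        assume "Complex (r * cos x) (r * sin x) \<in> set ws"
        moreover have "Complex (r * cos x) (r * sin x) = of_real r * cis x" by (simp add: complex_eq_iff)
        hence "norm (Complex (r * cos x) (r * sin x)) = r" using r by (simp only: norm_mult norm_cis norm_of_real)
        ultimately have "r \<in> norm ` set ws" by (metis imageI)
        thus False using that by blast
      qed
      note G = potential_gap[OF A B ws(1,3) this]
      have pot: "F.potential (m - 1) (r, x) = r ^ (m - 1) * (\<integral>t. ln \<bar>?h r x t\<bar> \<partial>circle)"
        "F'.potential (m - 1) (r, x) = r ^ (m - 1) * (\<integral>t. ln \<bar>?h' r x t\<bar> \<partial>circle)"
        unfolding F.potential_def F'.potential_def F.weighted_log_def F'.weighted_log_def using r by simp_all
      show ?thesis unfolding V_def pot absh right_diff_distrib[symmetric]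
      proof (intro conjI impI)
        show "0 \<le> r ^ (m - 1) * ((\<integral>t. ln (norm (det (complex_of_real (r * cos (x - t)) \<cdot>\<^sub>m 1\<^sub>m n - dir_mat A B t))) \<partial>circle)
          - (\<integral>t. ln \<bar>?h' r x t\<bar> \<partial>circle))" using G(1) r(1) by simp
        assume "cos x < 0 \<or> sin x < 0"
        from G(2)[OF r(1) this]
        show "r ^ (m - 1) * ((\<integral>t. ln (norm (det (complex_of_real (r * cos (x - t)) \<cdot>\<^sub>m 1\<^sub>m n - dir_mat A B t))) \<partial>circle)
          - (\<integral>t. ln \<bar>?h' r x t\<bar> \<partial>circle)) = 0" by simp
      qed
    next
      case False
      thus ?thesis unfolding V_def F.potential_def F'.potential_def F.weighted_log_def F'.weighted_log_def by simp
    qed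
    \<comment> \<open>Jensen's inequality excludes the eigenvalues of \<open>M\<close>; the circles through them are null sets.\<close>
    have ae: "AE z in polar. fst z \<notin> norm ` set ws"
    proof -
      have N: "norm ` set ws \<in> null_sets lborel" by (intro finite_imp_null_set_lborel) simp
      have "norm ` set ws \<times> space circle \<in> null_sets (lborel \<Otimes>\<^sub>M circle)"
        by (rule circle.times_in_null_sets1[OF N]) simp
      from AE_not_in[OF this] show ?thesis unfolding polar_def by eventually_elim auto
    qed
    define J where "J k = (\<integral>z. cos (snd z) ^ (m - 2 - k) * sin (snd z) ^ k * V z \<partial>polar)" for k
    have J0: "0 \<le> J k" for k unfolding J_def
    proof (rule integral_nonneg_AE)
      show "AE z in polar. 0 \<le> cos (snd z) ^ (m - 2 - k) * sin (snd z) ^ k * V z"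
        using ae
      proof eventually_elim
        case (elim z)
        have Vz: "0 \<le> V z" "cos (snd z) < 0 \<or> sin (snd z) < 0 \<longrightarrow> V z = 0"
          using V[OF elim, of "snd z"] by auto
        show ?case
        proof (cases "cos (snd z) < 0 \<or> sin (snd z) < 0")
          case False
          thus ?thesis using Vz by (intro mult_nonneg_nonneg zero_le_power) auto
        qed (use Vz in auto)
      qed
    qed
    have VI: "integrable polar (\<lambda>z. cos (snd z) ^ i * sin (snd z) ^ k * V z)" for i k
    proof (rule integrable_bounded_mult[OF PD1])
      show "\<bar>cos (snd z) ^ i * sin (snd z) ^ k\<bar> \<le> 1" for z :: "real \<times> real"
        unfolding abs_mult power_abs by (intro mult_le_one power_le_one) auto
    qed measurable
    define I where "I k = real m * real (m - 1) * (real ((m - 2) choose k) * J k)" for k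
    have eq: "(\<Sum>l\<leftarrow>ls p. l ^ m) - (\<Sum>l\<leftarrow>ls' p. l ^ m) = (\<Sum>k\<le>m - 2. I k * cos p ^ (m - 2 - k) * sin p ^ k)" for p
    proof -
      have "cos (y - p) ^ (m - 2) = (\<Sum>k\<le>m - 2. real ((m - 2) choose k) * cos p ^ (m - 2 - k) * sin p ^ k * (cos y ^ (m - 2 - k) * sin y ^ k))" for y
      proof -
        have "cos (y - p) ^ (m - 2) = (sin y * sin p + cos y * cos p) ^ (m - 2)" by (simp add: cos_diff add.commute)
        also have "\<dots> = (\<Sum>k\<le>m - 2. real ((m - 2) choose k) * (sin y * sin p) ^ k * (cos y * cos p) ^ (m - 2 - k))"
          by (rule binomial_ring)
        finally show ?thesis by (simp add: power_mult_distrib mult_ac)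
      qed
      hence "(\<integral>z. cos (snd z - p) ^ (m - 2) * V z \<partial>polar)
        = (\<integral>z. (\<Sum>k\<le>m - 2. real ((m - 2) choose k) * cos p ^ (m - 2 - k) * sin p ^ k * (cos (snd z) ^ (m - 2 - k) * sin (snd z) ^ k * V z)) \<partial>polar)"
        by (simp only: sum_distrib_right mult.assoc)
      also have "\<dots> = (\<Sum>k\<le>m - 2. real ((m - 2) choose k) * cos p ^ (m - 2 - k) * sin p ^ k * J k)"
        unfolding J_def using VI by (subst Bochner_Integration.integral_sum) auto
      finally have "((\<Sum>l\<leftarrow>ls p. l ^ m) - (\<Sum>l\<leftarrow>ls' p. l ^ m)) / (real m * real (m - 1))
        = (\<Sum>k\<le>m - 2. real ((m - 2) choose k) * cos p ^ (m - 2 - k) * sin p ^ k * J k)"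
        unfolding PD2 .
      hence "(\<Sum>l\<leftarrow>ls p. l ^ m) - (\<Sum>l\<leftarrow>ls' p. l ^ m)
        = (\<Sum>k\<le>m - 2. real ((m - 2) choose k) * cos p ^ (m - 2 - k) * sin p ^ k * J k) * (real m * real (m - 1))"
        by (subst (asm) nonzero_divide_eq_eq) (use m in auto)
      thus ?thesis unfolding I_def sum_distrib_right by (simp only: mult_ac)
    qed
    have I0: "0 \<le> I k" for k unfolding I_def using J0 by simp
    have fin: "mat_trace (dir_mat A B p ^\<^sub>m m) = complex_of_real
      ((\<Sum>w\<leftarrow>ws. (Re w * cos p + Im w * sin p) ^ m) +
       (if m < 2 then 0 else \<Sum>k\<le>m - 2. I k * cos p ^ (m - 2 - k) * sin p ^ k))" for p
      unfolding rep eq using False by (simp only: if_False)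
    show ?thesis by (rule that[OF quad I0 fin])
  qed
qed

definition nonneg_poly :: "real poly \<Rightarrow> bool" where
  "nonneg_poly p \<longleftrightarrow> (\<forall>k. 0 \<le> coeff p k)"

lemma nonneg_poly_add: "nonneg_poly p \<Longrightarrow> nonneg_poly q \<Longrightarrow> nonneg_poly (p + q)"
  unfolding nonneg_poly_def by simp

lemma nonneg_poly_mult: "nonneg_poly p \<Longrightarrow> nonneg_poly q \<Longrightarrow> nonneg_poly (p * q)"
  unfolding nonneg_poly_def by (auto simp: coeff_mult intro!: sum_nonneg)

lemma nonneg_poly_power: "nonneg_poly p \<Longrightarrow> nonneg_poly (p ^ k)"
proof (induction k)
  case 0
  show ?case by (simp add: nonneg_poly_def coeff_1)
qed (simp add: nonneg_poly_mult)

lemma nonneg_poly_sum: "(\<And>i. i \<in> S \<Longrightarrow> nonneg_poly (f i)) \<Longrightarrow> nonneg_poly (sum f S)"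
  unfolding nonneg_poly_def by (auto simp: coeff_sum intro!: sum_nonneg)

lemma nonneg_poly_sum_list: "(\<And>i. i \<in> set xs \<Longrightarrow> nonneg_poly (f i)) \<Longrightarrow> nonneg_poly (\<Sum>i\<leftarrow>xs. f i)"
  by (induction xs) (auto intro: nonneg_poly_add simp: nonneg_poly_def)

lemma nonneg_poly_linear: "0 \<le> a \<Longrightarrow> 0 \<le> b \<Longrightarrow> nonneg_poly [:a, b:]"
  unfolding nonneg_poly_def by (auto simp: coeff_pCons split: nat.split)

text \<open>For \<open>s = tan p\<close> the matrix \<open>A + s B\<close> is \<open>dir_mat A B p\<close> divided by \<open>cos p\<close>. Dividing by
\<open>cos\<^sup>m p\<close> turns a sum of degree \<open>m\<close> in \<open>cos p\<close> and \<open>sin p\<close> into a polynomial in \<open>s\<close>, and one of degree \<open>m - 2\<close>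
into \<open>1 / cos\<^sup>2 p = 1 + s\<^sup>2\<close> times a polynomial in \<open>s\<close>.\<close>
lemma trace_pencil_nonneg_poly:
  fixes A B :: "complex mat"
  assumes A: "A \<in> carrier_mat n n" "pos_semidef_mat A" and B: "B \<in> carrier_mat n n" "pos_semidef_mat B"
  shows "\<exists>p. map_poly complex_of_real p = mat_trace (linear_pencil A B ^\<^sub>m m) \<and> nonneg_poly p"
proof -
  obtain ws I where ws: "\<And>w. w \<in> set ws \<Longrightarrow> 0 \<le> Re w \<and> 0 \<le> Im w" and I: "\<And>k. 0 \<le> (I k :: real)"
    and rep: "\<And>p. mat_trace (dir_mat A B p ^\<^sub>m m) = complex_of_real
      ((\<Sum>w\<leftarrow>ws. (Re w * cos p + Im w * sin p) ^ m) +
       (if m < 2 then 0 else \<Sum>k\<le>m - 2. I k * cos p ^ (m - 2 - k) * sin p ^ k))"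
    using trace_representation[OF A B, of m] by blast
  define P where "P = (\<Sum>w\<leftarrow>ws. [:Re w, Im w:] ^ m) +
    (if m < 2 then 0 else ([:1, 0:] + [:0, 1:] * [:0, 1:]) * (\<Sum>k\<le>m - 2. [:I k, 0:] * [:0, 1:] ^ k))"
  have nn: "nonneg_poly P"
  proof -
    have 1: "nonneg_poly (\<Sum>w\<leftarrow>ws. [:Re w, Im w:] ^ m)"
      by (intro nonneg_poly_sum_list nonneg_poly_power nonneg_poly_linear) (use ws in auto)
    have 2: "nonneg_poly (([:1, 0:] + [:0, 1:] * [:0, 1:]) * (\<Sum>k\<le>m - 2. [:I k, 0:] * [:0, 1:] ^ k))"
      by (intro nonneg_poly_mult nonneg_poly_add nonneg_poly_sum nonneg_poly_power nonneg_poly_linear I) auto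
    have 3: "nonneg_poly 0" by (simp add: nonneg_poly_def)
    show ?thesis unfolding P_def
      by (rule nonneg_poly_add[OF 1]) (cases "m < 2"; simp only: if_True if_False 2 3)
  qed
  have ev: "poly (mat_trace (linear_pencil A B ^\<^sub>m m)) (complex_of_real s) = complex_of_real (poly P s)" for s
  proof -
    define p where "p = arctan s"
    define c where "c = cos p"
    have c: "c > 0" unfolding c_def p_def by (simp add: cos_arctan add_pos_nonneg)
    have s: "sin p = s * c"
    proof -
      have "tan p = s" unfolding p_def by (rule tan_arctan)
      thus ?thesis using c unfolding tan_def c_def by (simp add: field_simps)
    qed
    have c2: "c\<^sup>2 * (1 + s\<^sup>2) = 1"
      using sin_cos_squared_add[of p] unfolding s c_def[symmetric] by (simp add: power_mult_distrib algebra_simps)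
    have D: "dir_mat A B p = complex_of_real c \<cdot>\<^sub>m (A + complex_of_real s \<cdot>\<^sub>m B)"
      unfolding dir_mat_def s c_def[symmetric]
      by (rule eq_matI) (use A B in \<open>auto simp: algebra_simps\<close>)
    have X: "A + complex_of_real s \<cdot>\<^sub>m B \<in> carrier_mat n n" using A B by simp
    have "complex_of_real (c ^ m) * mat_trace ((A + complex_of_real s \<cdot>\<^sub>m B) ^\<^sub>m m) = mat_trace (dir_mat A B p ^\<^sub>m m)"
      unfolding D smult_pow_mat[OF X] mat_trace_smult[OF pow_carrier_mat[OF X]] by simp
    also have "\<dots> = complex_of_real (c ^ m * poly P s)"
    proof -
      have "(\<Sum>w\<leftarrow>ws. (Re w * c + Im w * (s * c)) ^ m) = c ^ m * poly (\<Sum>w\<leftarrow>ws. [:Re w, Im w:] ^ m) s"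
      proof (induction ws)
        case (Cons w ws)
        have "Re w * c + Im w * (s * c) = c * (Re w + s * Im w)" by (simp add: algebra_simps)
        hence "(Re w * c + Im w * (s * c)) ^ m = c ^ m * (Re w + s * Im w) ^ m"
          by (simp only: power_mult_distrib)
        thus ?case using Cons by (simp add: distrib_left)
      qed simp
      moreover have "(\<Sum>k\<le>m - 2. I k * c ^ (m - 2 - k) * (s * c) ^ k) = c ^ m * ((1 + s\<^sup>2) * (\<Sum>k\<le>m - 2. I k * s ^ k))" if "\<not> m < 2"
      proof -
        have "(\<Sum>k\<le>m - 2. I k * c ^ (m - 2 - k) * (s * c) ^ k) = (\<Sum>k\<le>m - 2. c ^ (m - 2) * (I k * s ^ k))"
        proof (rule sum.cong)
          fix k assume "k \<in> {..m - 2}"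
          hence "c ^ (m - 2) = c ^ (m - 2 - k) * c ^ k"
            by (simp only: power_add[symmetric] le_add_diff_inverse2 atMost_iff)
          thus "I k * c ^ (m - 2 - k) * (s * c) ^ k = c ^ (m - 2) * (I k * s ^ k)"
            by (simp add: power_mult_distrib)
        qed simp
        also have "\<dots> = c ^ (m - 2) * (\<Sum>k\<le>m - 2. I k * s ^ k)" by (simp add: sum_distrib_left)
        also have "c ^ (m - 2) = c ^ m * (1 + s\<^sup>2)"
        proof -
          have "c ^ m = c ^ (m - 2) * c\<^sup>2" using that
            by (metis le_add_diff_inverse2 not_less power_add)
          thus ?thesis using c2 by (simp add: mult.assoc)
        qed
        finally show ?thesis by (simp add: mult.assoc)
      qed
      ultimately have "(\<Sum>w\<leftarrow>ws. (Re w * c + Im w * (s * c)) ^ m) +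
        (if m < 2 then 0 else \<Sum>k\<le>m - 2. I k * c ^ (m - 2 - k) * (s * c) ^ k) = c ^ m * poly P s"
        unfolding P_def by (simp add: poly_sum distrib_left distrib_right power2_eq_square mult.assoc)
      thus ?thesis unfolding rep s c_def[symmetric] by (simp only:)
    qed
    finally have "mat_trace ((A + complex_of_real s \<cdot>\<^sub>m B) ^\<^sub>m m) = complex_of_real (poly P s)"
      using c by simp
    thus ?thesis using poly_mat_trace_linear_pencil[OF A(1) B(1), of m "complex_of_real s"] by simp
  qed
  have "map_poly complex_of_real P = mat_trace (linear_pencil A B ^\<^sub>m m)"
  proof (rule ccontr)
    define q where "q = map_poly complex_of_real P - mat_trace (linear_pencil A B ^\<^sub>m m)"
    assume "map_poly complex_of_real P \<noteq> mat_trace (linear_pencil A B ^\<^sub>m m)"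
    hence "q \<noteq> 0" unfolding q_def by simp
    hence "finite {z. poly q z = 0}" by (rule poly_roots_finite)
    moreover have "range complex_of_real \<subseteq> {z. poly q z = 0}" unfolding q_def using ev by auto
    ultimately have "finite (range complex_of_real)" by (rule finite_subset[rotated])
    hence "finite (UNIV :: real set)" by (rule finite_imageD) (auto intro: injI)
    thus False using infinite_UNIV_char_0 by blast
  qed
  thus ?thesis using nn by blast
qed

theorem theorem1p2:
  fixes m n :: nat and A B :: "complex mat"
  assumes "m \<le> 13" and "n \<ge> 1"
    and "A \<in> carrier_mat n n" and "B \<in> carrier_mat n n"
    and "pos_semidef_mat A" and "pos_semidef_mat B"
  shows "\<exists>p :: real poly.
           map_poly complex_of_real p = mat_trace (linear_pencil A B ^\<^sub>m m) \<and>
           (\<forall>k. 0 \<le> coeff p k)"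
  using trace_pencil_nonneg_poly[OF assms(3,5,4,6), of m] unfolding nonneg_poly_def .

end
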